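(* Let $k$ be a field, $q\in k$ a primitive $2\ell$-th root of unity, $n\in\mathbb N$ with $2\ell<n$, and $w_1,w_2\notin\mathbb Z$. In $b_n^x=b_n^x(-[2],-[w_1],-[w_2],[w_1+1],[w_2+1],\kappa_{LR})$, let $E$ denote the basis element of the one-dimensional cell module $\mathcal S_n(-n)$ (the half-diagram with $n$ undecorated propagating lines). Then the $k$-linear map $\xi:\mathcal S_n(-n)\to\mathcal S_n(-n+2\ell)$ given by $$E\mapsto\sum_{D}h_3(D)\,D,$$ the sum over the half-diagram basis of $\mathcal S_n(-n+2\ell)$, is a non-zero $b_n^x$-module homomorphism.
   Context: Symplectic blob algebra: generated by $e,e_1,\dots,e_{n-1},f$; relations $e^2=\delta_Le$, $e_i^2=\delta e_i$, $f^2=\delta_Rf$, $e_ie_j=e_je_i$ ($|i-j|\ge2$), $e_1ee_1=\kappa_Le_1$, $e_ie_{i\pm1}e_i=e_i$, $e_{n-1}fe_{n-1}=\kappa_Re_{n-1}$, $IJI=\kappa_{LR}I$, $JIJ=\kappa_{LR}J$ ($I$, $J$ the products of the generators $e_i$ with $i$ odd, resp. even, where $e_0=e$, $e_n=f$), here with $\delta=-[2]$, $\delta_L=-[w_1]$, $\delta_R=-[w_2]$, $\kappa_L=[w_1+1]$, $\kappa_R=[w_2+1]$. Diagrammatically: $e$ = identity with a left blob on line 1, $f$ = identity with a right blob on line $n$, $e_i$ = cup–cap at $i,i+1$; lines may carry a left blob if deformable to the left edge without crossing, a right blob if deformable to the right edge. Quantum numbers: $[x]=\frac{q^x-q^{-x}}{q-q^{-1}}$;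 $Q_i=q^{w_i}\in k^\times$ formal, $[w_i+x]=\frac{Q_iq^x-Q_i^{-1}q^{-x}}{q-q^{-1}}$, and $w_i\notin\mathbb Z$ means $Q_i\notin\pm q^{\mathbb Z}$. $[w]_\ell!=[w][w-1]\cdots[w-\ell+1]$. Cell module $\mathcal S_n(-n+2\ell)$: basis of half-diagrams with $n$ top vertices, $\ell$ non-crossing arcs and $n-2\ell$ undecorated propagating lines; arcs may carry a left blob (if deformable to the left edge) or a right blob (if deformable to the right edge). A generator acts on a half-diagram by stacking on top and straightening (undecorated loop $\to\delta$, loop with left blob $\to\kappa_L$, loop with right blob $\to\kappa_R$, two left blobs on a line $\to\delta_L$ times one, two right blobs $\to\delta_R$ times one), the result being $0$ if the number of unblobbed propagating lines decreases. $\mathcal S_n(-n)$ is one-dimensional with all generators acting by $0$. Hook product: number top vertices $1,\dots,n$ left to right and bottom ends of propagating lines $n+1,\dots,2n-2\ell$ right to left; each line $g=(a,a+2b+1)$, $b\ge0$. $h_3(g)=[b+1]$ for an undecorated arc; $1$ (resp. $-1$) for a propagating line with $a\equiv1,\dots,2\ell$ (resp. $2\ell+1,\dots,4\ell$) mod $4\ell$; $\left[\frac{a+2b+1}{2}\right]\left[\frac{2w_1-a+1}{2}\right]$ for a left-blobbed arc; $\left[\frac{n-a+1}{2}\right]\left[\frac{2w_2-n+a+2b+1}{2}\right]$ for a right-blobbed arc. $h_3(D)=[\ell]!\,[w_1]_\ell!\,[w_2]_\ell!/\prod_{g\in D}h_3(g)$, computed as a rational function in indeterminates $q,Q_1,Q_2$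 with all cancellations performed before specialising. *)

theory Defs
  imports Main "HOL-Computational_Algebra.Polynomial" "HOL-Computational_Algebra.Fraction_Field"
begin

datatype deco = Undec | LBlob | RBlob

text \<open>A half-diagram on top vertices 1..n is a function from vertices to
  either Prop (vertex carries an undecorated propagating line) or Arc w d
  (vertex is joined by an arc to vertex w, the arc carrying decoration d).\<close>
datatype hv = Prop | Arc nat deco

type_synonym hdiag = "nat \<Rightarrow> hv"

definition valid_hd :: "nat \<Rightarrow> nat \<Rightarrow> hdiag \<Rightarrow> bool" where
  "valid_hd n l D \<longleftrightarrow>
     (\<forall>v. (v < 1 \<or> n < v) \<longrightarrow> D v = Prop) \<and>
     (\<forall>v w d. D v = Arc w d \<longrightarrow> 1 \<le> w \<and> w \<le> n \<and> w \<noteq> v \<and> D w = Arc v d) \<and>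
     (\<forall>a b d a' b' d'. D a = Arc b d \<and> D a' = Arc b' d' \<and> a < b \<and> a' < b'
          \<longrightarrow> \<not> (a < a' \<and> a' < b \<and> b < b')) \<and>
     (\<forall>a b d p. D a = Arc b d \<and> a < p \<and> p < b \<longrightarrow> D p \<noteq> Prop) \<and>
     card {v \<in> {1..n}. D v \<noteq> Prop} = 2 * l \<and>
     (\<forall>a b. a < b \<and> D a = Arc b LBlob \<longrightarrow>
          (\<forall>v. 1 \<le> v \<and> v < a \<longrightarrow> (\<exists>w d. D v = Arc w d \<and> w < a))) \<and>
     (\<forall>a b. a < b \<and> D a = Arc b RBlob \<longrightarrow>
          (\<forall>v. b < v \<and> v \<le> n \<longrightarrow> (\<exists>w d. D v = Arc w d \<and> b < w)))"

definition qn :: "'k::field \<Rightarrow> int \<Rightarrow> 'k" where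
  "qn q x = (q powi x - q powi (- x)) / (q - inverse q)"

definition qw :: "'k::field \<Rightarrow> 'k \<Rightarrow> int \<Rightarrow> 'k" where
  "qw q Q x = (Q * q powi x - inverse Q * q powi (- x)) / (q - inverse q)"

definition prim_root :: "'k::field \<Rightarrow> nat \<Rightarrow> bool" where
  "prim_root q m \<longleftrightarrow> 0 < m \<and> q ^ m = 1 \<and> (\<forall>j. 0 < j \<and> j < m \<longrightarrow> q ^ j \<noteq> 1)"

datatype gen = GenE | GenF | GenEi nat

definition valid_gen :: "nat \<Rightarrow> gen \<Rightarrow> bool" where
  "valid_gen n g = (case g of GenEi i \<Rightarrow> 1 \<le> i \<and> i + 1 \<le> n | _ \<Rightarrow> True)"

text \<open>Loop values: delta = -[2], kappa_L = [w1+1], kappa_R = [w2+1].\<close>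
definition loopval :: "'k::field \<Rightarrow> 'k \<Rightarrow> 'k \<Rightarrow> deco \<Rightarrow> 'k" where
  "loopval q Q1 Q2 d = (case d of Undec \<Rightarrow> - qn q 2 | LBlob \<Rightarrow> qw q Q1 1 | RBlob \<Rightarrow> qw q Q2 1)"

text \<open>Joining two arc pieces: two left blobs give delta_L = -[w1], two right blobs
  delta_R = -[w2]; a left and a right blob on one line cannot occur when
  propagating lines are present (result None).\<close>
fun combine :: "'k::field \<Rightarrow> 'k \<Rightarrow> 'k \<Rightarrow> deco \<Rightarrow> deco \<Rightarrow> ('k \<times> deco) option" where
  "combine q Q1 Q2 Undec d = Some (1, d)"
| "combine q Q1 Q2 d Undec = Some (1, d)"
| "combine q Q1 Q2 LBlob LBlob = Some (- qw q Q1 0, LBlob)"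
| "combine q Q1 Q2 RBlob RBlob = Some (- qw q Q2 0, RBlob)"
| "combine q Q1 Q2 _ _ = None"

definition cup :: "nat \<Rightarrow> hdiag \<Rightarrow> hdiag" where
  "cup i D = D(i := Arc (Suc i) Undec, Suc i := Arc i Undec)"

text \<open>g acting on a half-diagram D gives either 0 (None) or c times a half-diagram.\<close>
fun act :: "'k::field \<Rightarrow> 'k \<Rightarrow> 'k \<Rightarrow> nat \<Rightarrow> gen \<Rightarrow> hdiag \<Rightarrow> ('k \<times> hdiag) option" where
  "act q Q1 Q2 n GenE D =
     (case D 1 of Prop \<Rightarrow> None
      | Arc b d \<Rightarrow> (case d of
           Undec \<Rightarrow> Some (1, D(1 := Arc b LBlob, b := Arc 1 LBlob))
         | LBlob \<Rightarrow> Some (- qw q Q1 0, D)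
         | RBlob \<Rightarrow> None))"
| "act q Q1 Q2 n GenF D =
     (case D n of Prop \<Rightarrow> None
      | Arc b d \<Rightarrow> (case d of
           Undec \<Rightarrow> Some (1, D(n := Arc b RBlob, b := Arc n RBlob))
         | RBlob \<Rightarrow> Some (- qw q Q2 0, D)
         | LBlob \<Rightarrow> None))"
| "act q Q1 Q2 n (GenEi i) D =
     (case (D i, D (Suc i)) of
        (Arc a d1, Arc b d2) \<Rightarrow>
          (if a = Suc i then Some (loopval q Q1 Q2 d1, cup i D)
           else (case combine q Q1 Q2 d1 d2 of None \<Rightarrow> None
                 | Some (c, d) \<Rightarrow> Some (c, cup i (D(a := Arc b d, b := Arc a d)))))
      | (Arc a d, Prop) \<Rightarrow> (if d = Undec then Some (1, cup i (D(a := Prop))) else None)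
      | (Prop, Arc b d) \<Rightarrow> (if d = Undec then Some (1, cup i (D(b := Prop))) else None)
      | (Prop, Prop) \<Rightarrow> None)"

text \<open>Action on vectors of the cell module S_n(-n+2l), vectors being coefficient
  functions on the half-diagram basis.\<close>
definition act_vec :: "'k::field \<Rightarrow> 'k \<Rightarrow> 'k \<Rightarrow> nat \<Rightarrow> nat \<Rightarrow> gen \<Rightarrow> (hdiag \<Rightarrow> 'k) \<Rightarrow> (hdiag \<Rightarrow> 'k)" where
  "act_vec q Q1 Q2 n l g v = (\<lambda>E. \<Sum>D\<in>{D. valid_hd n l D}.
       (case act q Q1 Q2 n g D of None \<Rightarrow> 0
        | Some (c, E') \<Rightarrow> (if E' = E then c * v D else 0)))"

type_synonym 'k rfun = "'k poly poly poly fract"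

definition eval3 :: "'k::field poly poly poly \<Rightarrow> 'k \<Rightarrow> 'k \<Rightarrow> 'k \<Rightarrow> 'k" where
  "eval3 p x y z = poly (map_poly (\<lambda>r. poly (map_poly (\<lambda>s. poly s x) r) y) p) z"

text \<open>indeterminate q (evaluated at the first argument of eval3), Q1 (second), Q2 (third)\<close>
definition Vq :: "'k::field rfun" where "Vq = Fract [:[:[:0, 1:]:]:] 1"
definition VQ1 :: "'k::field rfun" where "VQ1 = Fract [:[:0, 1:]:] 1"
definition VQ2 :: "'k::field rfun" where "VQ2 = Fract [:0, 1:] 1"

definition fqn :: "int \<Rightarrow> 'k::field rfun" where
  "fqn x = (Vq powi x - Vq powi (- x)) / (Vq - inverse Vq)"

definition fqw :: "'k::field rfun \<Rightarrow> int \<Rightarrow> 'k rfun" where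
  "fqw Q x = (Q * Vq powi x - inverse Q * Vq powi (- x)) / (Vq - inverse Vq)"

text \<open>F specialises to v at (q,Q1,Q2): after cancelling, the denominator does not
  vanish and the value is v (well defined independently of the representation).\<close>
definition spec_at :: "'k::field rfun \<Rightarrow> 'k \<Rightarrow> 'k \<Rightarrow> 'k \<Rightarrow> 'k \<Rightarrow> bool" where
  "spec_at F q Q1 Q2 v \<longleftrightarrow>
     (\<exists>P R. F = Fract P R \<and> eval3 R q Q1 Q2 \<noteq> 0 \<and> v = eval3 P q Q1 Q2 / eval3 R q Q1 Q2)"

definition specializable :: "'k::field rfun \<Rightarrow> 'k \<Rightarrow> 'k \<Rightarrow> 'k \<Rightarrow> bool" where
  "specializable F q Q1 Q2 \<longleftrightarrow> (\<exists>v. spec_at F q Q1 Q2 v)"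

definition specialize :: "'k::field rfun \<Rightarrow> 'k \<Rightarrow> 'k \<Rightarrow> 'k \<Rightarrow> 'k" where
  "specialize F q Q1 Q2 = (THE v. spec_at F q Q1 Q2 v)"

text \<open>Factor h_3(g) for the line g whose smaller endpoint is the top vertex a
  (factor 1 at right endpoints of arcs, so each line is counted once).\<close>
definition h3_fac :: "nat \<Rightarrow> nat \<Rightarrow> hdiag \<Rightarrow> nat \<Rightarrow> 'k::field rfun" where
  "h3_fac n l D a =
     (case D a of
        Prop \<Rightarrow> (if (a - 1) mod (4 * l) < 2 * l then 1 else - 1)
      | Arc c d \<Rightarrow> (if a < c then
           (case d of
              Undec \<Rightarrow> fqn ((int c - int a + 1) div 2)
            | LBlob \<Rightarrow> fqn (int c div 2) * fqw VQ1 ((1 - int a) div 2)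
            | RBlob \<Rightarrow> fqn ((int n - int a + 1) div 2) * fqw VQ2 ((int c - int n) div 2))
         else 1))"

definition h3 :: "nat \<Rightarrow> nat \<Rightarrow> hdiag \<Rightarrow> 'k::field rfun" where
  "h3 n l D =
     ((\<Prod>j\<in>{1..l}. fqn (int j)) * (\<Prod>j<l. fqw VQ1 (- int j)) * (\<Prod>j<l. fqw VQ2 (- int j)))
     / (\<Prod>a\<in>{1..n}. h3_fac n l D a)"

end

theory Submission
  imports Defs
begin

text \<open>
  A half-diagram is a non-crossing matching in which no arc covers a propagating line. The diagrams
  \<open>D\<close> with \<open>e\<^sub>i D\<close> proportional to a given \<open>E\<close> arise from \<open>E\<close> by
  changing the blob on its cup at \<open>i, i + 1\<close> or by cutting a line that is visible from the cup and
  joining the two pieces to \<open>i\<close> and \<open>i + 1\<close>. Cutting the successive siblings of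
  the cup contributes differences of quotients \<open>[s - 1] / [s]\<close>, so the sum over all siblings on one
  side telescopes. By the Pluecker relations for quantum numbers the total is then exactly \<open>0\<close> over
  the field of rational functions, unless the cup is next to a propagating line; in that case there
  remains an explicit defect in which the hook product of \<open>E\<close> has no factor \<open>[l]\<close> in
  its denominator, and which specialises to \<open>0\<close> because of the factor \<open>[l]\<close> in the numerator
  of \<open>h\<^sub>3\<close> together with \<open>q ^ l = - 1\<close>.
\<close>

section \<open>Quantum numbers and specialisation\<close>

text \<open>At the root of unity the numerator of \<open>h3\<close> and some hook products vanish,
  so the coefficients cannot be compared factor by factor there. All identities are proved for
  generic \<open>q\<close>, \<open>Q1\<close>, \<open>Q2\<close>, where every hook is invertible,
  and carried over by the place \<open>sp\<close>. This works because of a count: a hook of size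
  \<open>s\<close> occupies \<open>2 * s\<close> of the \<open>2 * l\<close> vertices that carry
  arcs, so at most one hook has size \<open>l\<close>, and \<open>[l] * H E\<close> is always
  finite. The denominators of the defects are \<open>[S + 1]\<close> and \<open>[T + 1]\<close>,
  with \<open>2 * S\<close> and \<open>2 * T\<close> vertices in the gaps on the two sides of the
  cup. If one of them is \<open>[l]\<close>, it cancels the factor \<open>[l]\<close>, but then a
  propagating line has moved by \<open>2 * l\<close> places and changed its sign, in step with
  \<open>p powi int l = - 1\<close>, and the rest of the defect vanishes. This explains the period
  \<open>4 * l\<close> of the signs. Since \<open>2 * l < n\<close>, some propagating line exists,
  so a cup is never open to both edges. What lies to the right of a cup is treated by reflection,
  which exchanges \<open>Q1\<close> and \<open>Q2\<close>. The image is non-zero because the diagram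
  of nested arcs has exactly one hook \<open>[l]\<close>.\<close>

lemma qn_0 [simp]: "qn q 0 = 0"
  by (simp add: qn_def)

lemma qn_minus: "qn q (- x) = - qn q x"
  by (simp add: qn_def minus_divide_left)

lemma qn_1 [simp]: "q - inverse q \<noteq> 0 \<Longrightarrow> qn q 1 = 1"
  by (simp add: qn_def power_int_minus)

text \<open>The Pluecker relation for the points \<open>Q\<close>, \<open>q ^ x\<close>, \<open>q ^ y\<close>, \<open>q ^ z\<close>: all rational identities
  between hook factors are instances of it.\<close>
lemma qw_Plucker:
  fixes q Q :: "'a::field"
  assumes "q \<noteq> 0" "Q \<noteq> 0"
  shows "qw q Q x * qn q (y - z) + qw q Q y * qn q (z - x) + qw q Q z * qn q (x - y) = 0"
proof -
  define a b c where "a = q powi x" "b = q powi y" "c = q powi z"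
  have nz: "a \<noteq> 0" "b \<noteq> 0" "c \<noteq> 0" using assms by (auto simp: a_b_c_def power_int_eq_0_iff)
  define r where "r = inverse (q - inverse q)"
  have "(Q * a - inverse Q * inverse a) * (b / c - c / b)
     + (Q * b - inverse Q * inverse b) * (c / a - a / c)
     + (Q * c - inverse Q * inverse c) * (a / b - b / a) = 0"
    using nz assms by (simp add: divide_simps) (simp add: algebra_simps)
  then have "r * r * ((Q * a - inverse Q * inverse a) * (b / c - c / b)
     + (Q * b - inverse Q * inverse b) * (c / a - a / c)
     + (Q * c - inverse Q * inverse c) * (a / b - b / a)) = 0" by simp
  moreover have "qw q Q x = (Q * a - inverse Q * inverse a) * r"
     "qw q Q y = (Q * b - inverse Q * inverse b) * r"
     "qw q Q z = (Q * c - inverse Q * inverse c) * r"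
     "qn q (y - z) = (b / c - c / b) * r" "qn q (z - x) = (c / a - a / c) * r"
     "qn q (x - y) = (a / b - b / a) * r"
    using assms
    by (auto simp: qw_def qn_def a_b_c_def r_def power_int_minus power_int_diff field_simps)
  ultimately show ?thesis by (simp only:) (simp add: algebra_simps)
qed

lemma qw_at_1: "qw q 1 x = qn q x"
  by (simp add: qw_def qn_def)

lemma qn_Plucker:
  fixes q :: "'a::field"
  assumes "q \<noteq> 0"
  shows "qn q x * qn q (y - z) + qn q y * qn q (z - x) + qn q z * qn q (x - y) = 0"
  using qw_Plucker[OF assms, of 1 x y z] by (simp add: qw_at_1)

section \<open>Evaluation of polynomials and of rational functions at a point\<close>

lemma poly_map_poly_add:
  assumes "\<And>a b. h (a + b) = h a + h b" "h 0 = 0"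
  shows "poly (map_poly h (p + r)) z = poly (map_poly h p) z + poly (map_poly h r) (z :: 'a::comm_ring_1)"
proof -
  have "map_poly h (p + r) = map_poly h p + map_poly h r"
    by (rule poly_eqI) (simp add: coeff_map_poly assms)
  then show ?thesis by simp
qed

lemma poly_map_poly_smult:
  assumes "\<And>a b. h (a * b) = h a * h b" "h 0 = 0"
  shows "poly (map_poly h (smult c p)) z = h c * poly (map_poly h p) (z :: 'a::comm_ring_1)"
proof -
  have "map_poly h (smult c p) = smult (h c) (map_poly h p)"
    by (rule poly_eqI) (simp add: coeff_map_poly assms)
  then show ?thesis by simp
qed

text \<open>\<open>eval3\<close> evaluates one layer of polynomials at a time, the coefficient map
  \<open>h\<close> of a layer being the evaluation of the layer inside it. Only ring laws of
  \<open>h\<close> are used, so the layers can be handled one after the other.\<close>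

lemma poly_map_poly_mult:
  fixes h :: "'b::comm_ring_1 \<Rightarrow> 'a::comm_ring_1"
  assumes "\<And>a b. h (a + b) = h a + h b" "\<And>a b. h (a * b) = h a * h b" "h 0 = 0"
  shows "poly (map_poly h (p * r)) z = poly (map_poly h p) z * poly (map_poly h r) z"
proof (induction p)
  case (pCons a p)
  have "poly (map_poly h (pCons 0 s)) z = z * poly (map_poly h s) z" for s
    by (simp add: map_poly_pCons assms(3))
  then show ?case
    using pCons by (simp add: poly_map_poly_add[of h] assms poly_map_poly_smult map_poly_pCons algebra_simps)
qed simp

lemma eval3_0 [simp]: "eval3 0 x y z = 0"
  by (simp add: eval3_def)

lemma eval3_1 [simp]: "eval3 1 x y z = 1"
  by (simp add: eval3_def map_poly_1)

lemma eval3_add: "eval3 (p + r) x y z = eval3 p x y z + eval3 r x y z"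
  unfolding eval3_def by (simp add: poly_map_poly_add)

lemma eval3_mult: "eval3 (p * r) x y z = eval3 p x y z * eval3 r x y z"
  unfolding eval3_def by (simp add: poly_map_poly_add poly_map_poly_mult)

lemma eval3_minus_1: "eval3 (- 1) x y z = - 1"
proof -
  have "eval3 (- 1 + 1) x y z = eval3 (- 1) x y z + eval3 1 x y z" by (rule eval3_add)
  then show ?thesis by (simp add: eq_neg_iff_add_eq_0)
qed

lemma spec_at_add:
  assumes "spec_at F x y z u" "spec_at G x y z v"
  shows "spec_at (F + G) x y z (u + v)"
proof -
  obtain P R where 1: "F = Fract P R" "eval3 R x y z \<noteq> 0" "u = eval3 P x y z / eval3 R x y z"
    using assms(1) by (auto simp: spec_at_def)
  obtain P' R' where 2: "G = Fract P' R'" "eval3 R' x y z \<noteq> 0" "v = eval3 P' x y z / eval3 R' x y z"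
    using assms(2) by (auto simp: spec_at_def)
  \<comment> \<open>The side condition of \<open>add_fract\<close> holds because a polynomial with
    non-zero value is non-zero.\<close>
  have "F + G = Fract (P * R' + P' * R) (R * R')" using 1 2 by (metis add_fract eval3_0)
  moreover have "u + v = eval3 (P * R' + P' * R) x y z / eval3 (R * R') x y z"
    using 1 2 by (simp add: eval3_add eval3_mult add_frac_eq)
  moreover have "eval3 (R * R') x y z \<noteq> 0" using 1 2 by (simp add: eval3_mult)
  ultimately show ?thesis unfolding spec_at_def by blast
qed

lemma spec_at_mult:
  assumes "spec_at F x y z u" "spec_at G x y z v"
  shows "spec_at (F * G) x y z (u * v)"
proof -
  obtain P R where 1: "F = Fract P R" "eval3 R x y z \<noteq> 0" "u = eval3 P x y z / eval3 R x y z"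
    using assms(1) by (auto simp: spec_at_def)
  obtain P' R' where 2: "G = Fract P' R'" "eval3 R' x y z \<noteq> 0" "v = eval3 P' x y z / eval3 R' x y z"
    using assms(2) by (auto simp: spec_at_def)
  show ?thesis unfolding spec_at_def using 1 2
    by (intro exI[of _ "P * P'"] exI[of _ "R * R'"]) (auto simp: eval3_mult)
qed

lemma spec_at_inverse:
  assumes "spec_at F x y z u" "u \<noteq> 0"
  shows "spec_at (inverse F) x y z (inverse u)"
proof -
  obtain P R where 1: "F = Fract P R" "eval3 R x y z \<noteq> 0" "u = eval3 P x y z / eval3 R x y z"
    using assms(1) by (auto simp: spec_at_def)
  show ?thesis unfolding spec_at_def using 1 assms(2)
    by (intro exI[of _ R] exI[of _ P]) auto
qed

lemma spec_at_Fract_1: "spec_at (Fract P 1) x y z (eval3 P x y z)"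
  unfolding spec_at_def by (intro exI[of _ P] exI[of _ 1]) simp

text \<open>Two representations of one fraction satisfy a cross-multiplied polynomial identity, and
  evaluation preserves it. This makes the \<open>THE\<close> in \<open>specialize\<close>
  meaningful.\<close>

lemma spec_at_unique:
  assumes "spec_at F x y z u" "spec_at F x y z v"
  shows "u = v"
proof -
  obtain P R where 1: "F = Fract P R" "eval3 R x y z \<noteq> 0" "u = eval3 P x y z / eval3 R x y z"
    using assms(1) by (auto simp: spec_at_def)
  obtain P' R' where 2: "F = Fract P' R'" "eval3 R' x y z \<noteq> 0" "v = eval3 P' x y z / eval3 R' x y z"
    using assms(2) by (auto simp: spec_at_def)
  have "P * R' = P' * R" using 1 2 by (metis eq_fract(1) eval3_0)
  then have "eval3 P x y z * eval3 R' x y z = eval3 P' x y z * eval3 R x y z"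
    by (metis eval3_mult)
  then show ?thesis using 1 2 by (simp add: frac_eq_eq)
qed

lemma specialize_eq: "spec_at F x y z u \<Longrightarrow> specialize F x y z = u"
  unfolding specialize_def by (rule the_equality) (auto intro: spec_at_unique)

lemma eval3_Vars:
  "eval3 [:[:[:0, 1:]:]:] x y z = x" "eval3 [:[:0, 1:]:] x y z = y" "eval3 [:0, 1:] x y z = z"
  by (simp_all add: eval3_def map_poly_pCons)

lemma Vq_power: "Vq ^ m = Fract [:[:[:0, 1:] ^ m:]:] 1"
  by (induction m) (simp_all add: Vq_def One_fract_def flip: one_pCons)

text \<open>Comparing degrees shows that the indeterminate \<open>q\<close> is no root of unity;
  hence generic quantum integers vanish only at \<open>0\<close>.\<close>

lemma Vq_power_ne_1: 
  assumes "0 < m" shows "(Vq :: 'k::field rfun) ^ m \<noteq> 1"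
proof
  assume "(Vq :: 'k::field rfun) ^ m = 1"
  then have "[:[:([:0, 1:] :: 'k poly) ^ m:]:] = 1"
    by (simp add: Vq_power One_fract_def eq_fract)
  then have "([:0, 1:] :: 'k poly) ^ m = 1" by (simp add: one_pCons)
  then have "degree (([:0, 1:] :: 'k poly) ^ m) = 0" by simp
  then show False using assms by (simp add: degree_power_eq)
qed

text \<open>A place of the field \<open>'K\<close>, given as the relation \<open>sp x u\<close>: \<open>x\<close> is finite with value \<open>u\<close>.\<close>
locale place =
  fixes sp :: "'K::field \<Rightarrow> 'k::field \<Rightarrow> bool"
  assumes sp_add: "sp x u \<Longrightarrow> sp y v \<Longrightarrow> sp (x + y) (u + v)"
    and sp_mult: "sp x u \<Longrightarrow> sp y v \<Longrightarrow> sp (x * y) (u * v)"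
    and sp_inverse: "sp x u \<Longrightarrow> u \<noteq> 0 \<Longrightarrow> sp (inverse x) (inverse u)"
    and sp_1: "sp 1 1"
    and sp_minus_1: "sp (- 1) (- 1)"
    and sp_unique: "sp x u \<Longrightarrow> sp x v \<Longrightarrow> u = v"
begin

lemma sp_0: "sp 0 0"
  using sp_add[OF sp_1 sp_minus_1] by simp

lemma sp_uminus: "sp x u \<Longrightarrow> sp (- x) (- u)"
  using sp_mult[OF sp_minus_1] by fastforce

lemma sp_diff: "sp x u \<Longrightarrow> sp y v \<Longrightarrow> sp (x - y) (u - v)"
  using sp_add[OF _ sp_uminus] by fastforce

lemma sp_divide: "sp x u \<Longrightarrow> sp y v \<Longrightarrow> v \<noteq> 0 \<Longrightarrow> sp (x / y) (u / v)"
  by (simp add: divide_inverse sp_mult sp_inverse)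

lemma sp_nonzero: "sp x u \<Longrightarrow> u \<noteq> 0 \<Longrightarrow> x \<noteq> 0"
  using sp_unique sp_0 by blast

lemma sp_sum: "(\<And>a. a \<in> A \<Longrightarrow> sp (f a) (g a)) \<Longrightarrow> sp (sum f A) (sum g A)"
  by (induction A rule: infinite_finite_induct) (auto intro: sp_0 sp_add)

lemma sp_prod: "(\<And>a. a \<in> A \<Longrightarrow> sp (f a) (g a)) \<Longrightarrow> sp (prod f A) (prod g A)"
  by (induction A rule: infinite_finite_induct) (auto intro: sp_1 sp_mult)

lemma sp_power: "sp x u \<Longrightarrow> sp (x ^ m) (u ^ m)"
  by (induction m) (auto intro: sp_1 sp_mult)

lemma sp_powi: "sp x u \<Longrightarrow> u \<noteq> 0 \<Longrightarrow> sp (x powi m) (u powi m)"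
  by (auto simp: power_int_def intro: sp_power sp_inverse)

lemma sp_qw:
  assumes "sp q q'" "sp Q Q'" "q' \<noteq> 0" "Q' \<noteq> 0" "q' - inverse q' \<noteq> 0"
  shows "sp (qw q Q x) (qw q' Q' x)"
  unfolding qw_def by (intro sp_divide sp_diff sp_mult sp_inverse sp_powi assms)

lemma sp_qn:
  assumes "sp q q'" "q' \<noteq> 0" "q' - inverse q' \<noteq> 0"
  shows "sp (qn q x) (qn q' x)"
  unfolding qn_def by (intro sp_divide sp_diff sp_powi sp_inverse assms)

end

lemma place_spec_at: "place (\<lambda>F v. spec_at F x y z v)"
proof
  show "spec_at 1 x y z 1" using spec_at_Fract_1[of 1 x y z] by (simp add: One_fract_def)
  show "spec_at (- 1) x y z (- 1)"
    using spec_at_Fract_1[of "- 1" x y z] by (simp add: One_fract_def eval3_minus_1)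
qed (auto intro: spec_at_add spec_at_mult spec_at_inverse spec_at_unique)

section \<open>Half-diagrams as tilings by arcs\<close>

text \<open>The open interval is a union of matched pairs. This one predicate expresses planarity,
  the absence of covered lines and, with \<open>x = 0\<close> or \<open>y = Suc n\<close>, the
  exposure of a line to the left or right edge.\<close>

definition tiled :: "hdiag \<Rightarrow> nat \<Rightarrow> nat \<Rightarrow> bool" where
  "tiled D x y \<longleftrightarrow> (\<forall>v. x < v \<and> v < y \<longrightarrow> (\<exists>w d. D v = Arc w d \<and> x < w \<and> w < y))"

definition undec :: "hdiag \<Rightarrow> nat \<Rightarrow> nat \<Rightarrow> bool" where
  "undec D x y \<longleftrightarrow> (\<forall>v w d. x < v \<and> v < y \<and> D v = Arc w d \<longrightarrow> d = Undec)"

text \<open>The geometric clauses of \<open>valid_hd\<close> in terms of \<open>tiled\<close>,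
  without the number of arcs: the inside of every arc is tiled, and for a blobbed arc also the part
  between it and its edge.\<close>

definition nc :: "nat \<Rightarrow> hdiag \<Rightarrow> bool" where
  "nc n D \<longleftrightarrow>
     (\<forall>v. v < 1 \<or> n < v \<longrightarrow> D v = Prop) \<and>
     (\<forall>v w d. D v = Arc w d \<longrightarrow> 1 \<le> w \<and> w \<le> n \<and> w \<noteq> v \<and> D w = Arc v d) \<and>
     (\<forall>a b d. D a = Arc b d \<and> a < b \<longrightarrow> tiled D a b
        \<and> (d = LBlob \<longrightarrow> tiled D 0 a) \<and> (d = RBlob \<longrightarrow> tiled D b (Suc n)))"

definition arcv :: "nat \<Rightarrow> hdiag \<Rightarrow> nat set" where
  "arcv n D = {v \<in> {1..n}. D v \<noteq> Prop}"

lemma tiledD: "tiled D x y \<Longrightarrow> D v = Arc w d \<Longrightarrow> x < v \<Longrightarrow> v < y \<Longrightarrow> x < w \<and> w < y"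
  unfolding tiled_def by (metis hv.inject)

lemma tiledE: 
  assumes "tiled D x y" "x < v" "v < y" obtains w d where "D v = Arc w d" "x < w" "w < y"
  using assms unfolding tiled_def by blast

lemma undecD: "undec D x y \<Longrightarrow> D v = Arc w d \<Longrightarrow> x < v \<Longrightarrow> v < y \<Longrightarrow> d = Undec"
  unfolding undec_def by blast

lemma ncD:
  assumes "nc n D" "D v = Arc w d"
  shows "1 \<le> v" "v \<le> n" "1 \<le> w" "w \<le> n" "w \<noteq> v" "D w = Arc v d"
proof -
  have "\<not> (v < 1 \<or> n < v)" using assms unfolding nc_def by (metis hv.distinct(1))
  then show "1 \<le> v" "v \<le> n" by auto
  show "1 \<le> w" "w \<le> n" "w \<noteq> v" "D w = Arc v d" using assms unfolding nc_def by blast+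
qed

lemma nc_tiled: "nc n D \<Longrightarrow> D a = Arc b d \<Longrightarrow> a < b \<Longrightarrow> tiled D a b"
  and nc_L: "nc n D \<Longrightarrow> D a = Arc b LBlob \<Longrightarrow> a < b \<Longrightarrow> tiled D 0 a"
  and nc_R: "nc n D \<Longrightarrow> D a = Arc b RBlob \<Longrightarrow> a < b \<Longrightarrow> tiled D b (Suc n)"
  unfolding nc_def by blast+

text \<open>A vertex under an arc carries an arc itself, and its partner cannot leave on either side
  without a crossing; this turns the pairwise crossing condition into a tiling condition.\<close>

lemma valid_hd_iff: "valid_hd n l D \<longleftrightarrow> nc n D \<and> card (arcv n D) = 2 * l"
proof
  assume "valid_hd n l D"
  note V = this[unfolded valid_hd_def]
  note out = V[THEN conjunct1, rule_format]
  note sym = V[THEN conjunct2, THEN conjunct1, rule_format]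
  note cr = V[THEN conjunct2, THEN conjunct2, THEN conjunct1, rule_format]
  note np = V[THEN conjunct2, THEN conjunct2, THEN conjunct2, THEN conjunct1, rule_format]
  note card = V[THEN conjunct2, THEN conjunct2, THEN conjunct2, THEN conjunct2, THEN conjunct1]
  note L = V[THEN conjunct2, THEN conjunct2, THEN conjunct2, THEN conjunct2, THEN conjunct2, THEN conjunct1, rule_format]
  note R = V[THEN conjunct2, THEN conjunct2, THEN conjunct2, THEN conjunct2, THEN conjunct2, THEN conjunct2, rule_format]
  have t: "tiled D a b" if ab: "D a = Arc b d" "a < b" for a b d
    unfolding tiled_def
  proof (intro allI impI)
    fix v assume v: "a < v \<and> v < b"
    then obtain w e where w: "D v = Arc w e" using np[of a b d v] ab by (cases "D v") auto
    have w': "D w = Arc v e" "D b = Arc a d" using sym[OF w] sym[OF ab(1)] by auto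
    have "w \<noteq> a" "w \<noteq> b" using w' ab(1) v by auto
    moreover have "\<not> b < w" using cr[of a b d v w e] ab w v by auto
    moreover have "\<not> w < a" using cr[of w v e a b d] ab w' v by auto
    ultimately have "a < w \<and> w < b" by auto
    then show "\<exists>w d. D v = Arc w d \<and> a < w \<and> w < b" using w by blast
  qed
  have tL: "tiled D 0 a" if ab: "D a = Arc b LBlob" "a < b" for a b
    unfolding tiled_def
  proof (intro allI impI)
    fix v assume v: "0 < v \<and> v < a"
    then obtain w d where w: "D v = Arc w d" "w < a" using L[of a b v, OF conjI[OF ab(2,1)]] v by auto
    then show "\<exists>w d. D v = Arc w d \<and> 0 < w \<and> w < a" using sym[OF w(1)] by fastforce
  qed
  have tR: "tiled D b (Suc n)" if ab: "D a = Arc b RBlob" "a < b" for a b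
    unfolding tiled_def
  proof (intro allI impI)
    fix v assume v: "b < v \<and> v < Suc n"
    then obtain w d where w: "D v = Arc w d" "b < w" using R[of a b v, OF conjI[OF ab(2,1)]] v by auto
    then show "\<exists>w d. D v = Arc w d \<and> b < w \<and> w < Suc n" using sym[OF w(1)] by fastforce
  qed
  have "\<forall>a b d. D a = Arc b d \<and> a < b \<longrightarrow> tiled D a b
        \<and> (d = LBlob \<longrightarrow> tiled D 0 a) \<and> (d = RBlob \<longrightarrow> tiled D b (Suc n))"
    using t tL tR by blast
  then have "nc n D"
    unfolding nc_def by (rule conjI[OF V[THEN conjunct1] conjI[OF V[THEN conjunct2, THEN conjunct1]]])
  then show "nc n D \<and> card (arcv n D) = 2 * l" using card by (simp add: arcv_def)
next
  assume "nc n D \<and> card (arcv n D) = 2 * l"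
  then have N: "nc n D" and c: "card (arcv n D) = 2 * l" by auto
  have 1: "\<forall>a b d a' b' d'. D a = Arc b d \<and> D a' = Arc b' d' \<and> a < b \<and> a' < b'
      \<longrightarrow> \<not> (a < a' \<and> a' < b \<and> b < b')"
    using tiledD[OF nc_tiled[OF N]] by (meson less_asym)
  have 2: "\<forall>a b d p. D a = Arc b d \<and> a < p \<and> p < b \<longrightarrow> D p \<noteq> Prop"
    using tiledE[OF nc_tiled[OF N]] by (metis hv.distinct(1) order_less_trans)
  have 3: "\<forall>a b. a < b \<and> D a = Arc b LBlob \<longrightarrow> (\<forall>v. 1 \<le> v \<and> v < a \<longrightarrow> (\<exists>w d. D v = Arc w d \<and> w < a))"
    using tiledE[OF nc_L[OF N]] by (metis One_nat_def Suc_le_eq)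
  have 4: "\<forall>a b. a < b \<and> D a = Arc b RBlob \<longrightarrow> (\<forall>v. b < v \<and> v \<le> n \<longrightarrow> (\<exists>w d. D v = Arc w d \<and> b < w))"
    using tiledE[OF nc_R[OF N]] by (metis less_Suc_eq_le)
  show "valid_hd n l D"
    unfolding valid_hd_def
    by (rule conjI[OF N[unfolded nc_def, THEN conjunct1] conjI[OF N[unfolded nc_def, THEN conjunct2, THEN conjunct1]
          conjI[OF 1 conjI[OF 2 conjI[OF c[unfolded arcv_def] conjI[OF 3 4]]]]]])
qed

lemma valid_nc: "valid_hd n l D \<Longrightarrow> nc n D"
  by (simp add: valid_hd_iff)

lemma finite_valid_hd: "finite {D. valid_hd n l D}"
proof -
  let ?B = "insert Prop ((\<lambda>(w, d). Arc w d) ` ({1..n} \<times> {Undec, LBlob, RBlob}))"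
  have "finite {D. \<forall>v. (v \<in> {1..n} \<longrightarrow> D v \<in> ?B) \<and> (v \<notin> {1..n} \<longrightarrow> D v = Prop)}"
    by (rule finite_set_of_finite_funs) auto
  moreover have "{D. valid_hd n l D} \<subseteq> {D. \<forall>v. (v \<in> {1..n} \<longrightarrow> D v \<in> ?B) \<and> (v \<notin> {1..n} \<longrightarrow> D v = Prop)}"
  proof (intro subsetI CollectI allI conjI impI)
    fix D v assume D: "D \<in> {D. valid_hd n l D}"
    then have N: "nc n D" by (simp add: valid_hd_iff)
    show "D v \<in> ?B"
    proof (cases "D v")
      case (Arc w d)
      then show ?thesis using ncD[OF N Arc] by (cases d) auto
    qed simp
    show "D v = Prop" if "v \<notin> {1..n}"
      using ncD(1,2)[OF N] that by (cases "D v") auto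
  qed
  ultimately show ?thesis by (rule finite_subset[rotated])
qed

text \<open>The basic tool for surgery on diagrams: only the altered vertices have to be
  checked.\<close>

lemma tiled_transfer:
  assumes "tiled D x y"
    and "\<And>v. x < v \<Longrightarrow> v < y \<Longrightarrow> E v \<noteq> D v \<Longrightarrow> \<exists>w d. E v = Arc w d \<and> x < w \<and> w < y"
  shows "tiled E x y"
  unfolding tiled_def
proof (intro allI impI)
  fix v assume v: "x < v \<and> v < y"
  show "\<exists>w d. E v = Arc w d \<and> x < w \<and> w < y"
  proof (cases "E v = D v")
    case True
    then show ?thesis using tiledE[OF assms(1), of v] v by metis
  qed (use v assms(2) in blast)
qed

lemma tiled_empty [simp]: "y \<le> Suc x \<Longrightarrow> tiled D x y"
  unfolding tiled_def by auto

text \<open>Vertices outside \<open>1..n\<close> need no separate clause: a vertex with an arc is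
  the partner of its partner and therefore lies in range.\<close>

lemma ncI:
  assumes "\<And>v w d. D v = Arc w d \<Longrightarrow> 1 \<le> w \<and> w \<le> n \<and> w \<noteq> v \<and> D w = Arc v d"
    and arcs: "\<And>a b d. D a = Arc b d \<Longrightarrow> a < b \<Longrightarrow> tiled D a b \<and> (d = LBlob \<longrightarrow> tiled D 0 a)
        \<and> (d = RBlob \<longrightarrow> tiled D b (Suc n))"
  shows "nc n D"
proof -
  have "D v = Prop" if "v < 1 \<or> n < v" for v
  proof (cases "D v")
    case (Arc w d)
    then have "D w = Arc v d" using assms(1) by blast
    then show ?thesis using assms(1)[of w v d] that by simp
  qed simp
  then show ?thesis using assms unfolding nc_def by blast
qed

text \<open>\<open>e\<^sub>i\<close> maps \<open>join i a b d1 d2 E\<close> to a multiple of \<open>E\<close>, if \<open>E\<close> has an undecorated arc at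
  \<open>i\<close>, \<open>i + 1\<close> and an arc joining \<open>a\<close> and \<open>b\<close>.\<close>
definition join :: "nat \<Rightarrow> nat \<Rightarrow> nat \<Rightarrow> deco \<Rightarrow> deco \<Rightarrow> hdiag \<Rightarrow> hdiag" where
  "join i a b d1 d2 E = E(i := Arc a d1, Suc i := Arc b d2, a := Arc i d1, b := Arc (Suc i) d2)"

text \<open>Glues a tiled interval, an arc with its tiled inside, and a further tiled
  interval.\<close>

lemma tiled_bridge:
  assumes ab: "E a = Arc b d" "E b = Arc a d'" "a < b"
    and t: "tiled E x a" "tiled E a b" "tiled E b y" "x < a" "b < y"
  shows "tiled E x y"
  unfolding tiled_def
proof (intro allI impI)
  fix v assume v: "x < v \<and> v < y"
  consider "v < a" | "v = a" | "a < v" "v < b" | "v = b" | "b < v" by linarith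
  then show "\<exists>w d. E v = Arc w d \<and> x < w \<and> w < y"
  proof cases
    case 1
    then obtain w e where "E v = Arc w e" "x < w" "w < a" using tiledE[OF t(1)] v by blast
    then show ?thesis using ab t by auto
  next
    case 3
    then obtain w e where "E v = Arc w e" "a < w" "w < b" using tiledE[OF t(2)] by blast
    then show ?thesis using t by auto
  next
    case 5
    then obtain w e where "E v = Arc w e" "b < w" "w < y" using tiledE[OF t(3)] v by blast
    then show ?thesis using ab t by auto
  qed (use ab t in auto)
qed

text \<open>Removing a tiled initial part and the arc that follows it leaves a tiled rest: a partner
  in the removed part would have its own partner there too. \<open>tiled_take\<close> is the same at
  the other end.\<close>

lemma tiled_drop:
  assumes N: "nc n E" and t: "tiled E x y" "tiled E x m" and m: "E m = Arc m' d" "x < m" "m < m'"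
  shows "tiled E m' y"
  unfolding tiled_def
proof (intro allI impI)
  fix v assume v: "m' < v \<and> v < y"
  then have "x < v" using m by simp
  then obtain w e where w: "E v = Arc w e" "x < w" "w < y" using tiledE[OF t(1)] v by blast
  note wv = ncD(6)[OF N w(1)]
  have "\<not> w < m" using tiledD[OF t(2) wv] w v m by auto
  moreover have "\<not> (m < w \<and> w < m')" using tiledD[OF nc_tiled[OF N m(1,3)] wv] v by auto
  moreover have "w \<noteq> m" "w \<noteq> m'" using wv m ncD(6)[OF N m(1)] v by auto
  ultimately show "\<exists>w d. E v = Arc w d \<and> m' < w \<and> w < y" using w by force
qed

lemma tiled_take:
  assumes N: "nc n E" and t: "tiled E x y" "tiled E m' y" and m: "E m = Arc m' d" "m' < y" "m < m'"
  shows "tiled E x m"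
  unfolding tiled_def
proof (intro allI impI)
  fix v assume v: "x < v \<and> v < m"
  then have "v < y" using m by simp
  then obtain w e where w: "E v = Arc w e" "x < w" "w < y" using tiledE[OF t(1)] v by blast
  note wv = ncD(6)[OF N w(1)]
  have "\<not> m' < w" using tiledD[OF t(2) wv] w v m by auto
  moreover have "\<not> (m < w \<and> w < m')" using tiledD[OF nc_tiled[OF N m(1,3)] wv] v by auto
  moreover have "w \<noteq> m" "w \<noteq> m'" using wv m ncD(6)[OF N m(1)] v by auto
  ultimately show "\<exists>w d. E v = Arc w d \<and> x < w \<and> w < m" using w by force
qed

lemma tiled_inter:
  assumes "tiled E a y" "tiled E x b" "x \<le> a" "b \<le> y"
  shows "tiled E a b"
  unfolding tiled_def
proof (intro allI impI)
  fix v assume v: "a < v \<and> v < b"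
  then obtain w e where w: "E v = Arc w e" "a < w" using tiledE[OF assms(1), of v] assms(4) by (metis less_le_trans)
  then show "\<exists>w d. E v = Arc w d \<and> a < w \<and> w < b" using tiledD[OF assms(2) w(1)] v assms(3) by auto
qed

lemma tiled_right:
  assumes "nc n E" "E i = Arc (Suc i) d'" "E a = Arc b d" "a < i" "tiled E a i" "Suc i < b"
  shows "tiled E (Suc i) b"
  using tiled_drop[OF assms(1) nc_tiled[OF assms(1,3)] assms(5,2,4)] assms(4,6) by simp

text \<open>\<open>tiled E a i\<close> says that the end \<open>a\<close> is visible from the cup.
  The new arc from \<open>a\<close> to \<open>i\<close> will cover everything between, so no blob
  may be there. If the cut arc is a sibling (\<open>b < a\<close>), this new arc also lies under the
  one from \<open>b\<close> to \<open>Suc i\<close>, which must take the whole decoration; if the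
  cut arc encloses the cup, each piece remains as exposed as the arc was.\<close>

lemma nc_join:
  assumes N: "nc n E" and cup: "E i = Arc (Suc i) Undec" and ab: "E a = Arc b d" and ai: "a < i"
    and t: "tiled E a i" and u: "undec E a i"
    and c: "b < a \<and> d1 = Undec \<and> d2 = d \<or> Suc i < b \<and> d1 \<in> {Undec, d} \<and> d2 \<in> {Undec, d}"
  shows "nc n (join i a b d1 d2 E)"
proof -
  let ?D = "join i a b d1 d2 E"
  have E: "E (Suc i) = Arc i Undec" "E b = Arc a d" using ncD[OF N cup] ncD[OF N ab] by auto
  have ne: "a \<noteq> Suc i" "a \<noteq> b" "b \<noteq> i" "b \<noteq> Suc i" "a \<noteq> i" using ai c by auto
  have D: "?D i = Arc a d1" "?D (Suc i) = Arc b d2" "?D a = Arc i d1" "?D b = Arc (Suc i) d2"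
    and Do: "\<And>v. v \<notin> {i, Suc i, a, b} \<Longrightarrow> ?D v = E v"
    using ne by (auto simp: join_def)
  \<comment> \<open>An interval stays tiled if it does not separate the new pairs \<open>i\<close>,
    \<open>a\<close> and \<open>Suc i\<close>, \<open>b\<close>.\<close>
  have tr: "tiled ?D x y" if "tiled E x y" "x < i \<and> i < y \<longleftrightarrow> x < a \<and> a < y"
       "x < Suc i \<and> Suc i < y \<longleftrightarrow> x < b \<and> b < y" for x y
    using that(1)
  proof (rule tiled_transfer)
    fix v assume v: "x < v" "v < y" "?D v \<noteq> E v"
    then have "v \<in> {i, Suc i, a, b}" using Do by blast
    then show "\<exists>w d. ?D v = Arc w d \<and> x < w \<and> w < y" using D that v by auto
  qed
  have rng: "1 \<le> i" "Suc i \<le> n" "1 \<le> a" "b \<le> n" "1 \<le> b" "a \<le> n"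
    using ncD[OF N cup] ncD[OF N ab] by auto
  show ?thesis
  proof (rule ncI)
    fix v w e assume v: "?D v = Arc w e"
    show "1 \<le> w \<and> w \<le> n \<and> w \<noteq> v \<and> ?D w = Arc v e"
    proof (cases "v \<in> {i, Suc i, a, b}")
      case False
      then have Ev: "E v = Arc w e" using Do v by simp
      note Ew = ncD(6)[OF N Ev]
      have "w \<notin> {i, Suc i, a, b}" using False Ew cup E ab by auto
      then show ?thesis using ncD[OF N Ev] Do by simp
    qed (use v D ne rng in auto)
  next
    fix p r e assume pr: "?D p = Arc r e" "p < r"
    show "tiled ?D p r \<and> (e = LBlob \<longrightarrow> tiled ?D 0 p) \<and> (e = RBlob \<longrightarrow> tiled ?D r (Suc n))"
    proof (cases "p \<in> {i, Suc i, a, b}")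
      case False
      then have Ep: "E p = Arc r e" using Do pr by simp
      note Er = ncD(6)[OF N Ep]
      have rn: "r \<notin> {i, Suc i, a, b}" using False Er cup E ab by (auto)
      note tp = nc_tiled[OF N Ep pr(2)]
      have 1: "p < i \<and> i < r \<longleftrightarrow> p < Suc i \<and> Suc i < r" using False rn by auto
      have 2: "p < a \<and> a < r \<longleftrightarrow> p < b \<and> b < r" using tiledD[OF tp ab] tiledD[OF tp E(2)] by blast
      have "p \<noteq> a" "p \<noteq> i" "r \<noteq> a" "r \<noteq> i" using False rn by auto
      then have 3: "p < i \<and> i < r \<longleftrightarrow> p < a \<and> a < r"
        using tiledD[OF t Ep] tiledD[OF t Er] ai pr(2) by linarith
      have "tiled ?D p r" using tr[OF tp] 1 2 3 by blast
      moreover have "tiled ?D 0 p" if "e = LBlob"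
      proof -
        have t0: "tiled E 0 p" using nc_L[OF N] Ep that pr(2) by blast
        have "\<not> (a < p \<and> p < i)" using undecD[OF u Ep] that by auto
        moreover have "a < p \<longleftrightarrow> b < p" using tiledD[OF t0 ab] tiledD[OF t0 E(2)] rng by auto
        moreover have "p \<noteq> a" "p \<noteq> i" "p \<noteq> Suc i" using False by auto
        ultimately show ?thesis using tr[OF t0] ai rng by linarith
      qed
      moreover have "tiled ?D r (Suc n)" if "e = RBlob"
      proof -
        have t0: "tiled E r (Suc n)" using nc_R[OF N] Ep that pr(2) by blast
        have "\<not> (a < r \<and> r < i)" using undecD[OF u Er] that by auto
        moreover have "r < a \<longleftrightarrow> r < b" using tiledD[OF t0 ab] tiledD[OF t0 E(2)] rng by auto
        moreover have "r \<noteq> a" "r \<noteq> i" "r \<noteq> Suc i" using rn by auto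
        ultimately show ?thesis using tr[OF t0] ai rng by linarith
      qed
      ultimately show ?thesis by blast
    next
      case True
      have tai: "tiled ?D a i" by (rule tr[OF t]) (use c ai in auto)
      show ?thesis
      proof (cases "b < a")
        case True
        then have d: "d1 = Undec" "d2 = d" using c ai by auto
        have "p = a \<and> r = i \<and> e = d1 \<or> p = b \<and> r = Suc i \<and> e = d2"
          using \<open>p \<in> _\<close> pr D True ai by auto
        moreover have "tiled ?D b a" by (rule tr[OF nc_tiled[OF N E(2) True]]) (use True ai in auto)
        then have "tiled ?D b (Suc i)"
          by (rule tiled_bridge[OF D(3) D(1) ai _ tai]) (use True in simp_all)
        moreover have "tiled ?D 0 b" if "d = LBlob"
        proof -
          have t0: "tiled E 0 b" using nc_L[OF N, of b a] E(2) that True by simp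
          then show ?thesis by (rule tr) (use True ai in auto)
        qed
        moreover have "tiled ?D (Suc i) (Suc n)" if "d = RBlob"
        proof (rule tr)
          have t0: "tiled E a (Suc n)" using nc_R[OF N, of b a] E(2) that True by simp
          show "tiled E (Suc i) (Suc n)" by (rule tiled_drop[OF N t0 t cup ai]) simp
        qed (use True ai in auto)
        ultimately show ?thesis using tai d by auto
      next
        case False
        then have d: "Suc i < b" "d1 \<in> {Undec, d}" "d2 \<in> {Undec, d}" using c by auto
        have "p = a \<and> r = i \<and> e = d1 \<or> p = Suc i \<and> r = b \<and> e = d2"
          using \<open>p \<in> _\<close> pr D False d ai by auto
        moreover have tib: "tiled ?D (Suc i) b"
          by (rule tr[OF tiled_right[OF N cup ab ai t d(1)]]) (use d ai in auto)
        moreover have tL: "tiled ?D 0 a" if "d = LBlob"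
        proof -
          have "tiled E 0 a" using nc_L[OF N, of a b] ab that ai d by simp
          then show ?thesis by (rule tr) (use d ai in auto)
        qed
        moreover have tR: "tiled ?D b (Suc n)" if "d = RBlob"
        proof -
          have "tiled E b (Suc n)" using nc_R[OF N, of a b] ab that ai d by simp
          then show ?thesis by (rule tr) (use d ai in auto)
        qed
        moreover have "tiled ?D 0 (Suc i)" if L: "d = LBlob"
          by (rule tiled_bridge[OF D(3) D(1) ai tL[OF L] tai]) (use rng in simp_all)
        moreover have "tiled ?D i (Suc n)" if R: "d = RBlob"
          by (rule tiled_bridge[OF D(2) D(4) d(1) _ tib tR[OF R]]) (use rng in simp_all)
        ultimately show ?thesis using tai d by auto
      qed
    qed
  qed
qed

text \<open>The converse of \<open>nc_join\<close>: \<open>E\<close> is, up to a scalar, the image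
  of \<open>D\<close> under \<open>e_i\<close>, and \<open>D\<close> is recovered from it by
  \<open>join\<close>. Arcs of \<open>D\<close> under the arc from \<open>a\<close> to
  \<open>i\<close> touch neither edge, whence \<open>undec E a i\<close>.\<close>

lemma nc_of_join:
  assumes N: "nc n D" and Di: "D i = Arc a d1" and Ds: "D (Suc i) = Arc b d2" and ai: "a < i"
    and c: "d1 = Undec \<and> d = d2 \<or> d2 = Undec \<and> d = d1 \<or> d1 = d2 \<and> d = d1"
  defines "E \<equiv> cup i (D(a := Arc b d, b := Arc a d))"
  shows "nc n E" "E i = Arc (Suc i) Undec" "E a = Arc b d" "tiled E a i" "undec E a i"
    "b < a \<and> d1 = Undec \<and> d2 = d \<or> Suc i < b" "D = join i a b d1 d2 E"
proof -
  note Da = ncD(6)[OF N Di] and Db = ncD(6)[OF N Ds]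
  have rng: "1 \<le> a" "i \<le> n" "Suc i \<le> n" "1 \<le> b" "b \<le> n" "b \<noteq> Suc i"
    using ncD[OF N Di] ncD[OF N Ds] by auto
  have "b \<noteq> a" "b \<noteq> i" using Db Da Di ai by auto
  have tai: "tiled D a i" using nc_tiled[OF N Da ai] .
  have b: "b < a \<or> Suc i < b" using tiledD[OF tai Db] \<open>b \<noteq> a\<close> \<open>b \<noteq> i\<close> \<open>b \<noteq> Suc i\<close> by fastforce
  then have ne: "a \<noteq> Suc i" "a \<noteq> b" "b \<noteq> i" "b \<noteq> Suc i" "a \<noteq> i" using ai by auto
  show Ei: "E i = Arc (Suc i) Undec" and Ea: "E a = Arc b d"
    using ne by (auto simp: E_def cup_def)
  have Es: "E (Suc i) = Arc i Undec" and Eb: "E b = Arc a d"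
    and Eo: "\<And>v. v \<notin> {i, Suc i, a, b} \<Longrightarrow> E v = D v"
    using ne by (auto simp: E_def cup_def)
  have tr: "tiled E x y" if "tiled D x y" "x < i \<and> i < y \<longleftrightarrow> x < Suc i \<and> Suc i < y"
       "x < a \<and> a < y \<longleftrightarrow> x < b \<and> b < y" for x y
    using that(1)
  proof (rule tiled_transfer)
    fix v assume v: "x < v" "v < y" "E v \<noteq> D v"
    then have "v \<in> {i, Suc i, a, b}" using Eo by blast
    then show "\<exists>w d. E v = Arc w d \<and> x < w \<and> w < y" using Ei Es Ea Eb that v by auto
  qed
  show tE: "tiled E a i" by (rule tr[OF tai]) (use b ai in auto)
  show "D = join i a b d1 d2 E"
    using ne Di Ds Da Db by (auto simp: join_def E_def cup_def fun_eq_iff)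
  \<comment> \<open>In this case the arc from \<open>a\<close> to \<open>i\<close> lies under the
    arc from \<open>b\<close> to \<open>Suc i\<close> and is exposed to neither edge.\<close>
  have d1U: "d1 = Undec" if "b < a"
  proof (cases d1)
    case LBlob
    then show ?thesis using nc_L[OF N, of a i] Da ai tiledD[where D = D and x = 0 and y = a, OF _ Db] that rng by auto
  next
    case RBlob
    then show ?thesis using nc_R[OF N, of a i] Da ai tiledD[where D = D and x = i and y = "Suc n", OF _ Ds] that rng by auto
  qed
  then show "b < a \<and> d1 = Undec \<and> d2 = d \<or> Suc i < b" using b c by auto
  have ud: "e = Undec" if "D p = Arc r e" "p < r" "a < p" "r < i" for p r e
  proof (cases e)
    case LBlob
    then show ?thesis using nc_L[OF N, of p r] that ai tiledD[where D = D and x = 0 and y = p, OF _ Da] rng by auto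
  next
    case RBlob
    then show ?thesis using nc_R[OF N, of p r] that ai tiledD[where D = D and x = r and y = "Suc n", OF _ Di] rng by auto
  qed
  show "undec E a i"
    unfolding undec_def
  proof (intro allI impI; elim conjE)
    fix v w e assume v: "a < v" "v < i" "E v = Arc w e"
    then have Dv: "D v = Arc w e" using Eo[of v] b by auto
    then have w: "a < w" "w < i" using tiledD[OF tai Dv] v by auto
    note Dw = ncD[OF N Dv]
    show "e = Undec"
    proof (cases "v < w")
      case True
      then show ?thesis using ud[OF Dv] v w by blast
    next
      case False
      then show ?thesis using ud[OF Dw(6)] v w Dw(5) by simp
    qed
  qed
  show "nc n E"
  proof (rule ncI)
    fix v w e assume v: "E v = Arc w e"
    show "1 \<le> w \<and> w \<le> n \<and> w \<noteq> v \<and> E w = Arc v e"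
    proof (cases "v \<in> {i, Suc i, a, b}")
      case False
      then have Dv: "D v = Arc w e" using Eo v by simp
      note Dw = ncD(6)[OF N Dv]
      have "w \<notin> {i, Suc i, a, b}" using False Dw Di Ds Da Db by auto
      then show ?thesis using ncD[OF N Dv] Eo by simp
    qed (use v Ei Es Ea Eb ne rng ai in auto)
  next
    fix p r e assume pr: "E p = Arc r e" "p < r"
    show "tiled E p r \<and> (e = LBlob \<longrightarrow> tiled E 0 p) \<and> (e = RBlob \<longrightarrow> tiled E r (Suc n))"
    proof (cases "p \<in> {i, Suc i, a, b}")
      case False
      then have Dp: "D p = Arc r e" using Eo pr by simp
      note Dr = ncD(6)[OF N Dp]
      have rn: "r \<notin> {i, Suc i, a, b}" using False Dr Di Ds Da Db by (auto)
      note tp = nc_tiled[OF N Dp pr(2)]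
      have 1: "p < i \<and> i < r \<longleftrightarrow> p < Suc i \<and> Suc i < r" using False rn by auto
      have 2: "p < a \<and> a < r \<longleftrightarrow> p < i \<and> i < r" using tiledD[OF tp Di] tiledD[OF tp Da] by blast
      have 3: "p < b \<and> b < r \<longleftrightarrow> p < Suc i \<and> Suc i < r" using tiledD[OF tp Ds] tiledD[OF tp Db] by blast
      have "tiled E p r" using tr[OF tp] 1 2 3 by blast
      moreover have "tiled E 0 p" if "e = LBlob"
      proof -
        have t0: "tiled D 0 p" using nc_L[OF N] Dp that pr(2) by blast
        have "a < p \<longleftrightarrow> i < p" using tiledD[OF t0 Di] tiledD[OF t0 Da] rng ai by auto
        moreover have "b < p \<longleftrightarrow> Suc i < p" using tiledD[OF t0 Ds] tiledD[OF t0 Db] rng by auto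
        moreover have "p \<noteq> i" "p \<noteq> Suc i" using False by auto
        ultimately show ?thesis using tr[OF t0] ai rng by linarith
      qed
      moreover have "tiled E r (Suc n)" if "e = RBlob"
      proof -
        have t0: "tiled D r (Suc n)" using nc_R[OF N] Dp that pr(2) by blast
        have "r < a \<longleftrightarrow> r < i" using tiledD[OF t0 Di] tiledD[OF t0 Da] rng ai by auto
        moreover have "r < b \<longleftrightarrow> r < Suc i" using tiledD[OF t0 Ds] tiledD[OF t0 Db] rng by auto
        moreover have "r \<noteq> i" "r \<noteq> Suc i" using rn by auto
        ultimately show ?thesis using tr[OF t0] ai rng by linarith
      qed
      ultimately show ?thesis by blast
    next
      case True
      then consider "p = i" "r = Suc i" "e = Undec" | "p = b" "r = a" "e = d" "b < a"
        | "p = a" "r = b" "e = d" "Suc i < b"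
        using pr Ei Es Ea Eb b ai by auto
      then show ?thesis
      proof cases
        case 1 then show ?thesis by simp
      next
        case 2
        note tb = nc_tiled[OF N Db]
        have d2: "d2 = d" using d1U[OF 2(4)] c by auto
        have "tiled E b a"
        proof (rule tr)
          show "tiled D b a" by (rule tiled_take[OF N tb _ Da _ ai]) (use 2 ai in auto)
        qed (use 2 ai in auto)
        moreover have "tiled E 0 b" if "d = LBlob"
          by (rule tr[OF nc_L[OF N, of b "Suc i"]]) (use Db d2 that 2 ai in auto)
        moreover have "tiled E a (Suc n)" if "d = RBlob"
        proof (rule tiled_bridge[OF Ei Es _ tE])
          have t0: "tiled D (Suc i) (Suc n)" using nc_R[OF N, of b "Suc i"] Db d2 that 2 ai by auto
          show "tiled E (Suc i) (Suc n)" by (rule tr[OF t0]) (use 2 ai in auto)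
        qed (use ai rng in simp_all)
        ultimately show ?thesis using 2 by auto
      next
        case 3
        have tib: "tiled E (Suc i) b" by (rule tr[OF nc_tiled[OF N Ds 3(4)]]) (use 3 ai in auto)
        have "tiled E a b" by (rule tiled_bridge[OF Ei Es _ tE _ tib]) (use 3 ai in simp_all)
        moreover have "tiled E 0 a" if L: "d = LBlob"
        proof (rule tr)
          show "tiled D 0 a"
          proof (cases "d1 = LBlob")
            case True then show ?thesis using nc_L[OF N, of a i] Da ai by simp
          next
            case False
            then have "d2 = LBlob" using c L by auto
            then have t0: "tiled D 0 (Suc i)" using nc_L[OF N, of "Suc i" b] Ds 3 by simp
            show ?thesis by (rule tiled_take[OF N t0 _ Da _ ai]) simp_all
          qed
        qed (use 3 ai in auto)
        moreover have "tiled E b (Suc n)" if R: "d = RBlob"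
        proof (rule tr)
          show "tiled D b (Suc n)"
          proof (cases "d2 = RBlob")
            case True then show ?thesis using nc_R[OF N, of "Suc i" b] Ds 3 by simp
          next
            case False
            then have "d1 = RBlob" using c R by auto
            then have t0: "tiled D i (Suc n)" using nc_R[OF N, of a i] Da ai by simp
            show ?thesis by (rule tiled_drop[OF N t0 _ Ds _ 3(4)]) simp_all
          qed
        qed (use 3 ai in auto)
        ultimately show ?thesis using 3 by auto
      qed
    qed
  qed
qed

text \<open>The counterpart of \<open>join\<close> for a propagating line at \<open>a\<close>: the
  line is moved to \<open>Suc i\<close>, and \<open>e_i\<close> moves it back.\<close>

definition shift_prop :: "nat \<Rightarrow> nat \<Rightarrow> hdiag \<Rightarrow> hdiag" where
  "shift_prop i a E = E(i := Arc a Undec, a := Arc i Undec, Suc i := Prop)"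

text \<open>Arcs between \<open>a\<close> and \<open>i\<close> become covered by the new arc, and
  the line now at \<open>Suc i\<close> separates them from the right edge; hence the hypothesis
  \<open>undec E a i\<close>. No arc covers the line at \<open>a\<close>, so no arc from outside
  reaches over the cup.\<close>

lemma nc_shift_prop:
  assumes N: "nc n E" and cup: "E i = Arc (Suc i) Undec" and Ea: "E a = Prop" and ai: "a < i" "1 \<le> a"
    and t: "tiled E a i" and u: "undec E a i"
  shows "nc n (shift_prop i a E)"
proof -
  let ?D = "shift_prop i a E"
  note Es = ncD(6)[OF N cup]
  have rng: "1 \<le> i" "Suc i \<le> n" using ncD[OF N cup] by auto
  have D: "?D i = Arc a Undec" "?D (Suc i) = Prop" "?D a = Arc i Undec"
    and Do: "\<And>v. v \<notin> {i, Suc i, a} \<Longrightarrow> ?D v = E v"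
    using ai by (auto simp: shift_prop_def)
  have tr: "tiled ?D x y" if "tiled E x y" "x < i \<and> i < y \<longleftrightarrow> x < a \<and> a < y"
       "\<not> (x < Suc i \<and> Suc i < y)" for x y
    using that(1)
  proof (rule tiled_transfer)
    fix v assume v: "x < v" "v < y" "?D v \<noteq> E v"
    then have "v \<in> {i, Suc i, a}" using Do by blast
    then show "\<exists>w d. ?D v = Arc w d \<and> x < w \<and> w < y" using D that v by auto
  qed
  have na: "\<not> (x < a \<and> a < y)" if "tiled E x y" for x y
    using that Ea by (auto elim: tiledE)
  show ?thesis
  proof (rule ncI)
    fix v w e assume v: "?D v = Arc w e"
    show "1 \<le> w \<and> w \<le> n \<and> w \<noteq> v \<and> ?D w = Arc v e"
    proof (cases "v \<in> {i, Suc i, a}")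
      case False
      then have Ev: "E v = Arc w e" using Do v by simp
      note Ew = ncD(6)[OF N Ev]
      have "w \<notin> {i, Suc i, a}" using False Ew cup Es Ea by auto
      then show ?thesis using ncD[OF N Ev] Do by simp
    qed (use v D ai rng in auto)
  next
    fix p r e assume pr: "?D p = Arc r e" "p < r"
    show "tiled ?D p r \<and> (e = LBlob \<longrightarrow> tiled ?D 0 p) \<and> (e = RBlob \<longrightarrow> tiled ?D r (Suc n))"
    proof (cases "p \<in> {i, Suc i, a}")
      case False
      then have Ep: "E p = Arc r e" using Do pr by simp
      note Er = ncD(6)[OF N Ep]
      have rn: "r \<noteq> i" "r \<noteq> Suc i" "r \<noteq> a" "p \<noteq> i" "p \<noteq> Suc i" "p \<noteq> a" using False Er cup Es Ea by auto
      note tp = nc_tiled[OF N Ep pr(2)]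
      have 3: "\<not> (p < i \<and> i < r)"
        using tiledD[OF t Ep] tiledD[OF t Er] na[OF tp] rn ai pr(2) by linarith
      have "tiled ?D p r" using tr[OF tp] 3 na[OF tp] rn by linarith
      moreover have "tiled ?D 0 p" if "e = LBlob"
      proof -
        have t0: "tiled E 0 p" using nc_L[OF N] Ep that pr(2) by blast
        show ?thesis using tr[OF t0] na[OF t0] rn ai by linarith
      qed
      moreover have "tiled ?D r (Suc n)" if "e = RBlob"
      proof -
        have t0: "tiled E r (Suc n)" using nc_R[OF N] Ep that pr(2) by blast
        have "\<not> (a < r \<and> r < i)" using undecD[OF u Er] that by auto
        then show ?thesis using tr[OF t0] na[OF t0] rn ai rng by linarith
      qed
      ultimately show ?thesis by blast
    next
      case True
      then have "p = a" "r = i" "e = Undec" using pr D ai by auto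
      then show ?thesis using tr[OF t] by simp
    qed
  qed
qed

lemma nc_of_shift_prop:
  assumes N: "nc n D" and Di: "D i = Arc a Undec" and Ds: "D (Suc i) = Prop" and ai: "a < i" and si: "Suc i \<le> n"
  defines "E \<equiv> cup i (D(a := Prop))"
  shows "nc n E" "E i = Arc (Suc i) Undec" "E a = Prop" "tiled E a i" "undec E a i"
    "D = shift_prop i a E" "1 \<le> a"
proof -
  note Da = ncD(6)[OF N Di]
  show rng: "1 \<le> a" using ncD[OF N Di] by auto
  have tai: "tiled D a i" using nc_tiled[OF N Da ai] .
  show Ei: "E i = Arc (Suc i) Undec" and Ea: "E a = Prop"
    using ai by (auto simp: E_def cup_def)
  have Es: "E (Suc i) = Arc i Undec"
    and Eo: "\<And>v. v \<notin> {i, Suc i, a} \<Longrightarrow> E v = D v"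
    using ai by (auto simp: E_def cup_def)
  have tr: "tiled E x y" if "tiled D x y" "x < i \<and> i < y \<longleftrightarrow> x < Suc i \<and> Suc i < y"
       "\<not> (x < a \<and> a < y)" for x y
    using that(1)
  proof (rule tiled_transfer)
    fix v assume v: "x < v" "v < y" "E v \<noteq> D v"
    then have "v \<in> {i, Suc i, a}" using Eo by blast
    then show "\<exists>w d. E v = Arc w d \<and> x < w \<and> w < y" using Ei Es Ea that v by auto
  qed
  have ns: "\<not> (x < Suc i \<and> Suc i < y)" if "tiled D x y" for x y
    using that Ds by (auto elim: tiledE)
  show tE: "tiled E a i" by (rule tr[OF tai]) (use ai in auto)
  show "D = shift_prop i a E"
    using ai Di Ds Da by (auto simp: shift_prop_def E_def cup_def fun_eq_iff)
  have ud: "e = Undec" if "D p = Arc r e" "p < r" "a < p" "r < i" for p r e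
  proof (cases e)
    case LBlob
    then show ?thesis using nc_L[OF N, of p r] that ai tiledD[where D = D and x = 0 and y = p, OF _ Da] rng by auto
  next
    case RBlob
    then show ?thesis using nc_R[OF N, of p r] that ai ns[of r "Suc n"] si by auto
  qed
  show "undec E a i"
    unfolding undec_def
  proof (intro allI impI; elim conjE)
    fix v w e assume v: "a < v" "v < i" "E v = Arc w e"
    then have Dv: "D v = Arc w e" using Eo[of v] by auto
    then have w: "a < w" "w < i" using tiledD[OF tai Dv] v by auto
    note Dw = ncD[OF N Dv]
    show "e = Undec"
    proof (cases "v < w")
      case True
      then show ?thesis using ud[OF Dv] v w by blast
    next
      case False
      then show ?thesis using ud[OF Dw(6)] v w Dw(5) by simp
    qed
  qed
  show "nc n E"
  proof (rule ncI)
    fix v w e assume v: "E v = Arc w e"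
    show "1 \<le> w \<and> w \<le> n \<and> w \<noteq> v \<and> E w = Arc v e"
    proof (cases "v \<in> {i, Suc i, a}")
      case False
      then have Dv: "D v = Arc w e" using Eo v by simp
      note Dw = ncD(6)[OF N Dv]
      have "w \<notin> {i, Suc i, a}" using False Dw Di Ds Da by auto
      then show ?thesis using ncD[OF N Dv] Eo by simp
    qed (use v Ei Es Ea rng ai si in auto)
  next
    fix p r e assume pr: "E p = Arc r e" "p < r"
    show "tiled E p r \<and> (e = LBlob \<longrightarrow> tiled E 0 p) \<and> (e = RBlob \<longrightarrow> tiled E r (Suc n))"
    proof (cases "p \<in> {i, Suc i, a}")
      case False
      then have Dp: "D p = Arc r e" using Eo pr by simp
      note Dr = ncD(6)[OF N Dp]
      have rn: "r \<noteq> i" "r \<noteq> Suc i" "r \<noteq> a" "p \<noteq> i" "p \<noteq> Suc i" "p \<noteq> a" using False Dr Di Ds Da by auto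
      note tp = nc_tiled[OF N Dp pr(2)]
      have 1: "\<not> (p < i \<and> i < r)" using ns[OF tp] rn by linarith
      then have 2: "\<not> (p < a \<and> a < r)" using tiledD[OF tp Da] by blast
      have "tiled E p r" using tr[OF tp] 1 2 ns[OF tp] by linarith
      moreover have "tiled E 0 p" if "e = LBlob"
      proof -
        have t0: "tiled D 0 p" using nc_L[OF N] Dp that pr(2) by blast
        have "a < p \<longleftrightarrow> i < p" using tiledD[OF t0 Di] tiledD[OF t0 Da] rng ai by auto
        then show ?thesis using tr[OF t0] ns[OF t0] rn ai by linarith
      qed
      moreover have "tiled E r (Suc n)" if "e = RBlob"
      proof -
        have t0: "tiled D r (Suc n)" using nc_R[OF N] Dp that pr(2) by blast
        show ?thesis using tr[OF t0] ns[OF t0] rn ai si by linarith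
      qed
      ultimately show ?thesis by blast
    next
      case True
      then have "p = i" "r = Suc i" "e = Undec"
        using pr Ei Es Ea by auto
      then show ?thesis by simp
    qed
  qed
qed

definition set_deco :: "nat \<Rightarrow> nat \<Rightarrow> deco \<Rightarrow> hdiag \<Rightarrow> hdiag" where
  "set_deco a b e D = D(a := Arc b e, b := Arc a e)"

lemma tiled_set_deco:
  assumes "D a = Arc b d" "D b = Arc a d"
  shows "tiled (set_deco a b e D) x y = tiled D x y"
proof
  assume *: "tiled D x y"
  then show "tiled (set_deco a b e D) x y"
  proof (rule tiled_transfer)
    fix v assume v: "x < v" "v < y" "set_deco a b e D v \<noteq> D v"
    then have "v = a \<or> v = b" by (auto simp: set_deco_def split: if_splits)
    moreover have "set_deco a b e D a = Arc b e" "set_deco a b e D b = Arc a e"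
      using assms by (auto simp: set_deco_def)
    ultimately show "\<exists>w d. set_deco a b e D v = Arc w d \<and> x < w \<and> w < y"
      using tiledD[OF * assms(1)] tiledD[OF * assms(2)] v by blast
  qed
next
  assume *: "tiled (set_deco a b e D) x y"
  then show "tiled D x y"
  proof (rule tiled_transfer)
    fix v assume v: "x < v" "v < y" "D v \<noteq> set_deco a b e D v"
    then have "v = a \<or> v = b" by (auto simp: set_deco_def split: if_splits)
    moreover have "set_deco a b e D a = Arc b e" "set_deco a b e D b = Arc a e"
      using assms by (auto simp: set_deco_def)
    ultimately show "\<exists>w d. D v = Arc w d \<and> x < w \<and> w < y"
      using tiledD[OF *, of a b e] tiledD[OF *, of b a e] assms v by blast
  qed
qed

text \<open>The matching is unchanged, so only the exposure of the redecorated arc itself is at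
  stake.\<close>

lemma nc_set_deco:
  assumes N: "nc n D" and D: "D a = Arc b d" and ab: "a < b"
  shows "nc n (set_deco a b e D) \<longleftrightarrow> (e = LBlob \<longrightarrow> tiled D 0 a) \<and> (e = RBlob \<longrightarrow> tiled D b (Suc n))"
proof -
  note Db = ncD(6)[OF N D]
  note t = tiled_set_deco[OF D Db]
  have E: "set_deco a b e D a = Arc b e" "set_deco a b e D b = Arc a e"
     "\<And>v. v \<noteq> a \<Longrightarrow> v \<noteq> b \<Longrightarrow> set_deco a b e D v = D v" 
    using ab by (auto simp: set_deco_def)
  show ?thesis
  proof
    assume "nc n (set_deco a b e D)"
    from nc_L[OF this, of a b] nc_R[OF this, of a b] show "(e = LBlob \<longrightarrow> tiled D 0 a) \<and> (e = RBlob \<longrightarrow> tiled D b (Suc n))"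
      using E ab t by auto
  next
    assume c: "(e = LBlob \<longrightarrow> tiled D 0 a) \<and> (e = RBlob \<longrightarrow> tiled D b (Suc n))"
    show "nc n (set_deco a b e D)"
    proof (rule ncI)
      fix v w f assume v: "set_deco a b e D v = Arc w f"
      show "1 \<le> w \<and> w \<le> n \<and> w \<noteq> v \<and> set_deco a b e D w = Arc v f"
      proof (cases "v = a \<or> v = b")
        case True
        then show ?thesis using v E(1,2) ncD(1-5)[OF N D] by fastforce
      next
        case False
        then have Dv: "D v = Arc w f" using v E by simp
        then have "w \<noteq> a" "w \<noteq> b" using ncD(6)[OF N Dv] D Db False by auto
        then show ?thesis using ncD[OF N Dv] E(3) by simp
      qed
    next
      fix p r f assume p: "set_deco a b e D p = Arc r f" "p < r"
      show "tiled (set_deco a b e D) p r \<and> (f = LBlob \<longrightarrow> tiled (set_deco a b e D) 0 p)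
        \<and> (f = RBlob \<longrightarrow> tiled (set_deco a b e D) r (Suc n))"
      proof (cases "p = a \<or> p = b")
        case True
        then have "p = a" "r = b" "f = e" using p E ab by auto
        then show ?thesis using c t nc_tiled[OF N D ab] by simp
      next
        case False
        then have "D p = Arc r f" using p E by simp
        then show ?thesis
          using t nc_tiled[OF N, of p r f] nc_L[OF N, of p r] nc_R[OF N, of p r] p(2) by auto
      qed
    qed
  qed
qed

lemma tiled_split:
  assumes N: "nc n E" and t: "tiled E x i" and x: "Suc x < i"
  obtains b d where "E (Suc x) = Arc b d" "Suc x < b" "b < i" "E b = Arc (Suc x) d"
    "tiled E (Suc x) b" "tiled E b i"
proof -
  obtain b d where b: "E (Suc x) = Arc b d" "x < b" "b < i" using tiledE[OF t, of "Suc x"] x by auto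
  note b' = ncD[OF N b(1)]
  have xb: "Suc x < b" using b b' by simp
  note tb = nc_tiled[OF N b(1) xb]
  have "tiled E b i" by (rule tiled_drop[OF N t _ b(1) _ xb]) simp_all
  with that b b' xb tb show thesis by blast
qed

text \<open>The vertices strictly inside are paired by arcs, so there is an even number of them. For
  the same reason all the halvings in the hook sizes are exact.\<close>

lemma tiled_odd:
  assumes N: "nc n E"
  shows "tiled E x i \<Longrightarrow> x < i \<Longrightarrow> odd (i - x)"
proof (induction "i - x" arbitrary: x i rule: less_induct)
  case less
  show ?case
  proof (cases "Suc x = i")
    case False
    then have "Suc x < i" using less by simp
    from tiled_split[OF N less(2) this] obtain b d where
      b: "Suc x < b" "b < i" "tiled E (Suc x) b" "tiled E b i" by metis
    then have "odd (b - Suc x)" "odd (i - b)" using less(1)[of b "Suc x"] less(1)[of i b] by auto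
    moreover have "i - x = Suc ((b - Suc x) + (i - b))" using b by simp
    ultimately show ?thesis by simp
  qed (use less in auto)
qed

text \<open>Induction along the top-level arcs between \<open>x\<close> and the fixed right end
  \<open>i\<close>, adding one arc on the left at a time.\<close>

lemma tiled_induct [consumes 3, case_names empty split]:
  assumes N: "nc n E" and t: "tiled E x i" "x < i"
    and emp: "\<And>x. Suc x = i \<Longrightarrow> P x"
    and spl: "\<And>x b d. Suc x < b \<Longrightarrow> b < i \<Longrightarrow> E (Suc x) = Arc b d \<Longrightarrow> E b = Arc (Suc x) d \<Longrightarrow>
        tiled E x i \<Longrightarrow> tiled E b i \<Longrightarrow> tiled E (Suc x) b \<Longrightarrow> P b \<Longrightarrow> P x"
  shows "P x"
  using t
proof (induction "i - x" arbitrary: x rule: less_induct)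
  case less
  show ?case
  proof (cases "Suc x = i")
    case False
    then have "Suc x < i" using less by simp
    from tiled_split[OF N less(2) this] obtain b d where
      b: "E (Suc x) = Arc b d" "Suc x < b" "b < i" "E b = Arc (Suc x) d"
        "tiled E (Suc x) b" "tiled E b i" by metis
    then have "P b" using less(1)[of b] by auto
    then show ?thesis using spl[of x b d] b less(2) by blast
  qed (use emp in auto)
qed

text \<open>Take the least \<open>x\<close> with \<open>tiled E x i\<close>. An arc ending at
  \<open>x\<close> from the left would extend the tiling, so \<open>x\<close> is the edge, a
  propagating line or the start of an arc enclosing the cup.\<close>

lemma left_boundary:
  assumes N: "nc n E" and cup: "E i = Arc (Suc i) e"
  obtains x where "x < i" "tiled E x i" 
    "x = 0 \<or> (1 \<le> x \<and> E x = Prop) \<or> (\<exists>y d. E x = Arc y d \<and> Suc i < y)"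
proof -
  have i: "1 \<le> i" "E (Suc i) = Arc i e" using ncD[OF N cup] by auto
  define x where "x = (LEAST x. tiled E x i)"
  have t0: "tiled E (i - 1) i" by simp
  have t: "tiled E x i" unfolding x_def by (rule LeastI[of "\<lambda>x. tiled E x i", OF t0])
  have "x \<le> i - 1" unfolding x_def by (rule Least_le[of "\<lambda>x. tiled E x i", OF t0])
  have lst: "\<not> tiled E y i" if "y < x" for y
    using not_less_Least[of y "\<lambda>x. tiled E x i"] that unfolding x_def by blast
  have xi: "x < i" using i \<open>x \<le> i - 1\<close> by simp
  have "\<exists>y d. E x = Arc y d \<and> Suc i < y" if nP: "E x \<noteq> Prop"
  proof -
    obtain w d where w: "E x = Arc w d" using nP by (cases "E x") auto
    note wx = ncD[OF N w]
    have "\<not> w < x"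
    proof
      assume wl: "w < x"
      have "tiled E (w - 1) i"
        unfolding tiled_def
      proof (intro allI impI)
        fix v assume v: "w - 1 < v \<and> v < i"
        consider "v = w" | "w < v" "v < x" | "v = x" | "x < v" using v by linarith
        then show "\<exists>u d. E v = Arc u d \<and> w - 1 < u \<and> u < i"
        proof cases
          case 2
          then obtain u d where "E v = Arc u d" "w < u" "u < x"
            using tiledE[OF nc_tiled[OF N wx(6) wl], of v] by blast
          then show ?thesis using xi by auto
        next
          case 4
          then obtain u d where "E v = Arc u d" "x < u" "u < i" using tiledE[OF t, of v] v by blast
          then show ?thesis using wl by auto
        qed (use wx w wl xi in auto)
      qed
      moreover have "w - 1 < x" using wl wx(3) by linarith
      ultimately show False using lst by blast
    qed
    moreover have "\<not> (x < w \<and> w < i)"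
      using tiledD[OF t wx(6)] by auto
    moreover have "w \<noteq> i" "w \<noteq> Suc i" using wx cup i xi by auto
    ultimately have "Suc i < w" using wx by linarith
    then show ?thesis using w by blast
  qed
  then show thesis using that[OF xi t] by (metis One_nat_def Suc_leI neq0_conv)
qed

lemma tiled_arcv:
  assumes "tiled E x y" "y \<le> Suc n"
  shows "{x<..<y} \<subseteq> arcv n E"
proof
  fix v assume v: "v \<in> {x<..<y}"
  then obtain w d where "E v = Arc w d" using tiledE[OF assms(1), of v] by (metis greaterThanLessThan_iff)
  then show "v \<in> arcv n E" using v assms(2) by (auto simp: arcv_def)
qed

lemma finite_arcv [simp]: "finite (arcv n E)"
  by (simp add: arcv_def)

text \<open>A tiled interval contains only vertices with arcs, and there are \<open>2 * l\<close> of
  them. This bounds every gap next to a cup and every hook size.\<close>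

lemma tiled_length:
  assumes "valid_hd n l E" "tiled E x y" "y \<le> Suc n"
  shows "y - x \<le> Suc (2 * l)"
  using card_mono[OF finite_arcv tiled_arcv[OF assms(2,3)]] assms(1) by (simp add: valid_hd_iff)

lemma tiled_full:
  assumes "valid_hd n l E" "tiled E x y" "y \<le> Suc n" "y - x = Suc (2 * l)"
  shows "arcv n E = {x<..<y}"
  using card_subset_eq[OF finite_arcv tiled_arcv[OF assms(2,3)]] assms(1,4) by (simp add: valid_hd_iff)

section \<open>Reflection of half-diagrams\<close>

fun swap :: "deco \<Rightarrow> deco" where
  "swap Undec = Undec" | "swap LBlob = RBlob" | "swap RBlob = LBlob"

lemma swap_swap [simp]: "swap (swap d) = d"
  by (cases d) auto

lemma swap_eq_iff [simp]: "swap d = Undec \<longleftrightarrow> d = Undec" "swap d = LBlob \<longleftrightarrow> d = RBlob"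
    "swap d = RBlob \<longleftrightarrow> d = LBlob"
  by (cases d; simp)+

fun mhv :: "nat \<Rightarrow> hv \<Rightarrow> hv" where
  "mhv n Prop = Prop" | "mhv n (Arc w d) = Arc (Suc n - w) (swap d)"

text \<open>Setting \<open>Prop\<close> outside \<open>1..n\<close> follows the convention of
  \<open>valid_hd\<close>, so that reflecting twice gives back the same function.\<close>

definition mir :: "nat \<Rightarrow> hdiag \<Rightarrow> hdiag" where
  "mir n D v = (if 1 \<le> v \<and> v \<le> n then mhv n (D (Suc n - v)) else Prop)"

lemma mir_upd: "1 \<le> v \<Longrightarrow> v \<le> n \<Longrightarrow> mir n (D(v := h)) = (mir n D)(Suc n - v := mhv n h)"
  by (auto simp: mir_def fun_eq_iff)

lemma mir_at: "1 \<le> v \<Longrightarrow> v \<le> n \<Longrightarrow> mir n D (Suc n - v) = mhv n (D v)"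
  by (auto simp: mir_def)

lemma mir_Arc: 
  assumes "nc n D" "D v = Arc w d" 
  shows "mir n D (Suc n - v) = Arc (Suc n - w) (swap d)"
  using ncD(1,2)[OF assms] assms by (simp add: mir_at)

lemma mhv_Prop_iff [simp]: "mhv n h = Prop \<longleftrightarrow> h = Prop"
  by (cases h) auto

lemma mir_mir:
  assumes "nc n D"
  shows "mir n (mir n D) = D"
proof
  fix v
  show "mir n (mir n D) v = D v"
  proof (cases "D v")
    case Prop
    then show ?thesis by (auto simp: mir_def)
  next
    case (Arc w d)
    then show ?thesis using ncD(1-4)[OF assms Arc] by (auto simp: mir_def)
  qed
qed

lemma mir_ArcD:
  assumes N: "nc n D" and "mir n D v = Arc w d"
  shows "D (Suc n - v) = Arc (Suc n - w) (swap d)" "1 \<le> v" "v \<le> n" "1 \<le> w" "w \<le> n"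
proof -
  show v: "1 \<le> v" "v \<le> n" using assms(2) by (auto simp: mir_def split: if_splits)
  obtain w' d' where w': "D (Suc n - v) = Arc w' d'" using assms(2) v by (cases "D (Suc n - v)") (auto simp: mir_def)
  then have "w = Suc n - w'" "d = swap d'" using assms(2) v by (auto simp: mir_def)
  then show "D (Suc n - v) = Arc (Suc n - w) (swap d)" "1 \<le> w" "w \<le> n" using w' ncD(1-4)[OF N w'] by auto
qed

lemma tiled_mir:
  assumes N: "nc n D" and t: "tiled D x y" and xy: "x \<le> Suc n" "y \<le> Suc n"
  shows "tiled (mir n D) (Suc n - y) (Suc n - x)"
  unfolding tiled_def
proof (intro allI impI)
  fix v assume v: "Suc n - y < v \<and> v < Suc n - x"
  then have "x < Suc n - v" "Suc n - v < y" by auto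
  then obtain w d where w: "D (Suc n - v) = Arc w d" "x < w" "w < y" using tiledE[OF t] by metis
  moreover have "Suc n - (Suc n - v) = v" using v by auto
  ultimately have "mir n D v = Arc (Suc n - w) (swap d)" using mir_Arc[OF N w(1)] by simp
  moreover have "Suc n - y < Suc n - w" "Suc n - w < Suc n - x" using w xy by auto
  ultimately show "\<exists>w d. mir n D v = Arc w d \<and> Suc n - y < w \<and> w < Suc n - x" by blast
qed

lemma nc_mir:
  assumes N: "nc n D"
  shows "nc n (mir n D)"
proof (rule ncI)
  fix v w d assume v: "mir n D v = Arc w d"
  note m = mir_ArcD[OF N v]
  note m' = ncD[OF N m(1)]
  have "mir n D w = Arc v d" using mir_Arc[OF N m'(6)] m by simp
  moreover have "w \<noteq> v" using m'(5) m(2-5) by auto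
  ultimately show "1 \<le> w \<and> w \<le> n \<and> w \<noteq> v \<and> mir n D w = Arc v d" using m by simp
next
  fix a b d assume v: "mir n D a = Arc b d" "a < b"
  note m = mir_ArcD[OF N v(1)]
  note m' = ncD(6)[OF N m(1)]
  have lt: "Suc n - b < Suc n - a" using v m by simp
  have "tiled (mir n D) a b" using tiled_mir[OF N nc_tiled[OF N m' lt]] m by simp
  moreover have "tiled (mir n D) 0 a" if "d = LBlob"
    using tiled_mir[OF N nc_R[OF N _ lt]] m m' that by simp
  moreover have "tiled (mir n D) b (Suc n)" if "d = RBlob"
    using tiled_mir[OF N nc_L[OF N _ lt]] m m' that by simp
  ultimately show "tiled (mir n D) a b \<and> (d = LBlob \<longrightarrow> tiled (mir n D) 0 a) \<and> (d = RBlob \<longrightarrow> tiled (mir n D) b (Suc n))"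
    by blast
qed

lemma valid_mir:
  assumes "valid_hd n l D"
  shows "valid_hd n l (mir n D)"
proof -
  have N: "nc n D" and c: "card (arcv n D) = 2 * l" using assms by (auto simp: valid_hd_iff)
  have "arcv n (mir n D) = (\<lambda>v. Suc n - v) ` arcv n D"
  proof (intro equalityI subsetI)
    fix v assume "v \<in> arcv n (mir n D)"
    then show "v \<in> (\<lambda>v. Suc n - v) ` arcv n D"
      by (intro image_eqI[of _ _ "Suc n - v"]) (auto simp: arcv_def mir_def)
  qed (auto simp: arcv_def mir_def)
  moreover have "inj_on (\<lambda>v. Suc n - v) (arcv n D)" by (auto simp: inj_on_def arcv_def)
  ultimately show ?thesis using nc_mir[OF N] c by (simp add: valid_hd_iff card_image)
qed

lemma combine_swap:
  "combine q Q2 Q1 (swap d2) (swap d1) = map_option (map_prod id swap) (combine q Q1 Q2 d1 d2)"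
  by (cases d1; cases d2; simp)

lemma loopval_swap: "loopval q Q2 Q1 (swap d) = loopval q Q1 Q2 d"
  by (cases d) (auto simp: loopval_def)

lemma mir_cup: 
  assumes "1 \<le> i" "Suc i \<le> n"
  shows "mir n (cup i D) = cup (n - i) (mir n D)"
proof -
  have "Suc n - i = Suc (n - i)" "Suc n - Suc i = n - i" using assms by auto
  then show ?thesis using assms by (simp add: cup_def mir_upd fun_upd_twist)
qed

text \<open>Reflection carries \<open>e_i\<close> to the generator at \<open>n - i\<close> and
  exchanges the two blob parameters; results about the left side of a cup thereby yield those about
  its right side.\<close>

lemma act_mir:
  assumes N: "nc n D" and i: "1 \<le> i" "Suc i \<le> n"
  shows "act q Q2 Q1 n (GenEi (n - i)) (mir n D) = map_option (map_prod id (mir n)) (act q Q1 Q2 n (GenEi i) D)"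
proof -
  have e: "Suc (n - i) = Suc n - i" "n - i = Suc n - Suc i" using i by auto
  have at: "mir n D (n - i) = mhv n (D (Suc i))" "mir n D (Suc (n - i)) = mhv n (D i)"
    using i mir_at[of "Suc i" n D] mir_at[of i n D] by (simp_all add: Suc_diff_le)
  show ?thesis
  proof (cases "D i")
    case Prop
    then show ?thesis
    proof (cases "D (Suc i)")
      case (Arc b d)
      then show ?thesis using Prop at i ncD[OF N Arc] by (auto simp: mir_cup mir_upd)
    qed (use at in simp)
  next
    case A: (Arc a d1)
    note ra = ncD[OF N A]
    show ?thesis
    proof (cases "D (Suc i)")
      case Prop
      then show ?thesis using A at i ra by (auto simp: mir_cup mir_upd)
    next
      case B: (Arc b d2)
      note rb = ncD[OF N B]
      have ab: "a = Suc i \<longleftrightarrow> b = i" using ra(6) rb(6) A B by auto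
      show ?thesis
      proof (cases "a = Suc i")
        case True
        then have "b = i" "d1 = d2" using ab ra B A by auto
        then show ?thesis using True A B at i by (simp add: mir_cup loopval_swap Suc_diff_le)
      next
        case False
        then have nb: "Suc n - b \<noteq> Suc (n - i)" using ab rb i by auto
        have ne: "a \<noteq> b" using A B ra rb by auto
        then have ne': "Suc n - a \<noteq> Suc n - b" using ra rb by auto
        show ?thesis
        proof (cases "combine q Q1 Q2 d1 d2")
          case None
          then show ?thesis using False nb A B at by (simp add: combine_swap)
        next
          case (Some cd)
          obtain c d where "cd = (c, d)" by (cases cd)
          then show ?thesis using Some False nb A B at i ra rb ne'
            by (simp add: combine_swap mir_cup mir_upd fun_upd_twist)
        qed
      qed
    qed
  qed
qed

section \<open>Hook products\<close>

text \<open>A blobbed arc is measured as if it were stretched to the edge it touches; the size is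
  half the number of vertices in the resulting block.\<close>

definition hsize :: "nat \<Rightarrow> nat \<Rightarrow> nat \<Rightarrow> deco \<Rightarrow> int" where
  "hsize n a c d = (case d of Undec \<Rightarrow> (int c - int a + 1) div 2 | LBlob \<Rightarrow> int c div 2
     | RBlob \<Rightarrow> (int n - int a + 1) div 2)"

text \<open>The part of a hook that stays non-zero under specialisation because \<open>w_1\<close>
  and \<open>w_2\<close> are not integers. Only the other part, \<open>[hsize]\<close>, can vanish
  at the root of unity.\<close>

definition hunit :: "'k::field \<Rightarrow> 'k \<Rightarrow> 'k \<Rightarrow> nat \<Rightarrow> nat \<Rightarrow> nat \<Rightarrow> deco \<Rightarrow> 'k" where
  "hunit q Q1 Q2 n a c d = (case d of Undec \<Rightarrow> 1 | LBlob \<Rightarrow> qw q Q1 ((1 - int a) div 2)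
     | RBlob \<Rightarrow> qw q Q2 ((int c - int n) div 2))"

definition hook :: "'k::field \<Rightarrow> 'k \<Rightarrow> 'k \<Rightarrow> nat \<Rightarrow> nat \<Rightarrow> nat \<Rightarrow> deco \<Rightarrow> 'k" where
  "hook q Q1 Q2 n a c d = qn q (hsize n a c d) * hunit q Q1 Q2 n a c d"

definition fac :: "'k::field \<Rightarrow> 'k \<Rightarrow> 'k \<Rightarrow> nat \<Rightarrow> (nat \<Rightarrow> 'k) \<Rightarrow> hdiag \<Rightarrow> nat \<Rightarrow> 'k" where
  "fac q Q1 Q2 n \<sigma> D a = (case D a of Prop \<Rightarrow> \<sigma> a
     | Arc c d \<Rightarrow> if a < c then hook q Q1 Q2 n a c d else 1)"

text \<open>\<open>h\<^sub>3\<close> without its numerator. The signs \<open>\<sigma>\<close> of the propagating lines are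
  arbitrary because reflecting the diagrams does not preserve the sign pattern of \<open>h\<^sub>3\<close>.\<close>
definition hk :: "'k::field \<Rightarrow> 'k \<Rightarrow> 'k \<Rightarrow> nat \<Rightarrow> (nat \<Rightarrow> 'k) \<Rightarrow> hdiag \<Rightarrow> 'k" where
  "hk q Q1 Q2 n \<sigma> D = inverse (\<Prod>a\<in>{1..n}. fac q Q1 Q2 n \<sigma> D a)"

definition coef :: "'k::field \<Rightarrow> 'k \<Rightarrow> 'k \<Rightarrow> nat \<Rightarrow> (nat \<Rightarrow> 'k) \<Rightarrow> nat \<Rightarrow> hdiag \<Rightarrow> hdiag \<Rightarrow> 'k" where
  "coef q Q1 Q2 n \<sigma> i E D = (case act q Q1 Q2 n (GenEi i) D of None \<Rightarrow> 0
     | Some (c, E') \<Rightarrow> if E' = E then c * hk q Q1 Q2 n \<sigma> D else 0)"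

text \<open>The coefficient of \<open>E\<close> after applying \<open>e_i\<close> to the vector of
  inverse hook products, restricted to the class \<open>P\<close> of diagrams
  \<open>D\<close>.\<close>

definition clsum :: "'k::field \<Rightarrow> 'k \<Rightarrow> 'k \<Rightarrow> nat \<Rightarrow> nat \<Rightarrow> (nat \<Rightarrow> 'k) \<Rightarrow> nat \<Rightarrow> hdiag \<Rightarrow> (hdiag \<Rightarrow> bool) \<Rightarrow> 'k" where
  "clsum q Q1 Q2 n l \<sigma> i E P = (\<Sum>D\<in>{D. valid_hd n l D \<and> P D}. coef q Q1 Q2 n \<sigma> i E D)"

lemma hook_mir:
  assumes "w < v" "v \<le> n"
  shows "hook q Q2 Q1 n (Suc n - v) (Suc n - w) (swap d) = hook q Q1 Q2 n w v d"
proof -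
  have "int (Suc n - v) = int n + 1 - int v" "int (Suc n - w) = int n + 1 - int w"
    using assms by auto
  then show ?thesis by (cases d) (auto simp: hook_def hsize_def hunit_def algebra_simps)
qed

lemma hk_mir:
  assumes N: "nc n D"
  shows "hk q Q2 Q1 n (\<lambda>a. \<sigma> (Suc n - a)) (mir n D) = hk q Q1 Q2 n \<sigma> D"
proof -
  \<comment> \<open>A factor sits at the left end of its arc, which reflection makes the right end.
    The two products are therefore matched through the partner of a vertex.\<close>
  define \<pi> where "\<pi> v = (case D v of Prop \<Rightarrow> v | Arc w d \<Rightarrow> w)" for v
  have \<pi>: "\<pi> v \<in> {1..n}" "\<pi> (\<pi> v) = v" if "v \<in> {1..n}" for v
  proof -
    have "\<pi> v \<in> {1..n} \<and> \<pi> (\<pi> v) = v"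
    proof (cases "D v")
      case (Arc w d)
      then show ?thesis using ncD[OF N Arc] by (simp add: \<pi>_def)
    qed (use that in \<open>simp add: \<pi>_def\<close>)
    then show "\<pi> v \<in> {1..n}" "\<pi> (\<pi> v) = v" by auto
  qed
  have "(\<Prod>a\<in>{1..n}. fac q Q2 Q1 n (\<lambda>a. \<sigma> (Suc n - a)) (mir n D) a) = (\<Prod>v\<in>{1..n}. fac q Q1 Q2 n \<sigma> D v)"
  proof (rule prod.reindex_bij_witness[where i = "\<lambda>v. Suc n - \<pi> v" and j = "\<lambda>a. \<pi> (Suc n - a)"])
    fix a assume a: "a \<in> {1..n}"
    obtain v where v: "v \<in> {1..n}" "Suc n - a = v" "Suc n - v = a"
      by (rule that[of "Suc n - a"]) (use a in auto)
    show "Suc n - \<pi> (\<pi> (Suc n - a)) = a" using \<pi>[OF v(1)] v by simp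
    show "\<pi> (Suc n - a) \<in> {1..n}" using \<pi>[OF v(1)] v by simp
    show "fac q Q1 Q2 n \<sigma> D (\<pi> (Suc n - a)) = fac q Q2 Q1 n (\<lambda>a. \<sigma> (Suc n - a)) (mir n D) a"
    proof (cases "D v")
      case Prop
      then have "mir n D a = Prop" using v mir_at[of v n D] by simp
      then show ?thesis using Prop v by (simp add: fac_def \<pi>_def)
    next
      case (Arc w d)
      note wv = ncD[OF N Arc]
      have m: "mir n D a = Arc (Suc n - w) (swap d)" using mir_Arc[OF N Arc] v by simp
      have pv: "\<pi> (Suc n - a) = w" using Arc v by (simp add: \<pi>_def)
      show ?thesis
      proof (cases "w < v")
        case True
        then have "a < Suc n - w" using v wv by auto
        then show ?thesis using m pv wv(6) True hook_mir[OF True wv(2), of q Q2 Q1 d] v by (simp add: fac_def)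
      next
        case False
        then have "\<not> a < Suc n - w" using v wv by auto
        then show ?thesis using m pv wv(6) False by (simp add: fac_def)
      qed
    qed
  next
    fix v assume v: "v \<in> {1..n}"
    have "Suc n - (Suc n - \<pi> v) = \<pi> v" using \<pi>[OF v] by auto
    then show "\<pi> (Suc n - (Suc n - \<pi> v)) = v" using \<pi>[OF v] by simp
    show "Suc n - \<pi> v \<in> {1..n}" using \<pi>[OF v] by auto
  qed
  then show ?thesis by (simp add: hk_def)
qed

lemma hk_change:
  assumes "\<And>v. v \<notin> Z \<Longrightarrow> D v = E v" "Z \<subseteq> {1..n}"
    and "\<And>v. v \<in> {1..n} \<Longrightarrow> fac q Q1 Q2 n \<sigma> D v \<noteq> 0" "\<And>v. v \<in> {1..n} \<Longrightarrow> fac q Q1 Q2 n \<sigma> E v \<noteq> 0"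
  shows "hk q Q1 Q2 n \<sigma> D = hk q Q1 Q2 n \<sigma> E * (\<Prod>v\<in>Z. fac q Q1 Q2 n \<sigma> E v) / (\<Prod>v\<in>Z. fac q Q1 Q2 n \<sigma> D v)"
proof -
  have Z: "finite Z" using assms(2) finite_subset by blast
  have "(\<Prod>v\<in>{1..n} - Z. fac q Q1 Q2 n \<sigma> D v) = (\<Prod>v\<in>{1..n} - Z. fac q Q1 Q2 n \<sigma> E v)"
    by (rule prod.cong) (auto simp: fac_def assms(1))
  moreover have *: "(\<Prod>v\<in>{1..n}. f v) = (\<Prod>v\<in>{1..n} - Z. f v) * (\<Prod>v\<in>Z. f v)" for f :: "nat \<Rightarrow> 'a"
    by (rule prod.subset_diff) (use assms(2) in auto)
  moreover have "(\<Prod>v\<in>Z. fac q Q1 Q2 n \<sigma> E v) \<noteq> 0" "(\<Prod>v\<in>Z. fac q Q1 Q2 n \<sigma> D v) \<noteq> 0"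
    using assms Z by (auto simp: subset_iff)
  ultimately show ?thesis unfolding hk_def *[of "fac _ _ _ _ _ _"] by (simp add: field_simps)
qed

text \<open>\<open>mir\<close> forgets everything outside \<open>1..n\<close>; this condition
  suffices for it to be injective, and it can be shown for the result of \<open>act\<close> before
  that result is known to be valid.\<close>

definition bounded_hd :: "nat \<Rightarrow> hdiag \<Rightarrow> bool" where
  "bounded_hd n D \<longleftrightarrow> (\<forall>v w d. D v = Arc w d \<longrightarrow> 1 \<le> v \<and> v \<le> n \<and> 1 \<le> w \<and> w \<le> n)"

lemma nc_bounded: "nc n D \<Longrightarrow> bounded_hd n D"
  unfolding bounded_hd_def using ncD(1-4) by blast

lemma swap_inject: "swap d = swap e \<longleftrightarrow> d = e"
  by (metis swap_swap)

lemma mir_inj: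
  assumes "bounded_hd n D" "bounded_hd n E" "mir n D = mir n E"
  shows "D = E"
proof
  fix v
  show "D v = E v"
  proof (cases "1 \<le> v \<and> v \<le> n")
    case True
    then have "mhv n (D v) = mhv n (E v)" using mir_at assms(3) by metis
    moreover have "D v = Arc w d \<Longrightarrow> w \<le> n" "E v = Arc w d \<Longrightarrow> w \<le> n" for w d
      using assms(1,2) unfolding bounded_hd_def by blast+
    ultimately show ?thesis by (cases "D v"; cases "E v") (auto simp: swap_inject)
  next
    case False
    then have "D v = Prop" "E v = Prop"
      using assms(1,2) unfolding bounded_hd_def by (meson hv.exhaust)+
    then show ?thesis by simp
  qed
qed

lemma bounded_upd:
  "bounded_hd n D \<Longrightarrow> 1 \<le> v \<Longrightarrow> v \<le> n \<Longrightarrow> 1 \<le> w \<Longrightarrow> w \<le> n \<Longrightarrow> bounded_hd n (D(v := Arc w d))"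
  "bounded_hd n D \<Longrightarrow> bounded_hd n (D(v := Prop))"
  unfolding bounded_hd_def by auto

lemma act_bounded:
  assumes N: "nc n D" and i: "1 \<le> i" "Suc i \<le> n" and a: "act q Q1 Q2 n (GenEi i) D = Some (c, E)"
  shows "bounded_hd n E"
proof -
  note B = nc_bounded[OF N]
  have cupb: "bounded_hd n (cup i F)" if "bounded_hd n F" for F
    unfolding cup_def using i that by (intro bounded_upd) auto
  show ?thesis
  proof (cases "D i")
    case A: (Arc w d1)
    show ?thesis
    proof (cases "D (Suc i)")
      case (Arc b d2)
      then show ?thesis using a A ncD(1-4)[OF N A] ncD(1-4)[OF N Arc] B
        by (auto split: if_splits option.splits intro!: cupb bounded_upd)
    qed (use a A B in \<open>auto split: if_splits intro!: cupb bounded_upd\<close>)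
  next
    case Prop
    then show ?thesis using a B
      by (cases "D (Suc i)") (auto split: if_splits intro!: cupb bounded_upd)
  qed
qed

declare act.simps [simp del]

lemma coef_mir:
  assumes N: "nc n D" and i: "1 \<le> i" "Suc i \<le> n" and E: "nc n E"
  shows "coef q Q2 Q1 n (\<lambda>a. \<sigma> (Suc n - a)) (n - i) (mir n E) (mir n D) = coef q Q1 Q2 n \<sigma> i E D"
proof (cases "act q Q1 Q2 n (GenEi i) D")
  case None
  then show ?thesis using act_mir[OF N i, of q Q2 Q1] by (simp add: coef_def)
next
  case (Some p)
  obtain c E' where p: "p = (c, E')" by (cases p)
  have a: "act q Q2 Q1 n (GenEi (n - i)) (mir n D) = Some (c, mir n E')"
    using act_mir[OF N i, of q Q2 Q1] Some p by simp
  have "mir n E' = mir n E \<longleftrightarrow> E' = E"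
    using mir_inj[OF act_bounded[OF N i] nc_bounded[OF E]] Some p by blast
  then show ?thesis using a Some p hk_mir[OF N, of q Q2 Q1 \<sigma>] by (simp add: coef_def)
qed

lemma clsum_mir:
  assumes i: "1 \<le> i" "Suc i \<le> n" and E: "nc n E"
  shows "clsum q Q2 Q1 n l (\<lambda>a. \<sigma> (Suc n - a)) (n - i) (mir n E) (\<lambda>D. P (mir n D)) = clsum q Q1 Q2 n l \<sigma> i E P"
  unfolding clsum_def
proof (rule sum.reindex_bij_witness[where i = "mir n" and j = "mir n"])
  fix D assume D: "D \<in> {D. valid_hd n l D \<and> P (mir n D)}"
  then have N: "nc n D" by (simp add: valid_hd_iff)
  show "mir n (mir n D) = D" by (rule mir_mir[OF N])
  show "mir n D \<in> {D. valid_hd n l D \<and> P D}" using D valid_mir by blast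
  show "coef q Q1 Q2 n \<sigma> i E (mir n D) = coef q Q2 Q1 n (\<lambda>a. \<sigma> (Suc n - a)) (n - i) (mir n E) D"
    using coef_mir[OF nc_mir[OF N] i E, of q Q2 Q1 \<sigma>] mir_mir[OF N] by simp
next
  fix D assume D: "D \<in> {D. valid_hd n l D \<and> P D}"
  then have N: "nc n D" by (simp add: valid_hd_iff)
  show "mir n (mir n D) = D" by (rule mir_mir[OF N])
  then show "mir n D \<in> {D. valid_hd n l D \<and> P (mir n D)}" using D valid_mir by auto
qed

section \<open>Explicit preimages under \<open>e_i\<close>\<close>

lemma act_join:
  assumes "E i = Arc (Suc i) Undec" "E (Suc i) = Arc i Undec" "E a = Arc b d" "E b = Arc a d"
    and "a \<noteq> i" "a \<noteq> Suc i" "b \<noteq> i" "b \<noteq> Suc i" "a \<noteq> b"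
    and "combine q Q1 Q2 d1 d2 = Some (c, d)"
  shows "act q Q1 Q2 n (GenEi i) (join i a b d1 d2 E) = Some (c, E)"
proof -
  have "join i a b d1 d2 E i = Arc a d1" "join i a b d1 d2 E (Suc i) = Arc b d2"
    using assms by (auto simp: join_def)
  moreover have "cup i ((join i a b d1 d2 E)(a := Arc b d, b := Arc a d)) = E"
    using assms by (auto simp: join_def cup_def fun_eq_iff)
  ultimately show ?thesis using assms by (simp add: act.simps)
qed

lemma act_shift_prop:
  assumes "E i = Arc (Suc i) Undec" "E (Suc i) = Arc i Undec" "E a = Prop" "a \<noteq> i" "a \<noteq> Suc i"
  shows "act q Q1 Q2 n (GenEi i) (shift_prop i a E) = Some (1, E)"
proof -
  have "shift_prop i a E i = Arc a Undec" "shift_prop i a E (Suc i) = Prop"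
    using assms by (auto simp: shift_prop_def)
  moreover have "cup i ((shift_prop i a E)(a := Prop)) = E"
    using assms by (auto simp: shift_prop_def cup_def fun_eq_iff)
  ultimately show ?thesis by (simp add: act.simps)
qed

lemma act_set_deco:
  assumes "E i = Arc (Suc i) Undec" "E (Suc i) = Arc i Undec"
  shows "act q Q1 Q2 n (GenEi i) (set_deco i (Suc i) e E) = Some (loopval q Q1 Q2 e, E)"
proof -
  have "cup i (set_deco i (Suc i) e E) = E"
    using assms by (auto simp: set_deco_def cup_def fun_eq_iff)
  then show ?thesis by (simp add: act.simps set_deco_def)
qed

text \<open>The way every class sum is evaluated: \<open>J\<close> parametrises the members of the
  class that \<open>e_i\<close> sends to a non-zero multiple of \<open>E\<close>.\<close>

lemma clsum_image:
  assumes "inj_on J A"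
    and "\<And>a. a \<in> A \<Longrightarrow> valid_hd n l (J a) \<and> P (J a) \<and> coef q Q1 Q2 n \<sigma> i E (J a) = g a"
    and "\<And>D. valid_hd n l D \<Longrightarrow> P D \<Longrightarrow> coef q Q1 Q2 n \<sigma> i E D \<noteq> 0 \<Longrightarrow> D \<in> J ` A"
  shows "clsum q Q1 Q2 n l \<sigma> i E P = (\<Sum>a\<in>A. g a)"
proof -
  have "clsum q Q1 Q2 n l \<sigma> i E P = (\<Sum>D\<in>J ` A. coef q Q1 Q2 n \<sigma> i E D)"
    unfolding clsum_def
    by (rule sum.mono_neutral_right)
       (use assms(2,3) finite_valid_hd[of n l] in \<open>auto intro: finite_subset[of _ "{D. valid_hd n l D}"]\<close>)
  also have "\<dots> = (\<Sum>a\<in>A. coef q Q1 Q2 n \<sigma> i E (J a))"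
    using assms(1) by (simp add: sum.reindex)
  also have "\<dots> = (\<Sum>a\<in>A. g a)"
    using assms(2) by (intro sum.cong) auto
  finally show ?thesis .
qed

lemma arcv_cong: "(\<And>v. D v = Prop \<longleftrightarrow> E v = Prop) \<Longrightarrow> arcv n D = arcv n E"
  by (auto simp: arcv_def)

lemma valid_join:
  assumes V: "valid_hd n l E" and cup: "E i = Arc (Suc i) Undec" and ab: "E a = Arc b d" and ai: "a < i"
    and t: "tiled E a i" and u: "undec E a i"
    and c: "b < a \<and> d1 = Undec \<and> d2 = d \<or> Suc i < b \<and> d1 \<in> {Undec, d} \<and> d2 \<in> {Undec, d}"
  shows "valid_hd n l (join i a b d1 d2 E)"
proof -
  note N = valid_nc[OF V]
  have E: "E (Suc i) \<noteq> Prop" "E b \<noteq> Prop" using ncD(6)[OF N cup] ncD(6)[OF N ab] by auto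
  have "arcv n (join i a b d1 d2 E) = arcv n E"
    by (rule arcv_cong) (use cup ab E in \<open>auto simp: join_def\<close>)
  then show ?thesis using nc_join[OF N cup ab ai t u c] V by (simp add: valid_hd_iff)
qed

lemma valid_of_join:
  assumes V: "valid_hd n l D" and Di: "D i = Arc a d1" and Ds: "D (Suc i) = Arc b d2" and ai: "a < i"
    and c: "d1 = Undec \<and> d = d2 \<or> d2 = Undec \<and> d = d1 \<or> d1 = d2 \<and> d = d1"
  defines "E \<equiv> cup i (D(a := Arc b d, b := Arc a d))"
  shows "valid_hd n l E"
proof -
  note N = valid_nc[OF V]
  have E: "D a \<noteq> Prop" "D b \<noteq> Prop" using ncD(6)[OF N Di] ncD(6)[OF N Ds] by auto
  have "arcv n E = arcv n D"
    by (rule arcv_cong) (use Di Ds E in \<open>auto simp: E_def cup_def\<close>)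
  then show ?thesis using nc_of_join[OF N Di Ds ai c] V by (simp add: valid_hd_iff E_def)
qed

lemma card_exchange: "finite A \<Longrightarrow> x \<in> A \<Longrightarrow> y \<notin> A \<Longrightarrow> card (insert y (A - {x})) = card A"
  by (metis Diff_iff card.remove card_insert_disjoint finite_Diff)

lemma valid_shift_prop:
  assumes V: "valid_hd n l E" and cup: "E i = Arc (Suc i) Undec" and Ea: "E a = Prop" and ai: "a < i" "1 \<le> a"
    and t: "tiled E a i" and u: "undec E a i"
  shows "valid_hd n l (shift_prop i a E)"
proof -
  note N = valid_nc[OF V]
  have r: "Suc i \<le> n" "E (Suc i) \<noteq> Prop" using ncD[OF N cup] by auto
  have "arcv n (shift_prop i a E) = insert a (arcv n E - {Suc i})"
    using cup Ea ai r by (auto simp: arcv_def shift_prop_def)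
  moreover have "card \<dots> = card (arcv n E)"
    by (rule card_exchange) (use Ea r in \<open>auto simp: arcv_def\<close>)
  ultimately show ?thesis using nc_shift_prop[OF N cup Ea ai t u] V by (simp add: valid_hd_iff)
qed

lemma valid_of_shift_prop:
  assumes V: "valid_hd n l D" and Di: "D i = Arc a Undec" and Ds: "D (Suc i) = Prop" and ai: "a < i" and si: "Suc i \<le> n"
  defines "E \<equiv> cup i (D(a := Prop))"
  shows "valid_hd n l E"
proof -
  note N = valid_nc[OF V]
  have r: "1 \<le> a" "D a \<noteq> Prop" using ncD[OF N Di] by auto
  have "arcv n E = insert (Suc i) (arcv n D - {a})"
    using Di Ds ai si r by (auto simp: arcv_def E_def cup_def)
  moreover have "card \<dots> = card (arcv n D)"
    by (rule card_exchange) (use Ds r ai si in \<open>auto simp: arcv_def\<close>)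
  ultimately show ?thesis using nc_of_shift_prop[OF N Di Ds ai si] V by (simp add: valid_hd_iff E_def)
qed

lemma valid_set_deco:
  assumes V: "valid_hd n l D" and D: "D a = Arc b d" and ab: "a < b"
  shows "valid_hd n l (set_deco a b e D) \<longleftrightarrow> (e = LBlob \<longrightarrow> tiled D 0 a) \<and> (e = RBlob \<longrightarrow> tiled D b (Suc n))"
proof -
  note N = valid_nc[OF V]
  have r: "D b \<noteq> Prop" using ncD[OF N D] by auto
  have "arcv n (set_deco a b e D) = arcv n D"
    by (rule arcv_cong) (use D r in \<open>auto simp: set_deco_def\<close>)
  then show ?thesis using nc_set_deco[OF N D ab] V by (simp add: valid_hd_iff)
qed

text \<open>The generic situation, in which only \<open>[0]\<close> vanishes and all hooks are
  invertible. It holds for the rational functions and is stable under reflection with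
  \<open>Q1\<close> and \<open>Q2\<close> exchanged.\<close>

locale hook_weights =
  fixes q Q1 Q2 :: "'k::field" and n l :: nat and \<sigma> :: "nat \<Rightarrow> 'k"
  assumes q0: "q \<noteq> 0" "Q1 \<noteq> 0" "Q2 \<noteq> 0" and qd: "q - inverse q \<noteq> 0"
    and qn_nz: "\<And>m. m \<noteq> 0 \<Longrightarrow> qn q m \<noteq> 0"
    and qw_nz: "\<And>m. qw q Q1 m \<noteq> 0" "\<And>m. qw q Q2 m \<noteq> 0"
    and \<sigma>_nz: "\<And>a. \<sigma> a \<noteq> 0"
    and nl: "2 * l < n"
begin

abbreviation "hook' \<equiv> hook q Q1 Q2 n"
abbreviation "H \<equiv> hk q Q1 Q2 n \<sigma>"
abbreviation "fac' \<equiv> fac q Q1 Q2 n \<sigma>"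
abbreviation "coef' \<equiv> coef q Q1 Q2 n \<sigma>"
abbreviation "clsum' \<equiv> clsum q Q1 Q2 n l \<sigma>"

lemma mirror: "hook_weights q Q2 Q1 n l (\<lambda>a. \<sigma> (Suc n - a))"
  using q0 qd qn_nz qw_nz \<sigma>_nz nl by unfold_locales auto

lemma hook_nz:
  assumes "1 \<le> a" "a < c" "c \<le> n"
  shows "hook' a c d \<noteq> 0"
proof -
  have "hsize n a c d > 0" using assms by (cases d) (auto simp: hsize_def)
  then show ?thesis using qn_nz qw_nz by (cases d) (auto simp: hook_def hunit_def)
qed

lemma fac_nz:
  assumes N: "nc n D" and v: "v \<in> {1..n}"
  shows "fac' D v \<noteq> 0"
proof (cases "D v")
  case (Arc w d)
  then show ?thesis using ncD(1-4)[OF N Arc] hook_nz by (simp add: fac_def)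
qed (simp add: fac_def \<sigma>_nz)

lemma H_change:
  assumes "nc n D" "nc n E" "\<And>v. v \<notin> Z \<Longrightarrow> D v = E v" "Z \<subseteq> {1..n}"
  shows "H D = H E * (\<Prod>v\<in>Z. fac' E v) / (\<Prod>v\<in>Z. fac' D v)"
  by (rule hk_change) (use assms fac_nz in auto)

lemma hook_cup [simp]: "hook' i (Suc i) Undec = 1"
  using qd by (simp add: hook_def hsize_def hunit_def)

text \<open>The cup of \<open>E\<close> has hook \<open>[1] = 1\<close>, so the only change is that
  the hook of the cut arc gives way to the hooks of its two pieces.\<close>

lemma H_join_inner:
  assumes N: "nc n E" "nc n (join i a b Undec d E)"
    and cup: "E i = Arc (Suc i) Undec" and ab: "E a = Arc b d" and lt: "b < a" "a < i"
  shows "H (join i a b Undec d E) = H E * (hook' b a d / (hook' a i Undec * hook' b (Suc i) d))"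
proof -
  let ?D = "join i a b Undec d E"
  have E: "E (Suc i) = Arc i Undec" "E b = Arc a d" using ncD(6)[OF N(1) cup] ncD(6)[OF N(1) ab] by auto
  have D: "?D i = Arc a Undec" "?D (Suc i) = Arc b d" "?D a = Arc i Undec" "?D b = Arc (Suc i) d"
    using lt by (auto simp: join_def)
  have "H ?D = H E * (\<Prod>v\<in>{i, Suc i, a, b}. fac' E v) / (\<Prod>v\<in>{i, Suc i, a, b}. fac' ?D v)"
    by (rule H_change[OF N(2,1)])
       (use ncD(1-4)[OF N(1) cup] ncD(1-4)[OF N(1) ab] in \<open>auto simp: join_def\<close>)
  then show ?thesis using E D cup ab lt by (simp add: fac_def)
qed

lemma H_join_outer:
  assumes N: "nc n E" "nc n (join i a b d1 d2 E)"
    and cup: "E i = Arc (Suc i) Undec" and ab: "E a = Arc b d" and lt: "a < i" "Suc i < b"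
  shows "H (join i a b d1 d2 E) = H E * (hook' a b d / (hook' a i d1 * hook' (Suc i) b d2))"
proof -
  let ?D = "join i a b d1 d2 E"
  have E: "E (Suc i) = Arc i Undec" "E b = Arc a d" using ncD(6)[OF N(1) cup] ncD(6)[OF N(1) ab] by auto
  have D: "?D i = Arc a d1" "?D (Suc i) = Arc b d2" "?D a = Arc i d1" "?D b = Arc (Suc i) d2"
    using lt by (auto simp: join_def)
  have "H ?D = H E * (\<Prod>v\<in>{i, Suc i, a, b}. fac' E v) / (\<Prod>v\<in>{i, Suc i, a, b}. fac' ?D v)"
    by (rule H_change[OF N(2,1)])
       (use ncD(1-4)[OF N(1) cup] ncD(1-4)[OF N(1) ab] in \<open>auto simp: join_def\<close>)
  then show ?thesis using E D cup ab lt by (simp add: fac_def mult.commute)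
qed

lemma H_shift_prop:
  assumes N: "nc n E" "nc n (shift_prop i a E)"
    and cup: "E i = Arc (Suc i) Undec" and a: "E a = Prop" "1 \<le> a" "a < i"
  shows "H (shift_prop i a E) = H E * (\<sigma> a / (hook' a i Undec * \<sigma> (Suc i)))"
proof -
  let ?D = "shift_prop i a E"
  have E: "E (Suc i) = Arc i Undec" using ncD(6)[OF N(1) cup] by auto
  have D: "?D i = Arc a Undec" "?D (Suc i) = Prop" "?D a = Arc i Undec"
    using a by (auto simp: shift_prop_def)
  have "H ?D = H E * (\<Prod>v\<in>{i, Suc i, a}. fac' E v) / (\<Prod>v\<in>{i, Suc i, a}. fac' ?D v)"
    by (rule H_change[OF N(2,1)])
       (use ncD(1-4)[OF N(1) cup] a in \<open>auto simp: shift_prop_def\<close>)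
  then show ?thesis using E D cup a by (simp add: fac_def mult.commute)
qed

lemma H_set_deco:
  assumes N: "nc n E" "nc n (set_deco a b e E)" and a: "E a = Arc b d" "a < b"
  shows "H (set_deco a b e E) = H E * (hook' a b d / hook' a b e)"
proof -
  let ?D = "set_deco a b e E"
  have E: "E b = Arc a d" using ncD(6)[OF N(1) a(1)] by auto
  have D: "?D a = Arc b e" "?D b = Arc a e"
    using a by (auto simp: set_deco_def)
  have "H ?D = H E * (\<Prod>v\<in>{a, b}. fac' E v) / (\<Prod>v\<in>{a, b}. fac' ?D v)"
    by (rule H_change[OF N(2,1)])
       (use ncD(1-4)[OF N(1) a(1)] in \<open>auto simp: set_deco_def\<close>)
  then show ?thesis using E D a by (simp add: fac_def)
qed


end

section \<open>Telescoping sums over the arcs next to a cup\<close>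

lemma odd_diff_int:
  assumes "odd (i - a)" "a < i"
  obtains k :: int where "int i = int a + 2 * k + 1" "0 \<le> k"
proof -
  obtain m where "i - a = 2 * m + 1" using assms(1) by (elim oddE)
  then have "int i = int a + 2 * int m + 1" using assms(2) by linarith
  then show thesis using that[of "int m"] by simp
qed

context hook_weights
begin

text \<open>Cutting an arc to the left of the cup telescopes in these quotients.\<close>
definition tel :: "nat \<Rightarrow> nat \<Rightarrow> 'k" where
  "tel i z = qn q ((int i - int z + 1) div 2 - 1) / qn q ((int i - int z + 1) div 2)"

text \<open>The factor by which \<open>H E\<close> changes when the left sibling with right end
  \<open>a\<close> is cut. The value for \<open>Prop\<close> is a mere default, since only vertices
  of a tiled interval are summed over.\<close>

definition cut_ratio :: "nat \<Rightarrow> hdiag \<Rightarrow> nat \<Rightarrow> 'k" where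
  "cut_ratio i E a = (case E a of Prop \<Rightarrow> 0
     | Arc b d \<Rightarrow> hook' b a d / (hook' a i Undec * hook' b (Suc i) d))"

text \<open>The Pluecker relation for \<open>1\<close>, \<open>u\<close>, \<open>v\<close> with
  \<open>[1] = 1\<close>; it writes the ratio of hooks as a difference of two values of one
  function, which makes the sums telescope.\<close>

lemma qn_tel:
  assumes "u \<noteq> 0" "v \<noteq> 0"
  shows "qn q (v - u) / (qn q u * qn q v) = qn q (v - 1) / qn q v - qn q (u - 1) / qn q u"
proof -
  have "qn q 1 * qn q (u - v) + qn q u * qn q (v - 1) + qn q v * qn q (1 - u) = 0"
    by (rule qn_Plucker[OF q0(1)])
  moreover have "qn q (u - v) = - qn q (v - u)" "qn q (1 - u) = - qn q (u - 1)"
    using qn_minus[of q "v - u"] qn_minus[of q "u - 1"] by simp_all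
  ultimately have e: "qn q (v - u) = qn q u * qn q (v - 1) - qn q v * qn q (u - 1)"
    using qd by (simp add: algebra_simps)
  show ?thesis using qn_nz[OF assms(1)] qn_nz[OF assms(2)] unfolding e by (simp add: diff_divide_distrib)
qed

lemma tel_eq:
  assumes "int i = int a + 2 * k + 1" shows "tel i a = qn q k / qn q (k + 1)"
proof -
  have "(int i - int a + 1) div 2 = k + 1" using assms by simp
  then show ?thesis by (simp add: tel_def)
qed

lemma tel_cup: "i = Suc a \<Longrightarrow> tel i a = 0"
  by (simp add: tel_def)

lemma hook_Undec:
  assumes "int c = int a + 2 * s - 1" shows "hook' a c Undec = qn q s"
proof -
  have "(int c - int a + 1) div 2 = s" using assms by simp
  then show ?thesis by (simp add: hook_def hsize_def hunit_def)
qed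

lemma hook_LBlob:
  assumes "int c = 2 * s" "int a = 1 - 2 * t" shows "hook' a c LBlob = qn q s * qw q Q1 t"
proof -
  have "int c div 2 = s" "(1 - int a) div 2 = t" using assms by simp_all
  then show ?thesis by (simp add: hook_def hsize_def hunit_def)
qed

lemma hook_RBlob:
  assumes "int n = int a + 2 * s - 1" "int c = int n + 2 * t" shows "hook' a c RBlob = qn q s * qw q Q2 t"
proof -
  have "(int n - int a + 1) div 2 = s" "(int c - int n) div 2 = t" using assms by simp_all
  then show ?thesis by (simp add: hook_def hsize_def hunit_def)
qed

lemma cut_ratio_Undec:
  assumes E: "E a = Arc b Undec" and lt: "x < b" "b < a" "a < i" and od: "odd (i - a)" "odd (i - x)" "b = Suc x"
  shows "cut_ratio i E a = tel i x - tel i a"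
proof -
  obtain k where k: "int i = int a + 2 * k + 1" "0 \<le> k" using odd_diff_int[OF od(1) lt(3)] .
  have "x < i" using lt by simp
  then obtain m where m: "int i = int x + 2 * m + 1" "0 \<le> m" using odd_diff_int[OF od(2)] by blast
  have "hook' b a Undec = qn q (m - k)" by (rule hook_Undec) (use od k m in simp)
  moreover have "hook' a i Undec = qn q (k + 1)" by (rule hook_Undec) (use k in simp)
  moreover have "hook' b (Suc i) Undec = qn q (m + 1)" by (rule hook_Undec) (use od m in simp)
  ultimately show ?thesis
    unfolding cut_ratio_def using E qn_tel[of "k + 1" "m + 1"] k(2) m(2) tel_eq[OF k(1)] tel_eq[OF m(1)]
    by simp
qed

text \<open>The \<open>Q1\<close> factors of the arc and of its outer piece cancel, and the sizes
  are those of an arc starting at the left edge; hence \<open>tel i 0\<close> appears whatever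
  \<open>b\<close> is.\<close>

lemma cut_ratio_LBlob:
  assumes E: "E a = Arc b LBlob" and lt: "b < a" "a < i" and od: "odd (i - a)" "odd (a - b)" "odd b"
  shows "cut_ratio i E a = tel i 0 - tel i a"
proof -
  obtain k where k: "int i = int a + 2 * k + 1" "0 \<le> k" using odd_diff_int[OF od(1) lt(2)] .
  obtain p where p: "int a = int b + 2 * p + 1" "0 \<le> p" using odd_diff_int[OF od(2) lt(1)] .
  obtain t where t: "int b = int 0 + 2 * t + 1" "0 \<le> t" using odd_diff_int[of b 0] od(3) by (metis diff_zero odd_pos)
  define m where "m = k + p + t + 1"
  have m: "int i = int 0 + 2 * m + 1" "0 \<le> m" using k p t by (simp_all add: m_def)
  have "hook' b a LBlob = qn q (m - k) * qw q Q1 (- t)" by (rule hook_LBlob) (use k p t m_def in simp_all)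
  moreover have "hook' a i Undec = qn q (k + 1)" by (rule hook_Undec) (use k in simp)
  moreover have "hook' b (Suc i) LBlob = qn q (m + 1) * qw q Q1 (- t)" by (rule hook_LBlob) (use k p t m_def in simp_all)
  ultimately show ?thesis
    unfolding cut_ratio_def using E qn_tel[of "k + 1" "m + 1"] k(2) m(2) tel_eq[OF k(1)] tel_eq[OF m(1)] qw_nz
    by (simp add: field_simps)
qed

text \<open>The quantum integers of the two right-blobbed hooks cancel. By the Pluecker relation for
  \<open>Q2\<close>, the ratio together with the rest \<open>tel i a\<close> of the telescoping sum
  depends only on the distance from the cup to the right edge.\<close>

lemma cut_ratio_RBlob:
  assumes E: "E a = Arc b RBlob" and lt: "b < a" "a < i" "i < n" and od: "odd (i - a)" "odd (a - b)" "odd (Suc n - a)"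
    and B: "int n = int i + 2 * B + 1"
  shows "cut_ratio i E a + tel i a = qw q Q2 (- B - 1) / qw q Q2 (- B)"
proof -
  obtain k where k: "int i = int a + 2 * k + 1" "0 \<le> k" using odd_diff_int[OF od(1) lt(2)] .
  obtain p where p: "int a = int b + 2 * p + 1" "0 \<le> p" using odd_diff_int[OF od(2) lt(1)] .
  have *: "qn q (k + p + B + 2) \<noteq> 0" "qn q (k + 1) \<noteq> 0" using k p lt B by (auto intro!: qn_nz)
  have "hook' b a RBlob = qn q (k + p + B + 2) * qw q Q2 (- B - k - 1)" by (rule hook_RBlob) (use k p B in simp_all)
  moreover have "hook' a i Undec = qn q (k + 1)" by (rule hook_Undec) (use k in simp)
  moreover have "hook' b (Suc i) RBlob = qn q (k + p + B + 2) * qw q Q2 (- B)"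
    by (rule hook_RBlob) (use k p B in simp_all)
  ultimately have "cut_ratio i E a = qw q Q2 (- B - k - 1) / (qn q (k + 1) * qw q Q2 (- B))"
    unfolding cut_ratio_def using E * by simp
  moreover have "qw q Q2 (- B) * qn q k + qw q Q2 (- B - 1) * qn q (- (k + 1)) + qw q Q2 (- B - k - 1) * qn q 1 = 0"
    using qw_Plucker[OF q0(1,3), of "- B" "- B - 1" "- B - k - 1"] by (simp add: algebra_simps)
  then have "qw q Q2 (- B - k - 1) + qn q k * qw q Q2 (- B) = qw q Q2 (- B - 1) * qn q (k + 1)"
    using qd unfolding qn_minus by (simp add: algebra_simps)
  ultimately show ?thesis unfolding tel_eq[OF k(1)] using * qw_nz(2)[of "- B"]
    by (simp add: field_simps)
qed

text \<open>Each sibling contributes \<open>tel\<close> just before its left end minus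
  \<open>tel\<close> at its right end, and neighbouring siblings share these positions. The last
  value, at \<open>i - 1\<close>, is \<open>[0] / [1] = 0\<close>.\<close>

lemma tel_sum_undec:
  assumes N: "nc n E" and t: "tiled E x i" "x < i" and u: "undec E x i"
  shows "(\<Sum>a\<in>{a. x < a \<and> a < i \<and> tiled E a i}. cut_ratio i E a) = tel i x"
  using N t u
proof (induction rule: tiled_induct)
  case (empty x)
  then have "{a. x < a \<and> a < i \<and> tiled E a i} = {}" by auto
  then show ?case using tel_cup[OF empty(1)[symmetric]] by (simp only: sum.empty)
next
  case (split x b d)
  have d: "d = Undec" using undecD[OF split(9,3)] split(1,2) by simp
  have "undec E b i" using split(9,1) unfolding undec_def by (meson Suc_lessD less_trans)
  note IH = split(8)[OF this]
  have out: "\<not> tiled E a i" if "x < a" "a < b" for a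
  proof
    assume "tiled E a i"
    from tiledD[OF this split(4)] show False using that split(1,2) by auto
  qed
  have "{a. x < a \<and> a < i \<and> tiled E a i} = insert b {a. b < a \<and> a < i \<and> tiled E a i}"
    using split(1,2,6) out by (auto dest: linorder_neqE_nat)
  moreover have "cut_ratio i E b = tel i x - tel i b"
    by (rule cut_ratio_Undec)
       (use split d tiled_odd[OF N split(6)] tiled_odd[OF N split(5)] in auto)
  ultimately show ?case using IH by simp
qed

end

section \<open>The surroundings of a cup and the classes of its preimages\<close>

definition left_end :: "nat \<Rightarrow> hdiag \<Rightarrow> nat \<Rightarrow> bool" where
  "left_end i E x \<longleftrightarrow> x < i \<and> tiled E x i \<and>
     (x = 0 \<or> (1 \<le> x \<and> E x = Prop) \<or> (\<exists>y d. E x = Arc y d \<and> Suc i < y))"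

definition has_deco :: "deco \<Rightarrow> hdiag \<Rightarrow> nat \<Rightarrow> nat \<Rightarrow> bool" where
  "has_deco e E x y \<longleftrightarrow> (\<exists>v w. x < v \<and> v < y \<and> E v = Arc w e)"

lemma undec_iff: "undec E x y \<longleftrightarrow> \<not> has_deco LBlob E x y \<and> \<not> has_deco RBlob E x y"
proof -
  have "d = Undec \<longleftrightarrow> d \<noteq> LBlob \<and> d \<noteq> RBlob" for d by (cases d) auto
  then show ?thesis unfolding undec_def has_deco_def by blast
qed

lemma left_end_less: "left_end i E x \<Longrightarrow> x < i"
  and left_end_tiled: "left_end i E x \<Longrightarrow> tiled E x i"
  by (simp_all add: left_end_def)

lemma left_end_le:
  assumes le: "left_end i E x" and a: "a < i" "tiled E a i"
  shows "x \<le> a"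
proof (rule ccontr)
  assume "\<not> x \<le> a"
  then have "a < x" by simp
  then obtain w d where "E x = Arc w d" "w < i" using tiledE[OF a(2) _ left_end_less[OF le]] by blast
  then show False using le \<open>a < x\<close> by (auto simp: left_end_def)
qed

lemma left_end_unique:
  assumes le: "left_end i E x" and a: "a < i" "tiled E a i"
    and A: "a = 0 \<or> E a = Prop \<or> (\<exists>y d. E a = Arc y d \<and> Suc i < y)"
  shows "a = x"
proof (rule ccontr)
  assume "a \<noteq> x"
  then have "x < a" using left_end_le[OF le a] by simp
  then obtain w d where "E a = Arc w d" "w < i" using tiledE[OF left_end_tiled[OF le] _ a(1)] by blast
  then show False using A \<open>x < a\<close> by auto
qed

lemma combine_cases:
  "combine q Q1 Q2 d1 d2 = Some (c, d) \<Longrightarrow> d1 = Undec \<and> d = d2 \<or> d2 = Undec \<and> d = d1 \<or> d1 = d2 \<and> d = d1"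
  by (cases d1; cases d2) auto

lemma act_joinD:
  assumes "D i = Arc a d1" "D (Suc i) = Arc b d2" "a \<noteq> Suc i" "act q Q1 Q2 n (GenEi i) D = Some (c, E)"
  obtains d where "combine q Q1 Q2 d1 d2 = Some (c, d)" "E = cup i (D(a := Arc b d, b := Arc a d))"
  using assms by (auto simp: act.simps split: option.splits)

lemma act_shiftD:
  assumes "D i = Arc a d1" "D (Suc i) = Prop" "act q Q1 Q2 n (GenEi i) D = Some (c, E)"
  shows "d1 = Undec" "c = 1" "E = cup i (D(a := Prop))"
  using assms by (auto simp: act.simps split: if_splits)

lemma act_cupD:
  assumes "D i = Arc (Suc i) d" "D (Suc i) = Arc i d" "act q Q1 Q2 n (GenEi i) D = Some (c, E)"
  shows "c = loopval q Q1 Q2 d" "E = cup i D"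
  using assms by (auto simp: act.simps)

lemma coef_nz:
  assumes "coef q Q1 Q2 n \<sigma> i E D \<noteq> 0"
  obtains c where "act q Q1 Q2 n (GenEi i) D = Some (c, E)"
  using assms by (auto simp: coef_def split: option.splits prod.splits if_splits)

lemma coef_eq: "act q Q1 Q2 n (GenEi i) D = Some (c, E) \<Longrightarrow> coef q Q1 Q2 n \<sigma> i E D = c * hk q Q1 Q2 n \<sigma> D"
  by (simp add: coef_def)

lemma act_target_left:
  assumes V: "valid_hd n l D" and D: "D i = Arc a d" "a < i \<or> a = Suc i" and si: "Suc i \<le> n"
    and act: "act q Q1 Q2 n (GenEi i) D = Some (c, E)"
  shows "valid_hd n l E \<and> E i = Arc (Suc i) Undec"
proof -
  note N = valid_nc[OF V]
  show ?thesis
  proof (cases "a = Suc i")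
    case True
    have Ds: "D (Suc i) = Arc i d" using ncD(6)[OF N D(1)] True by simp
    have E: "E = set_deco i (Suc i) Undec D" using act_cupD(2)[OF _ Ds act] D True by (auto simp: set_deco_def cup_def)
    then show ?thesis using valid_set_deco[OF V, of i "Suc i" d Undec] D True by (simp add: set_deco_def)
  next
    case False
    then have ai: "a < i" using D by simp
    show ?thesis
    proof (cases "D (Suc i)")
      case Prop
      note s = act_shiftD[OF D(1) Prop act]
      have Di: "D i = Arc a Undec" using D s by simp
      show ?thesis unfolding s(3)
        using valid_of_shift_prop[OF V Di Prop ai si] nc_of_shift_prop(2)[OF N Di Prop ai si] by blast
    next
      case (Arc b d2)
      obtain d' where d': "combine q Q1 Q2 d d2 = Some (c, d')" "E = cup i (D(a := Arc b d', b := Arc a d'))"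
        using act_joinD[OF D(1) Arc False act] .
      show ?thesis unfolding d'(2)
        using valid_of_join[OF V D(1) Arc ai combine_cases[OF d'(1)]]
          nc_of_join(2)[OF N D(1) Arc ai combine_cases[OF d'(1)]] by blast
    qed
  qed
qed

text \<open>An arc from \<open>i\<close> to the right, past \<open>Suc i\<close>, covers
  \<open>Suc i\<close>, and an arc from \<open>Suc i\<close> to the left, past \<open>i\<close>,
  covers \<open>i\<close>; so the cases not treated from the left have an arc going right from
  \<open>Suc i\<close>.\<close>

lemma right_arcs:
  assumes N: "nc n D" and i: "1 \<le> i" "Suc i \<le> n" and "\<not> (\<exists>a d. D i = Arc a d \<and> (a < i \<or> a = Suc i))"
    and "D i \<noteq> Prop \<or> D (Suc i) \<noteq> Prop"
  obtains b d where "D (Suc i) = Arc b d" "Suc i < b"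
proof (cases "D i")
  case Prop
  then obtain b d where b: "D (Suc i) = Arc b d" using assms(5) by (cases "D (Suc i)") auto
  note b' = ncD[OF N b]
  have "\<not> b < i" using nc_tiled[OF N b'(6)] Prop by (metis hv.distinct(1) less_SucI lessI tiledE)
  moreover have "b \<noteq> i" using b' Prop by auto
  ultimately have "Suc i < b" using b' by linarith
  then show ?thesis using that b by blast
next
  case (Arc a d)
  note a' = ncD[OF N Arc]
  have a: "Suc i < a" using assms(4) Arc a' by (metis Suc_lessI linorder_neqE_nat)
  then obtain b e where b: "D (Suc i) = Arc b e" "i < b" "b < a"
    using tiledE[OF nc_tiled[OF N Arc], of "Suc i"] by (metis Suc_lessD lessI)
  then have "Suc i < b" using ncD(5)[OF N b(1)] by simp
  then show ?thesis using that b by blast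
qed

text \<open>Consequently only coefficients of diagrams \<open>E\<close> with an undecorated cup at
  \<open>i\<close> have to be examined. Arcs leaving to the right are handled by reflection.\<close>

lemma act_target:
  assumes V: "valid_hd n l D" and i: "1 \<le> i" "Suc i \<le> n"
    and act: "act q Q1 Q2 n (GenEi i) D = Some (c, E)"
  shows "valid_hd n l E \<and> E i = Arc (Suc i) Undec"
proof (cases "\<exists>a d. D i = Arc a d \<and> (a < i \<or> a = Suc i)")
  case True
  then show ?thesis using act_target_left[OF V _ _ i(2) act] by blast
next
  case False
  note N = valid_nc[OF V]
  have "D i \<noteq> Prop \<or> D (Suc i) \<noteq> Prop" using act by (auto simp: act.simps)
  then obtain b d where b: "D (Suc i) = Arc b d" "Suc i < b" using right_arcs[OF N i False] by blast
  have m: "mir n D (n - i) = Arc (Suc n - b) (swap d)" using mir_Arc[OF N b(1)] by simp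
  have lt: "Suc n - b < n - i" using b ncD(2,4)[OF N b(1)] by linarith
  have act': "act q Q2 Q1 n (GenEi (n - i)) (mir n D) = Some (c, mir n E)"
    using act_mir[OF N i, of q Q2 Q1] act by simp
  have "Suc (n - i) \<le> n" using i by simp
  from act_target_left[OF valid_mir[OF V] m disjI1[OF lt] this act']
  have *: "valid_hd n l (mir n E)" "mir n E (n - i) = Arc (Suc (n - i)) Undec" by auto
  have N': "nc n (mir n E)" using * by (simp add: valid_hd_iff)
  have E: "mir n (mir n E) = E"
    by (rule mir_inj[OF nc_bounded[OF nc_mir[OF N']] act_bounded[OF N i act] mir_mir[OF N']])
  have "valid_hd n l E" using valid_mir[OF *(1)] E by simp
  moreover have "E (Suc n - (n - i)) = Arc (Suc n - Suc (n - i)) Undec"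
    using mir_Arc[OF N' *(2)] E by simp
  then have "E (Suc i) = Arc i Undec" using i by (simp add: Suc_diff_le)
  ultimately show ?thesis using ncD(6)[of n E "Suc i" i] by (simp add: valid_hd_iff)
qed

text \<open>The classes record what has to be cut in \<open>E\<close> to obtain \<open>D\<close>: a
  sibling on the left or right of the cup (\<open>SibL\<close>, \<open>SibR\<close>), an arc
  enclosing it (\<open>Encl\<close>), a propagating line on the left or right (\<open>PropL\<close>,
  \<open>PropR\<close>), or nothing (\<open>Cup\<close>), when \<open>e_i\<close> closes a
  loop.\<close>

definition SibL :: "nat \<Rightarrow> hdiag \<Rightarrow> bool" where
  "SibL i D \<longleftrightarrow> (\<exists>a b d1 d2. D i = Arc a d1 \<and> D (Suc i) = Arc b d2 \<and> b < a \<and> a < i)"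
definition SibR :: "nat \<Rightarrow> hdiag \<Rightarrow> bool" where
  "SibR i D \<longleftrightarrow> (\<exists>a b d1 d2. D i = Arc a d1 \<and> D (Suc i) = Arc b d2 \<and> Suc i < b \<and> b < a)"
definition Encl :: "nat \<Rightarrow> hdiag \<Rightarrow> bool" where
  "Encl i D \<longleftrightarrow> (\<exists>a b d1 d2. D i = Arc a d1 \<and> D (Suc i) = Arc b d2 \<and> a < i \<and> Suc i < b)"
definition PropL :: "nat \<Rightarrow> hdiag \<Rightarrow> bool" where
  "PropL i D \<longleftrightarrow> (\<exists>a d1. D i = Arc a d1 \<and> D (Suc i) = Prop \<and> a < i)"
definition PropR :: "nat \<Rightarrow> hdiag \<Rightarrow> bool" where
  "PropR i D \<longleftrightarrow> (\<exists>b d2. D i = Prop \<and> D (Suc i) = Arc b d2 \<and> Suc i < b)"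
definition Cup :: "nat \<Rightarrow> hdiag \<Rightarrow> bool" where
  "Cup i D \<longleftrightarrow> (\<exists>d. D i = Arc (Suc i) d)"

text \<open>The six patterns exclude each other. Non-crossing rules out all remaining ones except
  two propagating lines at \<open>i\<close> and \<open>Suc i\<close>, which \<open>e_i\<close>
  annihilates.\<close>

lemma clsum_split:
  assumes i: "1 \<le> i" "Suc i \<le> n"
  shows "clsum q Q1 Q2 n l \<sigma> i E (\<lambda>_. True) = clsum q Q1 Q2 n l \<sigma> i E (Cup i)
    + clsum q Q1 Q2 n l \<sigma> i E (SibL i) + clsum q Q1 Q2 n l \<sigma> i E (SibR i)
    + clsum q Q1 Q2 n l \<sigma> i E (PropL i) + clsum q Q1 Q2 n l \<sigma> i E (PropR i)
    + clsum q Q1 Q2 n l \<sigma> i E (Encl i)"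
proof -
  let ?f = "coef q Q1 Q2 n \<sigma> i E"
  let ?V = "{D. valid_hd n l D}"
  have 1: "clsum q Q1 Q2 n l \<sigma> i E P = (\<Sum>D\<in>?V. if P D then ?f D else 0)" for P
    unfolding clsum_def using sum.inter_filter[OF finite_valid_hd[of n l], of ?f P] by simp
  have pt: "?f D = (if Cup i D then ?f D else 0) + (if SibL i D then ?f D else 0)
      + (if SibR i D then ?f D else 0) + (if PropL i D then ?f D else 0)
      + (if PropR i D then ?f D else 0) + (if Encl i D then ?f D else 0)" if "D \<in> ?V" for D
  proof -
    have N: "nc n D" using that by (simp add: valid_hd_iff)
    show ?thesis
    proof (cases "D i")
      case Prop
      show ?thesis
      proof (cases "D (Suc i)")
        case P: Prop
        then show ?thesis using Prop by (simp add: coef_def act.simps)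
      next
        case (Arc b d)
        obtain b' d' where "D (Suc i) = Arc b' d'" "Suc i < b'"
          by (rule right_arcs[OF N i]) (use Prop Arc in auto)
        then show ?thesis using Prop Arc
          by (simp add: Cup_def SibL_def SibR_def PropL_def PropR_def Encl_def)
      qed
    next
      case A: (Arc a d)
      note a' = ncD[OF N A]
      consider "a = Suc i" | "a < i" | "Suc i < a" using a'(5) by linarith
      then show ?thesis
      proof cases
        case 1
        then have "D (Suc i) = Arc i d" using a' by simp
        then show ?thesis using A 1
          by (simp add: Cup_def SibL_def SibR_def PropL_def PropR_def Encl_def)
      next
        case 2
        show ?thesis
        proof (cases "D (Suc i)")
          case Prop
          then show ?thesis using A 2
            by (simp add: Cup_def SibL_def SibR_def PropL_def PropR_def Encl_def)
        next
          case (Arc b e)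
          note b' = ncD[OF N Arc]
          have "\<not> (a < b \<and> b < i)" using tiledD[OF nc_tiled[OF N a'(6) 2] b'(6)] by auto
          moreover have "b \<noteq> a" "b \<noteq> i" using a' b' A 2 by auto
          ultimately have "b < a \<and> \<not> Suc i < b \<or> Suc i < b \<and> \<not> b < a" using b'(5) 2 by linarith
          then show ?thesis using A 2 Arc
            by (auto simp: Cup_def SibL_def SibR_def PropL_def PropR_def Encl_def)
        qed
      next
        case 3
        obtain b e where b: "D (Suc i) = Arc b e" "i < b" "b < a"
          using tiledE[OF nc_tiled[OF N A], of "Suc i"] 3 by (metis Suc_lessD lessI)
        then have "Suc i < b" using ncD(5)[OF N b(1)] by simp
        then show ?thesis using A 3 b
          by (simp add: Cup_def SibL_def SibR_def PropL_def PropR_def Encl_def)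
      qed
    qed
  qed
  have "clsum q Q1 Q2 n l \<sigma> i E (\<lambda>_. True) = (\<Sum>D\<in>?V. ?f D)" by (simp add: clsum_def)
  also have "\<dots> = (\<Sum>D\<in>?V. (if Cup i D then ?f D else 0) + (if SibL i D then ?f D else 0)
      + (if SibR i D then ?f D else 0) + (if PropL i D then ?f D else 0)
      + (if PropR i D then ?f D else 0) + (if Encl i D then ?f D else 0))"
    by (rule sum.cong[OF refl pt])
  finally show ?thesis by (simp only: sum.distrib 1)
qed

lemma undec_mono: "undec E x y \<Longrightarrow> x \<le> x' \<Longrightarrow> y' \<le> y \<Longrightarrow> undec E x' y'"
  unfolding undec_def by (meson less_le_trans le_less_trans)

lemma has_deco_arc:
  assumes N: "nc n E" and t: "tiled E x z" and h: "has_deco e E x z"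
  obtains p r where "E p = Arc r e" "E r = Arc p e" "p < r" "x < p" "r < z"
proof -
  obtain v w where v: "x < v" "v < z" "E v = Arc w e" using h unfolding has_deco_def by blast
  then have w: "x < w" "w < z" using tiledD[OF t v(3)] by auto
  note Ew = ncD(5,6)[OF N v(3)]
  show thesis
  proof (cases "v < w")
    case True
    then show thesis using that v w Ew by blast
  next
    case False
    then have "w < v" using Ew(1) by simp
    then show thesis using that v w Ew by blast
  qed
qed

text \<open>A covered arc is separated from both edges by the arc above it.\<close>

lemma inside_undec:
  assumes N: "nc n E" and xy: "E x = Arc y d" "x < y"
  shows "undec E x y"
proof -
  note Ey = ncD(6)[OF N xy(1)] and t = nc_tiled[OF N xy] and r = ncD(1-4)[OF N xy(1)]
  have "\<not> has_deco LBlob E x y"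
  proof
    assume "has_deco LBlob E x y"
    from has_deco_arc[OF N t this] obtain p r where pr: "E p = Arc r LBlob" "p < r" "x < p" "r < y" by metis
    from tiledD[OF nc_L[OF N pr(1,2)] xy(1)] show False using pr r by auto
  qed
  moreover have "\<not> has_deco RBlob E x y"
  proof
    assume "has_deco RBlob E x y"
    from has_deco_arc[OF N t this] obtain p r where pr: "E p = Arc r RBlob" "p < r" "x < p" "r < y" by metis
    from tiledD[OF nc_R[OF N pr(1,2)] Ey] show False using pr r by auto
  qed
  ultimately show ?thesis by (simp add: undec_iff)
qed

context hook_weights
begin

definition rgap :: "nat \<Rightarrow> int" where
  "rgap i = (int n - int i - 1) div 2"

text \<open>The sum over all left siblings after telescoping. A right blob among them replaces the
  boundary term \<open>tel i x\<close>; a left blob does not.\<close>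

definition region :: "nat \<Rightarrow> hdiag \<Rightarrow> nat \<Rightarrow> 'k" where
  "region i E x = (if has_deco RBlob E x i then qw q Q2 (- rgap i - 1) / qw q Q2 (- rgap i) else tel i x)"

text \<open>A sibling beyond a blobbed one cannot be cut, since the new arc would cover the blob. So
  the sum stops at the blobbed sibling nearest to the cup, if there is one, and the cut of that
  sibling supplies the closing term.\<close>

lemma region_sum:
  assumes V: "valid_hd n l E" and le: "left_end i E x" and i: "i < n"
  shows "(\<Sum>a\<in>{a. x < a \<and> a < i \<and> tiled E a i \<and> undec E a i}. cut_ratio i E a) = region i E x"
proof (cases "undec E x i")
  case True
  then have "{a. x < a \<and> a < i \<and> tiled E a i \<and> undec E a i} = {a. x < a \<and> a < i \<and> tiled E a i}"
    unfolding undec_def by (auto intro: less_trans)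
  then show ?thesis
    using tel_sum_undec[OF _ left_end_tiled[OF le] left_end_less[OF le] True] V True
    by (simp add: valid_hd_iff region_def undec_iff)
next
  case False
  note N = valid_nc[OF V]
  note tx = left_end_tiled[OF le] and xi = left_end_less[OF le]
  define S where "S = {v. x < v \<and> v < i \<and> (\<exists>w e. E v = Arc w e \<and> e \<noteq> Undec)}"
  have S: "finite S" "S \<noteq> {}" using False by (auto simp: S_def undec_def)
  \<comment> \<open>The right end of the blobbed sibling nearest to the cup, which is the last one
    that can be cut.\<close>
  define a where "a = Max S"
  have "a \<in> S" unfolding a_def using Max_in[OF S] .
  then obtain b d where a: "x < a" "a < i" "E a = Arc b d" "d \<noteq> Undec" by (auto simp: S_def)
  have Smax: "v \<le> a" if "v \<in> S" for v unfolding a_def using Max_ge[OF S(1) that] .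
  note Eb = ncD(6)[OF N a(3)]
  have b: "x < b" "b < i" using tiledD[OF tx a(3,1,2)] by auto
  then have "b \<in> S" using Eb a(4) unfolding S_def by blast
  then have ba: "b < a" using Smax[of b] ncD(5)[OF N a(3)] by simp
  have ua: "undec E a i"
    unfolding undec_def
  proof (intro allI impI; elim conjE)
    fix v w e assume v: "a < v" "v < i" "E v = Arc w e"
    then have "v \<notin> S" using Smax[of v] by auto
    moreover have "x < v" using v a by simp
    ultimately show "e = Undec" using v unfolding S_def by blast
  qed
  have tba: "tiled E b a" by (rule nc_tiled[OF N Eb ba])
  \<comment> \<open>Everything to the left of a left-blobbed arc is tiled, so only the edge can
    bound the siblings.\<close>
  have x0: "x = 0" if L: "d = LBlob"
  proof (rule ccontr)
    have t0: "tiled E 0 b" using nc_L[OF N] Eb ba L by blast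
    assume "x \<noteq> 0"
    then obtain w e where "E x = Arc w e" "w < b" using tiledE[OF t0, of x] b by blast
    then show False using le b \<open>x \<noteq> 0\<close> by (auto simp: left_end_def)
  qed
  have ta: "tiled E a i"
  proof (cases d)
    case LBlob
    then have t0: "tiled E x b" using nc_L[OF N] Eb ba x0 by blast
    show ?thesis by (rule tiled_drop[OF N tx t0 Eb b(1) ba])
  next
    case RBlob
    then have t0: "tiled E a (Suc n)" using nc_R[OF N] Eb ba by blast
    show ?thesis by (rule tiled_inter[OF t0 tx]) (use a i in auto)
  qed (use a in simp)
  have A: "{v. x < v \<and> v < i \<and> tiled E v i \<and> undec E v i} = insert a {v. a < v \<and> v < i \<and> tiled E v i}" (is "?L = ?R")
  proof (intro equalityI subsetI)
    fix v assume v: "v \<in> ?L"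
    then have "\<not> v < a" using undecD[of E v i a b d] a by auto
    then show "v \<in> ?R" using v by auto
  next
    fix v assume v: "v \<in> ?R"
    have "undec E v i" if "a < v" using ua that unfolding undec_def by (meson less_trans)
    then show "v \<in> ?L" using v a ta ua by auto
  qed
  have od: "odd (i - a)" "odd (a - b)" using tiled_odd[OF N ta a(2)] tiled_odd[OF N tba ba] by auto
  have sum: "(\<Sum>v\<in>{v. x < v \<and> v < i \<and> tiled E v i \<and> undec E v i}. cut_ratio i E v) = cut_ratio i E a + tel i a"
    unfolding A using tel_sum_undec[OF N ta a(2) ua] by simp
  show ?thesis
  proof (cases d)
    case Undec then show ?thesis using a by simp
  next
    case RBlob
    have "has_deco RBlob E x i" unfolding has_deco_def using a RBlob by blast
    moreover have t0: "tiled E a (Suc n)" using nc_R[OF N] Eb ba RBlob by blast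
    have o3: "odd (Suc n - a)" using tiled_odd[OF N t0] a i by simp
    have "n - i = (Suc n - a) - (i - a) - 1" using a i by simp
    moreover have "even ((Suc n - a) - (i - a))" using o3 od(1) a i by simp
    ultimately have "odd (n - i)" using i a by (simp add: even_diff_nat)
    then obtain k where k: "int n = int i + 2 * k + 1" using odd_diff_int[OF _ i] by blast
    then have "rgap i = k" by (simp add: rgap_def)
    moreover have "cut_ratio i E a + tel i a = qw q Q2 (- k - 1) / qw q Q2 (- k)"
      by (rule cut_ratio_RBlob[OF _ ba a(2) i od o3 k]) (use a RBlob in simp)
    ultimately show ?thesis unfolding sum region_def using \<open>has_deco RBlob E x i\<close> by simp
  next
    case LBlob
    have t0: "tiled E 0 b" using nc_L[OF N] Eb ba LBlob by blast
    \<comment> \<open>A right-blobbed sibling to the left of the left-blobbed one would make the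
      arcs tile all of \<open>1..n\<close>, against \<open>2 * l < n\<close>.\<close>
    have "\<not> has_deco RBlob E x i"
    proof
      assume "has_deco RBlob E x i"
      from has_deco_arc[OF N tx this] obtain p r where
        pr: "E p = Arc r RBlob" "E r = Arc p RBlob" "p < r" "x < p" "r < i" by metis
      then have "r \<in> S" unfolding S_def by auto
      then have "r \<le> a" using Smax by blast
      moreover have "r \<noteq> a" using pr a LBlob by auto
      ultimately have ra: "r < a" by simp
      have tr: "tiled E r (Suc n)" using nc_R[OF N pr(1,3)] .
      have "r < b" using tiledD[OF tr a(3) ra] a i by simp
      have trb: "tiled E r b" by (rule tiled_inter[OF tr t0]) (use b i in auto)
      have "tiled E 0 (Suc n)"
        by (rule tiled_bridge[OF pr(1,2,3) tiled_take[OF N t0 trb pr(1) \<open>r < b\<close> pr(3)] nc_tiled[OF N pr(1,3)] tr])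
          (use pr i in auto)
      then show False using tiled_length[OF V, of 0 "Suc n"] nl by simp
    qed
    moreover have "odd b" using tiled_odd[OF N t0] ba b by simp
    then have "cut_ratio i E a = tel i 0 - tel i a"
      using cut_ratio_LBlob[OF _ ba a(2) od] a LBlob by simp
    ultimately show ?thesis unfolding sum region_def using x0[OF LBlob] by simp
  qed
qed

lemma clsum_SibL:
  assumes V: "valid_hd n l E" and cup: "E i = Arc (Suc i) Undec" and le: "left_end i E x"
  shows "clsum' i E (SibL i) = H E * region i E x"
proof -
  note N = valid_nc[OF V]
  note Es = ncD(6)[OF N cup]
  have i: "i < n" "1 \<le> i" using ncD[OF N cup] by auto
  note tx = left_end_tiled[OF le] and xi = left_end_less[OF le]
  define A where "A = {a. x < a \<and> a < i \<and> tiled E a i \<and> undec E a i}"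
  define J where "J a = (case E a of Prop \<Rightarrow> E | Arc b d \<Rightarrow> join i a b Undec d E)" for a
  have A: "\<exists>b d. E a = Arc b d \<and> b < a" if "a \<in> A" for a
  proof -
    have a: "x < a" "a < i" "tiled E a i" using that by (auto simp: A_def)
    obtain b d where b: "E a = Arc b d" "x < b" "b < i" using tiledE[OF tx a(1,2)] by blast
    have "\<not> a < b" using tiledD[OF a(3) ncD(6)[OF N b(1)]] b by auto
    then show ?thesis using b ncD(5)[OF N b(1)] by auto
  qed
  have J: "J a = join i a b Undec d E" "J a i = Arc a Undec" "J a (Suc i) = Arc b d"
    if "E a = Arc b d" "b < a" "a < i" for a b d
    using that by (auto simp: J_def join_def)
  have Ji: "J a i = Arc a Undec" if aA: "a \<in> A" for a
  proof -
    obtain b d where "E a = Arc b d" "b < a" using A[OF aA] by blast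
    then show ?thesis using J(2) aA unfolding A_def by blast
  qed
  have "clsum' i E (SibL i) = (\<Sum>a\<in>A. H E * cut_ratio i E a)"
  proof (rule clsum_image[where J = J])
    show "inj_on J A"
    proof (rule inj_onI)
      fix a a' assume a: "a \<in> A" "a' \<in> A" and eq: "J a = J a'"
      show "a = a'" using Ji[OF a(1)] Ji[OF a(2)] unfolding eq by simp
    qed
  next
    fix a assume "a \<in> A"
    then obtain b d where b: "E a = Arc b d" "b < a" using A by blast
    have a: "x < a" "a < i" "tiled E a i" "undec E a i" using \<open>a \<in> A\<close> by (auto simp: A_def)
    note j = J[OF b a(2)]
    note Eb = ncD(6)[OF N b(1)]
    have v: "valid_hd n l (join i a b Undec d E)" by (rule valid_join[OF V cup b(1) a(2-4)]) (use b in simp)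
    then have nj: "nc n (join i a b Undec d E)" by (simp add: valid_hd_iff)
    have "act q Q1 Q2 n (GenEi i) (join i a b Undec d E) = Some (1, E)"
      by (rule act_join[OF cup Es b(1) Eb]) (use a b in auto)
    from coef_eq[OF this] have "coef' i E (J a) = H E * cut_ratio i E a"
      unfolding j(1) using H_join_inner[OF N nj cup b(1,2) a(2)] b by (simp add: cut_ratio_def)
    moreover have "SibL i (J a)" unfolding SibL_def using j b a by blast
    ultimately show "valid_hd n l (J a) \<and> SibL i (J a) \<and> coef' i E (J a) = H E * cut_ratio i E a"
      using v j by simp
  next
    fix D assume D: "valid_hd n l D" "SibL i D" "coef' i E D \<noteq> 0"
    obtain a b d1 d2 where ab: "D i = Arc a d1" "D (Suc i) = Arc b d2" "b < a" "a < i"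
      using D(2) unfolding SibL_def by blast
    obtain c where c: "act q Q1 Q2 n (GenEi i) D = Some (c, E)" using coef_nz[OF D(3)] .
    have ne: "a \<noteq> Suc i" using ab by simp
    obtain d where d: "combine q Q1 Q2 d1 d2 = Some (c, d)" "E = cup i (D(a := Arc b d, b := Arc a d))"
      using act_joinD[OF ab(1,2) ne c] .
    note ND = valid_nc[OF D(1)]
    note f = nc_of_join[OF ND ab(1,2,4) combine_cases[OF d(1)], folded d(2)]
    have "d1 = Undec" "d2 = d" using f(6) ab by auto
    have "x \<le> a" by (rule left_end_le[OF le ab(4) f(4)])
    moreover have "x \<noteq> a"
    proof
      assume "x = a"
      then have "x = 0 \<or> (\<exists>y d. E x = Arc y d \<and> Suc i < y)" using le f(3) by (auto simp: left_end_def)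
      then show False using f(3) ab ncD(1)[OF N f(3)] \<open>x = a\<close> by auto
    qed
    ultimately have "a \<in> A" using ab f(4,5) by (simp add: A_def)
    moreover have "D = J a" using f(7) J(1)[OF f(3) ab(3,4)] \<open>d1 = Undec\<close> \<open>d2 = d\<close> by simp
    ultimately show "D \<in> J ` A" by blast
  qed
  also have "\<dots> = H E * region i E x"
    using region_sum[OF V le i(1)] unfolding A_def sum_distrib_left[symmetric] by simp
  finally show ?thesis .
qed

text \<open>At most one propagating line is visible on the left, namely the one that bounds the
  siblings, and only if no blob lies in between.\<close>

lemma clsum_PropL:
  assumes V: "valid_hd n l E" and cup: "E i = Arc (Suc i) Undec" and le: "left_end i E x"
  shows "clsum' i E (PropL i) = (if 1 \<le> x \<and> E x = Prop \<and> undec E x i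
     then H E * (\<sigma> x / (hook' x i Undec * \<sigma> (Suc i))) else 0)"
proof -
  note N = valid_nc[OF V]
  note Es = ncD(6)[OF N cup]
  have i: "Suc i \<le> n" "1 \<le> i" using ncD[OF N cup] by auto
  note tx = left_end_tiled[OF le] and xi = left_end_less[OF le]
  define A where "A = {a. a = x \<and> 1 \<le> x \<and> E x = Prop \<and> undec E x i}"
  define g where "g a = H E * (\<sigma> a / (hook' a i Undec * \<sigma> (Suc i)))" for a
  have "clsum' i E (PropL i) = (\<Sum>a\<in>A. g a)"
  proof (rule clsum_image[where J = "\<lambda>a. shift_prop i a E"])
    show "inj_on (\<lambda>a. shift_prop i a E) A" by (auto simp: inj_on_def A_def)
  next
    fix a assume "a \<in> A"
    then have a: "a = x" "1 \<le> a" "E a = Prop" "undec E a i" by (auto simp: A_def)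
    then have ai: "a < i" "tiled E a i" using xi tx by auto
    have v: "valid_hd n l (shift_prop i a E)"
      by (rule valid_shift_prop[OF V cup a(3) ai(1) a(2) ai(2) a(4)])
    then have ns: "nc n (shift_prop i a E)" by (simp add: valid_hd_iff)
    have "act q Q1 Q2 n (GenEi i) (shift_prop i a E) = Some (1, E)"
      by (rule act_shift_prop[OF cup Es a(3)]) (use ai in auto)
    from coef_eq[OF this] have "coef' i E (shift_prop i a E) = g a"
      using H_shift_prop[OF N ns cup a(3,2) ai(1)] by (simp add: g_def)
    moreover have "PropL i (shift_prop i a E)"
      using ai by (auto simp: PropL_def shift_prop_def)
    ultimately show "valid_hd n l (shift_prop i a E) \<and> PropL i (shift_prop i a E) \<and> coef' i E (shift_prop i a E) = g a"
      using v by blast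
  next
    fix D assume D: "valid_hd n l D" "PropL i D" "coef' i E D \<noteq> 0"
    obtain a d1 where ab: "D i = Arc a d1" "D (Suc i) = Prop" "a < i"
      using D(2) unfolding PropL_def by blast
    obtain c where c: "act q Q1 Q2 n (GenEi i) D = Some (c, E)" using coef_nz[OF D(3)] .
    note s = act_shiftD[OF ab(1,2) c]
    note ND = valid_nc[OF D(1)]
    have Di: "D i = Arc a Undec" using ab s by simp
    note f = nc_of_shift_prop[OF ND Di ab(2,3) i(1), folded s(3)]
    have "a = x" using left_end_unique[OF le ab(3) f(4)] f(3) by blast
    then show "D \<in> (\<lambda>a. shift_prop i a E) ` A" using f by (auto simp: A_def)
  qed
  also have "\<dots> = (if 1 \<le> x \<and> E x = Prop \<and> undec E x i then g x else 0)"
    by (auto simp: A_def)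
  finally show ?thesis by (simp add: g_def)
qed

lemma clsum_Encl_0:
  assumes V: "valid_hd n l E" and le: "left_end i E x" and x: "x = 0 \<or> E x = Prop"
  shows "clsum' i E (Encl i) = 0"
proof -
  note N = valid_nc[OF V]
  \<comment> \<open>The index set is empty, so \<open>J\<close> is arbitrary: an enclosing arc would
    have to start at \<open>x\<close>, where there is none.\<close>
  have "clsum' i E (Encl i) = (\<Sum>a\<in>{}. a)"
  proof (rule clsum_image[where J = "\<lambda>_. E"])
    fix D assume D: "valid_hd n l D" "Encl i D" "coef' i E D \<noteq> 0"
    obtain a b d1 d2 where ab: "D i = Arc a d1" "D (Suc i) = Arc b d2" "a < i" "Suc i < b"
      using D(2) unfolding Encl_def by blast
    obtain c where c: "act q Q1 Q2 n (GenEi i) D = Some (c, E)" using coef_nz[OF D(3)] .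
    have ne: "a \<noteq> Suc i" using ab by simp
    obtain d where d: "combine q Q1 Q2 d1 d2 = Some (c, d)" "E = cup i (D(a := Arc b d, b := Arc a d))"
      using act_joinD[OF ab(1,2) ne c] .
    note ND = valid_nc[OF D(1)]
    note f = nc_of_join[OF ND ab(1,2,3) combine_cases[OF d(1)], folded d(2)]
    have "a = x" using left_end_unique[OF le ab(3) f(4)] f(3) ab(4) by blast
    then show "D \<in> (\<lambda>_. E) ` {}" using x f(3) ncD(1)[OF N f(3)] by auto
  qed auto
  then show ?thesis by simp
qed

text \<open>Only the innermost enclosing arc, the one starting at \<open>x\<close>, can be cut. Its
  pieces may carry any two decorations that combine to \<open>d\<close>.\<close>

lemma clsum_Encl:
  assumes V: "valid_hd n l E" and cup: "E i = Arc (Suc i) Undec" and le: "left_end i E x"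
    and xy: "E x = Arc y d" "Suc i < y"
  shows "clsum' i E (Encl i) = (\<Sum>(d1, d2)\<in>{(d1, d2). \<exists>c. combine q Q1 Q2 d1 d2 = Some (c, d)}.
     fst (the (combine q Q1 Q2 d1 d2)) * (H E * (hook' x y d / (hook' x i d1 * hook' (Suc i) y d2))))"
proof -
  note N = valid_nc[OF V]
  note Es = ncD(6)[OF N cup] and Ey = ncD(6)[OF N xy(1)]
  note tx = left_end_tiled[OF le] and xi = left_end_less[OF le]
  have "undec E x y" using inside_undec[OF N xy(1)] xi xy(2) by simp
  then have u: "undec E x i" by (rule undec_mono) (use xy(2) in auto)
  let ?A = "{(d1, d2). \<exists>c. combine q Q1 Q2 d1 d2 = Some (c, d)}"
  define g where "g p = (case p of (d1, d2) \<Rightarrow>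
    fst (the (combine q Q1 Q2 d1 d2)) * (H E * (hook' x y d / (hook' x i d1 * hook' (Suc i) y d2))))" for p
  have "clsum' i E (Encl i) = (\<Sum>p\<in>?A. g p)"
  proof (rule clsum_image[where J = "\<lambda>(d1, d2). join i x y d1 d2 E"])
    have "join i x y d1 d2 E i = Arc x d1" "join i x y d1 d2 E (Suc i) = Arc y d2" for d1 d2
      using xi xy by (auto simp: join_def)
    then show "inj_on (\<lambda>(d1, d2). join i x y d1 d2 E) ?A"
      by (intro inj_onI) (auto, (metis hv.inject)+)
  next
    fix p assume p: "p \<in> ?A"
    obtain d1 d2 where p12: "p = (d1, d2)" by (cases p)
    then obtain c where c: "combine q Q1 Q2 d1 d2 = Some (c, d)" using p by auto
    have v: "valid_hd n l (join i x y d1 d2 E)"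
      by (rule valid_join[OF V cup xy(1) xi tx u]) (use xy combine_cases[OF c] in auto)
    then have nj: "nc n (join i x y d1 d2 E)" by (simp add: valid_hd_iff)
    have "act q Q1 Q2 n (GenEi i) (join i x y d1 d2 E) = Some (c, E)"
      by (rule act_join[OF cup Es xy(1) Ey]) (use xi xy c in auto)
    from coef_eq[OF this] have "coef' i E (join i x y d1 d2 E) = g p"
      unfolding p12 g_def using H_join_outer[OF N nj cup xy(1) xi xy(2)] c by simp
    moreover have "Encl i (join i x y d1 d2 E)"
      using xi xy by (auto simp: Encl_def join_def)
    ultimately show "valid_hd n l (case p of (d1, d2) \<Rightarrow> join i x y d1 d2 E) \<and>
         Encl i (case p of (d1, d2) \<Rightarrow> join i x y d1 d2 E) \<and>
         coef' i E (case p of (d1, d2) \<Rightarrow> join i x y d1 d2 E) = g p"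
      using v p12 by simp
  next
    fix D assume D: "valid_hd n l D" "Encl i D" "coef' i E D \<noteq> 0"
    obtain a b d1 d2 where ab: "D i = Arc a d1" "D (Suc i) = Arc b d2" "a < i" "Suc i < b"
      using D(2) unfolding Encl_def by blast
    obtain c where c: "act q Q1 Q2 n (GenEi i) D = Some (c, E)" using coef_nz[OF D(3)] .
    have ne: "a \<noteq> Suc i" using ab by simp
    obtain d' where d: "combine q Q1 Q2 d1 d2 = Some (c, d')" "E = cup i (D(a := Arc b d', b := Arc a d'))"
      using act_joinD[OF ab(1,2) ne c] .
    note ND = valid_nc[OF D(1)]
    note f = nc_of_join[OF ND ab(1,2,3) combine_cases[OF d(1)], folded d(2)]
    have ax: "a = x" using left_end_unique[OF le ab(3) f(4)] f(3) ab(4) by blast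
    then have "b = y" "d' = d" using f(3) xy(1) by auto
    then have "D = (\<lambda>(d1, d2). join i x y d1 d2 E) (d1, d2)" "(d1, d2) \<in> ?A" using f(7) ax d(1) by auto
    then show "D \<in> (\<lambda>(d1, d2). join i x y d1 d2 E) ` ?A" by (rule image_eqI)
  qed
  then show ?thesis by (simp add: g_def case_prod_beta)
qed

lemma clsum_Cup:
  assumes V: "valid_hd n l E" and cup: "E i = Arc (Suc i) Undec"
  shows "clsum' i E (Cup i) = H E * (\<Sum>e\<in>{e. (e = LBlob \<longrightarrow> tiled E 0 i) \<and> (e = RBlob \<longrightarrow> tiled E (Suc i) (Suc n))}.
     loopval q Q1 Q2 e / hook' i (Suc i) e)"
proof -
  note N = valid_nc[OF V]
  note Es = ncD(6)[OF N cup]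
  let ?A = "{e. (e = LBlob \<longrightarrow> tiled E 0 i) \<and> (e = RBlob \<longrightarrow> tiled E (Suc i) (Suc n))}"
  have "clsum' i E (Cup i) = (\<Sum>e\<in>?A. H E * (loopval q Q1 Q2 e / hook' i (Suc i) e))"
  proof (rule clsum_image[where J = "\<lambda>e. set_deco i (Suc i) e E"])
    have "set_deco i (Suc i) e E i = Arc (Suc i) e" for e by (simp add: set_deco_def)
    then show "inj_on (\<lambda>e. set_deco i (Suc i) e E) ?A" by (intro inj_onI) (metis hv.inject)
  next
    fix e assume e: "e \<in> ?A"
    have v: "valid_hd n l (set_deco i (Suc i) e E)" using valid_set_deco[OF V cup, of e] e by simp
    then have ns: "nc n (set_deco i (Suc i) e E)" by (simp add: valid_hd_iff)
    have "coef' i E (set_deco i (Suc i) e E) = H E * (loopval q Q1 Q2 e / hook' i (Suc i) e)"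
      using coef_eq[OF act_set_deco[OF cup Es, of q Q1 Q2 n e], of \<sigma>] H_set_deco[OF N ns cup] by simp
    moreover have "Cup i (set_deco i (Suc i) e E)" by (auto simp: Cup_def set_deco_def)
    ultimately show "valid_hd n l (set_deco i (Suc i) e E) \<and> Cup i (set_deco i (Suc i) e E) \<and>
      coef' i E (set_deco i (Suc i) e E) = H E * (loopval q Q1 Q2 e / hook' i (Suc i) e)"
      using v by blast
  next
    fix D assume D: "valid_hd n l D" "Cup i D" "coef' i E D \<noteq> 0"
    obtain d where d: "D i = Arc (Suc i) d" using D(2) unfolding Cup_def by blast
    obtain c where c: "act q Q1 Q2 n (GenEi i) D = Some (c, E)" using coef_nz[OF D(3)] .
    note ND = valid_nc[OF D(1)]
    have ds: "D (Suc i) = Arc i d" using ncD(6)[OF ND d] .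
    note s = act_cupD[OF d ds c]
    have De: "D = set_deco i (Suc i) d E"
      unfolding s(2) using d ds by (auto simp: set_deco_def cup_def fun_eq_iff)
    then have "d \<in> ?A" using valid_set_deco[OF V cup, of d] D(1) by simp
    then show "D \<in> (\<lambda>e. set_deco i (Suc i) e E) ` ?A" using De by blast
  qed
  then show ?thesis by (simp add: sum_distrib_left)
qed

end

definition right_end :: "nat \<Rightarrow> nat \<Rightarrow> hdiag \<Rightarrow> nat \<Rightarrow> bool" where
  "right_end n i E y \<longleftrightarrow> Suc i < y \<and> y \<le> Suc n \<and> tiled E (Suc i) y \<and>
     (y = Suc n \<or> (y \<le> n \<and> E y = Prop) \<or> (\<exists>x d. E y = Arc x d \<and> x < i))"

lemma left_end_mir:
  assumes N: "nc n E" and i: "1 \<le> i" "Suc i \<le> n" and re: "right_end n i E y"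
  shows "left_end (n - i) (mir n E) (Suc n - y)"
proof -
  have y: "Suc i < y" "y \<le> Suc n" "tiled E (Suc i) y" using re by (auto simp: right_end_def)
  have "tiled (mir n E) (Suc n - y) (n - i)" using tiled_mir[OF N y(3)] y i by simp
  moreover have "Suc n - y < n - i" using y i by simp
  moreover have "Suc n - y = 0 \<or> 1 \<le> Suc n - y \<and> mir n E (Suc n - y) = Prop
     \<or> (\<exists>x d. mir n E (Suc n - y) = Arc x d \<and> Suc (n - i) < x)"
  proof -
    consider "y = Suc n" | "y \<le> n" "E y = Prop" | x d where "E y = Arc x d" "x < i"
      using re by (auto simp: right_end_def)
    then show ?thesis
    proof cases
      case 2
      then show ?thesis using y mir_at[of y n E] by simp
    next
      case 3
      have "Suc (n - i) < Suc n - x" using 3 i by simp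
      then show ?thesis using mir_Arc[OF N 3(1)] by blast
    qed simp
  qed
  ultimately show ?thesis by (simp add: left_end_def)
qed

lemma right_end_mir:
  assumes N: "nc n E" and i: "1 \<le> i" "Suc i \<le> n" and le: "left_end i E x"
  shows "right_end n (n - i) (mir n E) (Suc n - x)"
proof -
  have x: "x < i" "tiled E x i" using le by (auto simp: left_end_def)
  have "tiled (mir n E) (Suc (n - i)) (Suc n - x)" using tiled_mir[OF N x(2)] x i by (simp add: Suc_diff_le)
  moreover have "Suc (n - i) < Suc n - x" using x i by simp
  moreover have "Suc n - x = Suc n \<or> Suc n - x \<le> n \<and> mir n E (Suc n - x) = Prop
     \<or> (\<exists>w d. mir n E (Suc n - x) = Arc w d \<and> w < n - i)"
  proof -
    consider "x = 0" | "1 \<le> x" "E x = Prop" | y d where "E x = Arc y d" "Suc i < y"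
      using le by (auto simp: left_end_def)
    then show ?thesis
    proof cases
      case 2
      then have "Suc n - x \<le> n" by linarith
      then show ?thesis using 2 x i mir_at[of x n E] by simp
    next
      case 3
      have "Suc n - y < n - i" using 3 ncD(4)[OF N 3(1)] by simp
      then show ?thesis using mir_Arc[OF N 3(1)] by blast
    qed simp
  qed
  ultimately show ?thesis by (simp add: right_end_def)
qed

lemma mir_cup_at:
  assumes N: "nc n E" and cup: "E i = Arc (Suc i) Undec" 
  shows "mir n E (n - i) = Arc (Suc (n - i)) Undec"
proof -
  have i: "Suc i \<le> n" "E (Suc i) = Arc i Undec" using ncD[OF N cup] by auto
  then show ?thesis using mir_Arc[OF N i(2)] by (simp add: Suc_diff_le)
qed

lemma right_end_exists:
  assumes N: "nc n E" and cup: "E i = Arc (Suc i) Undec"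
  obtains y where "right_end n i E y"
proof -
  have i: "1 \<le> i" "Suc i \<le> n" using ncD[OF N cup] by auto
  obtain x where "left_end (n - i) (mir n E) x"
    using left_boundary[OF nc_mir[OF N] mir_cup_at[OF N cup]] unfolding left_end_def by metis
  from right_end_mir[OF nc_mir[OF N] _ _ this] have "right_end n (n - (n - i)) (mir n (mir n E)) (Suc n - x)"
    using i by simp
  then show thesis using that i mir_mir[OF N] by simp
qed

lemma mir_classes:
  assumes N: "nc n D" and i: "1 \<le> i" "Suc i \<le> n"
  shows SibR_mir: "SibR i (mir n D) \<longleftrightarrow> SibL (n - i) D"
    and PropR_mir: "PropR i (mir n D) \<longleftrightarrow> PropL (n - i) D"
proof -
  have at: "mir n D i = mhv n (D (Suc (n - i)))" "mir n D (Suc i) = mhv n (D (n - i))"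
    using mir_at[of "Suc (n - i)" n D] mir_at[of "n - i" n D] i by (simp_all add: Suc_diff_le)
  have bd: "a \<le> n" if "D v = Arc a d" for v a d using ncD(4)[OF N that] .
  have 1: "Suc i < Suc n - a \<longleftrightarrow> a < n - i" "b \<le> n \<Longrightarrow> Suc n - a < Suc n - b \<longleftrightarrow> b < a" if "a \<le> n" for a b
    using i that by auto
  show "SibR i (mir n D) \<longleftrightarrow> SibL (n - i) D"
    using bd[of "n - i"] bd[of "Suc (n - i)"] unfolding SibR_def SibL_def at
    by (cases "D (n - i)"; cases "D (Suc (n - i))") (auto simp: 1)
  show "PropR i (mir n D) \<longleftrightarrow> PropL (n - i) D"
    using bd[of "n - i"] unfolding PropR_def PropL_def at
    by (cases "D (n - i)"; cases "D (Suc (n - i))") (auto simp: 1)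
qed

lemma clsum_cong:
  "(\<And>D. valid_hd n l D \<Longrightarrow> P D = P' D) \<Longrightarrow> clsum q Q1 Q2 n l \<sigma> i E P = clsum q Q1 Q2 n l \<sigma> i E P'"
  unfolding clsum_def by (rule sum.cong) auto

lemma has_deco_mir:
  assumes N: "nc n E" and xy: "x \<le> Suc n" "y \<le> Suc n"
  shows "has_deco (swap e) (mir n E) (Suc n - y) (Suc n - x) \<longleftrightarrow> has_deco e E x y"
proof
  assume "has_deco e E x y"
  then obtain v w where v: "x < v" "v < y" "E v = Arc w e" by (auto simp: has_deco_def)
  then have "Suc n - y < Suc n - v" "Suc n - v < Suc n - x" using xy by auto
  then show "has_deco (swap e) (mir n E) (Suc n - y) (Suc n - x)"
    using mir_Arc[OF N v(3)] unfolding has_deco_def by blast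
next
  assume "has_deco (swap e) (mir n E) (Suc n - y) (Suc n - x)"
  then obtain v w where v: "Suc n - y < v" "v < Suc n - x" "mir n E v = Arc w (swap e)" by (auto simp: has_deco_def)
  note m = mir_ArcD[OF N v(3)]
  have "x < Suc n - v" "Suc n - v < y" using v m by auto
  then show "has_deco e E x y" using m(1) unfolding has_deco_def by auto
qed

context hook_weights
begin

text \<open>The reflection of \<open>clsum_SibL\<close>, with left and right blobs trading places;
  \<open>A\<close> is the value of \<open>rgap\<close> in the reflected diagram.\<close>

lemma clsum_SibR:
  assumes V: "valid_hd n l E" and cup: "E i = Arc (Suc i) Undec" and re: "right_end n i E y"
    and T: "int y = int i + 2 * T + 2" and A: "int i = 2 * A + 1 \<or> \<not> has_deco LBlob E (Suc i) y"
  shows "clsum' i E (SibR i) = H E * (if has_deco LBlob E (Suc i) y then qw q Q1 (- A - 1) / qw q Q1 (- A)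
     else qn q T / qn q (T + 1))"
proof -
  interpret M: hook_weights q Q2 Q1 n l "\<lambda>a. \<sigma> (Suc n - a)" by (rule mirror)
  note N = valid_nc[OF V]
  have i: "1 \<le> i" "Suc i \<le> n" using ncD[OF N cup] by auto
  have y: "Suc i < y" "y \<le> Suc n" using re by (auto simp: right_end_def)
  have "clsum' i E (SibR i) = clsum q Q2 Q1 n l (\<lambda>a. \<sigma> (Suc n - a)) (n - i) (mir n E) (\<lambda>D. SibR i (mir n D))"
    by (rule clsum_mir[OF i N, symmetric])
  also have "\<dots> = clsum q Q2 Q1 n l (\<lambda>a. \<sigma> (Suc n - a)) (n - i) (mir n E) (SibL (n - i))"
    by (rule clsum_cong, rule SibR_mir[OF _ i]) (simp add: valid_hd_iff)
  also have "\<dots> = H E * M.region (n - i) (mir n E) (Suc n - y)"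
    using M.clsum_SibL[OF valid_mir[OF V] mir_cup_at[OF N cup] left_end_mir[OF N i re]]
      hk_mir[OF N, of q Q2 Q1 \<sigma>] by simp
  also have "M.region (n - i) (mir n E) (Suc n - y) = (if has_deco LBlob E (Suc i) y then qw q Q1 (- A - 1) / qw q Q1 (- A)
     else qn q T / qn q (T + 1))"
  proof -
    have "has_deco RBlob (mir n E) (Suc n - y) (n - i) \<longleftrightarrow> has_deco LBlob E (Suc i) y"
      using has_deco_mir[OF N _ y(2), of "Suc i" LBlob] i by simp
    moreover have "M.tel (n - i) (Suc n - y) = qn q T / qn q (T + 1)"
      by (rule M.tel_eq) (use T y i in linarith)
    moreover have "M.rgap (n - i) = A" if "has_deco LBlob E (Suc i) y"
    proof -
      have "int n - int (n - i) - 1 = 2 * A" using A that i by linarith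
      then show ?thesis by (simp add: M.rgap_def)
    qed
    ultimately show ?thesis by (simp add: M.region_def)
  qed
  finally show ?thesis .
qed

lemma clsum_PropR:
  assumes V: "valid_hd n l E" and cup: "E i = Arc (Suc i) Undec" and re: "right_end n i E y"
    and T: "int y = int i + 2 * T + 2"
  shows "clsum' i E (PropR i) = (if y \<le> n \<and> E y = Prop \<and> undec E (Suc i) y
     then H E * (\<sigma> y / (qn q (T + 1) * \<sigma> i)) else 0)"
proof -
  interpret M: hook_weights q Q2 Q1 n l "\<lambda>a. \<sigma> (Suc n - a)" by (rule mirror)
  note N = valid_nc[OF V]
  have i: "1 \<le> i" "Suc i \<le> n" using ncD[OF N cup] by auto
  have y: "Suc i < y" "y \<le> Suc n" using re by (auto simp: right_end_def)
  have "clsum' i E (PropR i) = clsum q Q2 Q1 n l (\<lambda>a. \<sigma> (Suc n - a)) (n - i) (mir n E) (\<lambda>D. PropR i (mir n D))"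
    by (rule clsum_mir[OF i N, symmetric])
  also have "\<dots> = clsum q Q2 Q1 n l (\<lambda>a. \<sigma> (Suc n - a)) (n - i) (mir n E) (PropL (n - i))"
    by (rule clsum_cong, rule PropR_mir[OF _ i]) (simp add: valid_hd_iff)
  also have "\<dots> = (if 1 \<le> Suc n - y \<and> mir n E (Suc n - y) = Prop \<and> undec (mir n E) (Suc n - y) (n - i)
     then H E * (\<sigma> (Suc n - (Suc n - y)) / (hook q Q2 Q1 n (Suc n - y) (n - i) Undec * \<sigma> (Suc n - Suc (n - i)))) else 0)"
    using M.clsum_PropL[OF valid_mir[OF V] mir_cup_at[OF N cup] left_end_mir[OF N i re]]
      hk_mir[OF N, of q Q2 Q1 \<sigma>] by simp
  also have "undec (mir n E) (Suc n - y) (n - i) \<longleftrightarrow> undec E (Suc i) y"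
    using has_deco_mir[OF N _ y(2), of "Suc i" LBlob] has_deco_mir[OF N _ y(2), of "Suc i" RBlob] i
    by (auto simp: undec_iff)
  also have "1 \<le> Suc n - y \<and> mir n E (Suc n - y) = Prop \<and> undec E (Suc i) y \<longleftrightarrow> y \<le> n \<and> E y = Prop \<and> undec E (Suc i) y"
  proof (cases "y \<le> n")
    case True
    then have "1 \<le> Suc n - y" by linarith
    then show ?thesis using True mir_at[of y n E] y by simp
  qed simp
  also have "Suc n - (Suc n - y) = y" using y by simp
  also have "Suc n - Suc (n - i) = i" using i by simp
  also have "hook q Q2 Q1 n (Suc n - y) (n - i) Undec = qn q (T + 1)"
  proof (rule M.hook_Undec)
    have "int (n - i) = int n - int i" "int (Suc n - y) = int n + 1 - int y" using y i by auto
    then show "int (n - i) = int (Suc n - y) + 2 * (T + 1) - 1" using T by simp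
  qed
  finally show ?thesis .
qed

section \<open>Rational identities for the sum of the class contributions\<close>

lemma qn_2: "qn q (t + 2) + qn q t = qn q 2 * qn q (t + 1)"
proof -
  have "qn q 1 * qn q (- 1 - (t + 1)) + qn q (- 1) * qn q (t + 1 - 1) + qn q (t + 1) * qn q (1 - (- 1)) = 0"
    by (rule qn_Plucker[OF q0(1)])
  moreover have "qn q (- 1 - (t + 1)) = - qn q (t + 2)" using qn_minus[of q "t + 2"] by (simp add: algebra_simps)
  ultimately show ?thesis using qd unfolding qn_minus by (simp add: algebra_simps)
qed

lemma qn_add: "qn q (s + t + 2) = qn q (s + 1) * qn q (t + 2) - qn q s * qn q (t + 1)"
proof -
  have "qn q 1 * qn q (s + 1 - (- (t + 1))) + qn q (s + 1) * qn q (- (t + 1) - 1) + qn q (- (t + 1)) * qn q (1 - (s + 1)) = 0"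
    by (rule qn_Plucker[OF q0(1)])
  moreover have "qn q (- (t + 1) - 1) = - qn q (t + 2)" "qn q (1 - (s + 1)) = - qn q s"
    using qn_minus[of q "t + 2"] qn_minus[of q s] by (simp_all add: algebra_simps)
  moreover have "s + 1 - (- (t + 1)) = s + t + 2" by simp
  ultimately show ?thesis using qd unfolding qn_minus by (simp add: algebra_simps)
qed

text \<open>The left side collects the undecorated loop and the telescoped siblings on both sides,
  with \<open>2 * S\<close> and \<open>2 * T\<close> vertices in the gaps. The result has to be
  balanced by whatever bounds the gaps.\<close>

lemma gap_sum:
  assumes "0 \<le> S" "0 \<le> T"
  shows "- qn q 2 + qn q S / qn q (S + 1) + qn q T / qn q (T + 1) = - qn q (S + T + 2) / (qn q (S + 1) * qn q (T + 1))"
proof -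
  have nz: "qn q (S + 1) \<noteq> 0" "qn q (T + 1) \<noteq> 0" using assms by (auto intro!: qn_nz)
  have "qn q 2 = (qn q (T + 2) + qn q T) / qn q (T + 1)" using qn_2[of T] nz by simp
  then show ?thesis using nz unfolding qn_add by (simp add: field_simps)
qed

text \<open>The terms in brackets come from the three ways to distribute a left blob over the pieces
  of the enclosing arc: on the left piece, on the right piece, on both. There are
  \<open>2 * A\<close> vertices before that arc, and \<open>i = 2 * X\<close>.\<close>

lemma encl_LBlob_sum:
  assumes "0 \<le> S" "0 \<le> T" "0 \<le> A" and X: "X = A + S + 1"
  shows "- qn q 2 + qn q S / qn q (S + 1) + qn q T / qn q (T + 1)
    + (qn q (X + T + 1) / (qn q X * qn q (T + 1)) + qw q Q1 (- A) / (qn q (S + 1) * qw q Q1 (- X))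
       - qw q Q1 0 / (qn q X * qw q Q1 (- X))) = 0"
proof -
  have nz: "qn q (S + 1) \<noteq> 0" "qn q (T + 1) \<noteq> 0" "qn q X \<noteq> 0" "qw q Q1 (- X) \<noteq> 0"
    using assms by (auto intro!: qn_nz qw_nz)
  have "qw q Q1 (- A) * qn q (0 - (- X)) + qw q Q1 0 * qn q (- X - (- A)) + qw q Q1 (- X) * qn q (- A - 0) = 0"
    by (rule qw_Plucker[OF q0(1,2)])
  moreover have "qn q (- X - (- A)) = - qn q (S + 1)" using qn_minus[of q "S + 1"] X by (simp add: algebra_simps)
  ultimately have 1: "qw q Q1 (- A) * qn q X - qw q Q1 0 * qn q (S + 1) = qn q A * qw q Q1 (- X)"
    using qn_minus[of q A] by (simp add: algebra_simps)
  have "qn q 1 * qn q (X - (S + 1)) + qn q X * qn q (S + 1 - 1) + qn q (S + 1) * qn q (1 - X) = 0"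
    by (rule qn_Plucker[OF q0(1)])
  moreover have "X - (S + 1) = A" using X by simp
  ultimately have 2: "qn q A = qn q (X - 1) * qn q (S + 1) - qn q X * qn q S"
    using qn_minus[of q "X - 1"] qd by (simp add: algebra_simps)
  have 3: "qn q (X + T + 1) = qn q X * qn q (T + 2) - qn q (X - 1) * qn q (T + 1)"
    using qn_add[of "X - 1" T] by (simp add: algebra_simps)
  have "qw q Q1 (- A) / (qn q (S + 1) * qw q Q1 (- X)) - qw q Q1 0 / (qn q X * qw q Q1 (- X))
     = (qw q Q1 (- A) * qn q X - qw q Q1 0 * qn q (S + 1)) / (qn q (S + 1) * qn q X * qw q Q1 (- X))"
    using nz by (simp add: field_simps)
  also have "\<dots> = qn q A / (qn q (S + 1) * qn q X)" unfolding 1 using nz by simp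
  also have "\<dots> = qn q (X - 1) / qn q X - qn q S / qn q (S + 1)" unfolding 2 using nz by (simp add: field_simps)
  finally have 4: "qw q Q1 (- A) / (qn q (S + 1) * qw q Q1 (- X)) - qw q Q1 0 / (qn q X * qw q Q1 (- X))
     = qn q (X - 1) / qn q X - qn q S / qn q (S + 1)" .
  have 5: "qn q (X + T + 1) / (qn q X * qn q (T + 1)) = qn q (T + 2) / qn q (T + 1) - qn q (X - 1) / qn q X"
    unfolding 3 using nz by (simp add: field_simps)
  have 6: "qn q 2 = qn q (T + 2) / qn q (T + 1) + qn q T / qn q (T + 1)"
    using qn_2[of T] nz by (simp add: field_simps)
  have 7: "qw q Q1 (- A) / (qn q (S + 1) * qw q Q1 (- X))
     = qn q (X - 1) / qn q X - qn q S / qn q (S + 1) + qw q Q1 0 / (qn q X * qw q Q1 (- X))"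
    using 4 by (simp add: diff_eq_eq)
  show ?thesis unfolding 5 6 7 by simp
qed

text \<open>The undecorated loop, the left siblings up to the edge, and the loop with a left blob.
  The result is the negative of what the right siblings give when a left blob occurs among them, so
  these cancel exactly.\<close>

lemma left_open_sum:
  assumes "0 \<le> A"
  shows "- qn q 2 + qn q A / qn q (A + 1) + qw q Q1 1 / (qn q (A + 1) * qw q Q1 (- A))
     = - qw q Q1 (- A - 1) / qw q Q1 (- A)"
proof -
  have nz: "qn q (A + 1) \<noteq> 0" "qw q Q1 (- A) \<noteq> 0" using assms by (auto intro!: qn_nz qw_nz)
  have "qw q Q1 (- A - 1) * qn q (1 - (- A)) + qw q Q1 1 * qn q (- A - (- A - 1)) + qw q Q1 (- A) * qn q (- A - 1 - 1) = 0"
    by (rule qw_Plucker[OF q0(1,2)])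
  moreover have "qn q (- A - 1 - 1) = - qn q (A + 2)" using qn_minus[of q "A + 2"] by (simp add: algebra_simps)
  ultimately have 1: "qw q Q1 1 = qw q Q1 (- A) * qn q (A + 2) - qw q Q1 (- A - 1) * qn q (A + 1)"
    using qd by (simp add: algebra_simps)
  have 6: "qn q 2 = qn q (A + 2) / qn q (A + 1) + qn q A / qn q (A + 1)"
    using qn_2[of A] nz by (simp add: field_simps)
  show ?thesis unfolding 1 6 using nz by (simp add: field_simps)
qed

lemma left_open_defect:
  assumes "0 \<le> T"
  shows "qn q T / qn q (T + 1) - qw q Q1 (- A - 1) / qw q Q1 (- A)
     = - qw q Q1 (- A - T - 1) / (qw q Q1 (- A) * qn q (T + 1))"
proof -
  have nz: "qn q (T + 1) \<noteq> 0" "qw q Q1 (- A) \<noteq> 0" using assms by (auto intro!: qn_nz qw_nz)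
  have "qw q Q1 (- A) * qn q (- A - 1 - (- A - T - 1)) + qw q Q1 (- A - 1) * qn q (- A - T - 1 - (- A))
     + qw q Q1 (- A - T - 1) * qn q (- A - (- A - 1)) = 0"
    by (rule qw_Plucker[OF q0(1,2)])
  moreover have "qn q (- A - T - 1 - (- A)) = - qn q (T + 1)" using qn_minus[of q "T + 1"] by (simp add: algebra_simps)
  ultimately have e: "qw q Q1 (- A) * qn q T - qw q Q1 (- A - 1) * qn q (T + 1) = - qw q Q1 (- A - T - 1)"
    using qd by (simp add: algebra_simps)
  have "qn q T / qn q (T + 1) - qw q Q1 (- A - 1) / qw q Q1 (- A)
     = (qw q Q1 (- A) * qn q T - qw q Q1 (- A - 1) * qn q (T + 1)) / (qw q Q1 (- A) * qn q (T + 1))"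
    using nz by (simp add: field_simps)
  then show ?thesis unfolding e .
qed

end

text \<open>A propagating line screens everything to its left from the right edge.\<close>

lemma no_RBlob:
  assumes N: "nc n E" and y: "E y = Prop" "y \<le> n" and t: "tiled E x z" "z \<le> y"
  shows "\<not> has_deco RBlob E x z"
proof
  assume "has_deco RBlob E x z"
  from has_deco_arc[OF N t(1) this] obtain p r where pr: "E p = Arc r RBlob" "p < r" "r < z" by metis
  have "r < y" "y < Suc n" using pr t y by auto
  then obtain u e where "E y = Arc u e" using tiledE[OF nc_R[OF N pr(1,2)]] by blast
  then show False using y by simp
qed

lemma no_LBlob:
  assumes N: "nc n E" and x: "E x = Prop" "1 \<le> x" and t: "tiled E z y" "x \<le> z"
  shows "\<not> has_deco LBlob E z y"
proof
  assume "has_deco LBlob E z y"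
  from has_deco_arc[OF N t(1) this] obtain p r where pr: "E p = Arc r LBlob" "p < r" "z < p" by metis
  have "x < p" "0 < x" using pr t x by auto
  then obtain u e where "E x = Arc u e" using tiledE[OF nc_L[OF N pr(1,2)]] by blast
  then show False using x by simp
qed

lemma even_gaps:
  assumes N: "nc n E" and le: "left_end i E x" and re: "right_end n i E y"
  obtains S T :: int where "int i = int x + 2 * S + 1" "0 \<le> S" "int y = int i + 2 * T + 2" "0 \<le> T"
proof -
  have x: "x < i" "tiled E x i" using le by (auto simp: left_end_def)
  have y: "Suc i < y" "tiled E (Suc i) y" using re by (auto simp: right_end_def)
  obtain S where S: "int i = int x + 2 * S + 1" "0 \<le> S" using odd_diff_int[OF tiled_odd[OF N x(2,1)] x(1)] .
  obtain T where T: "int y = int (Suc i) + 2 * T + 1" "0 \<le> T" using odd_diff_int[OF tiled_odd[OF N y(2,1)] y(1)] .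
  then have "int y = int i + 2 * T + 2" by simp
  with that S T(2) show thesis by blast
qed

text \<open>The siblings on both sides and the cup would together use all \<open>n\<close> vertices,
  but only \<open>2 * l\<close> carry arcs.\<close>

lemma not_both_open:
  assumes V: "valid_hd n l E" and nl: "2 * l < n" and cup: "E i = Arc (Suc i) e"
    and t: "tiled E 0 i" "tiled E (Suc i) (Suc n)"
  shows False
proof -
  note N = valid_nc[OF V]
  have "tiled E 0 (Suc n)"
    by (rule tiled_bridge[OF cup ncD(6)[OF N cup] _ t(1) _ t(2)]) (use ncD(1-4)[OF N cup] in auto)
  then show False using tiled_length[OF V, of 0 "Suc n"] nl by simp
qed

lemma combine_Undec: "{(d1, d2). \<exists>c. combine q Q1 Q2 d1 d2 = Some (c, Undec)} = {(Undec, Undec)}"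
proof -
  have "(\<exists>c. combine q Q1 Q2 d1 d2 = Some (c, Undec)) \<longleftrightarrow> d1 = Undec \<and> d2 = Undec" for d1 d2
    by (cases d1; cases d2) auto
  then show ?thesis by auto
qed

lemma combine_LBlob: "{(d1, d2). \<exists>c. combine q Q1 Q2 d1 d2 = Some (c, LBlob)}
   = {(LBlob, Undec), (Undec, LBlob), (LBlob, LBlob)}"
proof -
  have "(\<exists>c. combine q Q1 Q2 d1 d2 = Some (c, LBlob)) \<longleftrightarrow> (d1, d2) \<in> {(LBlob, Undec), (Undec, LBlob), (LBlob, LBlob)}" for d1 d2
    by (cases d1; cases d2) auto
  then show ?thesis by auto
qed

context hook_weights
begin

section \<open>Coefficients over the rational functions, according to what bounds the gaps\<close>

abbreviation total :: "nat \<Rightarrow> hdiag \<Rightarrow> 'k" where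
  "total i E \<equiv> clsum' i E (\<lambda>_. True)"

text \<open>The same arc bounds both gaps, so no propagating line is visible, and cutting this arc
  supplies exactly what is missing. A right-blobbed arc is left to the reflected situation.\<close>

lemma total_encl:
  assumes V: "valid_hd n l E" and cup: "E i = Arc (Suc i) Undec" and le: "left_end i E x"
    and xy: "E x = Arc y d" "Suc i < y" and d: "d \<noteq> RBlob"
  shows "total i E = 0"
proof -
  note N = valid_nc[OF V]
  have i: "1 \<le> i" "Suc i \<le> n" using ncD[OF N cup] by auto
  note Ey = ncD(6)[OF N xy(1)]
  note x' = ncD(1-4)[OF N xy(1)]
  note xi = left_end_less[OF le] and tx = left_end_tiled[OF le]
  have tr: "tiled E (Suc i) y" by (rule tiled_right[OF N cup xy(1) xi tx xy(2)])
  then have re: "right_end n i E y" unfolding right_end_def using xy Ey xi x' by auto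
  obtain S T where ST: "int i = int x + 2 * S + 1" "0 \<le> S" "int y = int i + 2 * T + 2" "0 \<le> T"
    using even_gaps[OF N le re] .
  have u: "undec E x y" using inside_undec[OF N xy(1)] xi xy(2) by simp
  have ul: "undec E x i" by (rule undec_mono[OF u]) (use xy in auto)
  have ur: "undec E (Suc i) y" by (rule undec_mono[OF u]) (use xi in auto)
  have n0: "\<not> tiled E 0 i" using tiledD[of E 0 i, OF _ xy(1)] x' xi xy by auto
  have n1: "\<not> tiled E (Suc i) (Suc n)" using tiledD[of E "Suc i" "Suc n", OF _ Ey] x' xi xy by auto
  have "{e. (e = LBlob \<longrightarrow> tiled E 0 i) \<and> (e = RBlob \<longrightarrow> tiled E (Suc i) (Suc n))} = {Undec}"
    using n0 n1 deco.exhaust by auto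
  then have C: "clsum' i E (Cup i) = H E * (- qn q 2)"
    using clsum_Cup[OF V cup] by (simp add: loopval_def)
  have L: "clsum' i E (SibL i) = H E * (qn q S / qn q (S + 1))"
    using clsum_SibL[OF V cup le] ul tel_eq[OF ST(1)] by (simp add: region_def undec_iff)
  have R: "clsum' i E (SibR i) = H E * (qn q T / qn q (T + 1))"
    using clsum_SibR[OF V cup re ST(3), of 0] ur by (simp add: undec_iff)
  have P: "clsum' i E (PropL i) = 0" "clsum' i E (PropR i) = 0"
    using clsum_PropL[OF V cup le] clsum_PropR[OF V cup re ST(3)] xy Ey by simp_all
  note sp = clsum_split[OF i, of q Q1 Q2 l \<sigma> E]
  have nz: "qn q (S + 1) \<noteq> 0" "qn q (T + 1) \<noteq> 0" using ST by (auto intro!: qn_nz)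
  have hU: "hook' x i Undec = qn q (S + 1)" "hook' (Suc i) y Undec = qn q (T + 1)"
    by (rule hook_Undec; use ST in simp)+
  show ?thesis
  proof (cases d)
    case Undec
    have "hook' x y Undec = qn q (S + T + 2)" by (rule hook_Undec) (use ST in simp)
    then have "clsum' i E (Encl i) = H E * (qn q (S + T + 2) / (qn q (S + 1) * qn q (T + 1)))"
      using clsum_Encl[OF V cup le xy] hU Undec by (simp add: combine_Undec)
    then have "total i E = H E * (- qn q 2 + qn q S / qn q (S + 1) + qn q T / qn q (T + 1)
        + qn q (S + T + 2) / (qn q (S + 1) * qn q (T + 1)))"
      unfolding sp C L R P by (simp add: algebra_simps)
    then show ?thesis unfolding gap_sum[OF ST(2,4)] by simp
  next
    case LBlob
    have t0: "tiled E 0 x" using nc_L[OF N, of x y] xy xi LBlob by simp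
    have "odd (x - 0)" by (rule tiled_odd[OF N t0]) (use x' in simp)
    moreover have "0 < x" using x' by simp
    ultimately obtain A where A: "int x = int 0 + 2 * A + 1" "0 \<le> A" using odd_diff_int[of x 0] by blast
    define X where "X = A + S + 1"
    have h: "hook' x y LBlob = qn q (X + T + 1) * qw q Q1 (- A)" "hook' x i LBlob = qn q X * qw q Q1 (- A)"
       "hook' (Suc i) y LBlob = qn q (X + T + 1) * qw q Q1 (- X)"
      by (rule hook_LBlob; use ST A X_def in simp)+
    have nz': "qn q X \<noteq> 0" "qn q (X + T + 1) \<noteq> 0" "qw q Q1 (- A) \<noteq> 0" "qw q Q1 (- X) \<noteq> 0"
      using ST A X_def by (auto intro!: qn_nz qw_nz)
    have "clsum' i E (Encl i) = H E * (qn q (X + T + 1) / (qn q X * qn q (T + 1))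
       + qw q Q1 (- A) / (qn q (S + 1) * qw q Q1 (- X)) - qw q Q1 0 / (qn q X * qw q Q1 (- X)))"
      using clsum_Encl[OF V cup le xy] LBlob hU h nz nz' by (simp add: combine_LBlob algebra_simps)
    then have "total i E = H E * (- qn q 2 + qn q S / qn q (S + 1) + qn q T / qn q (T + 1)
        + (qn q (X + T + 1) / (qn q X * qn q (T + 1))
       + qw q Q1 (- A) / (qn q (S + 1) * qw q Q1 (- X)) - qw q Q1 0 / (qn q X * qw q Q1 (- X))))"
      unfolding sp C L R P by (simp add: algebra_simps)
    then show ?thesis unfolding encl_LBlob_sum[OF ST(2,4) A(2) X_def] by simp
  qed (use d in simp)
qed

text \<open>The cup is open to the left edge, so its preimages include the left-blobbed cup. A left
  blob among the right siblings hides the line at \<open>y\<close>, and everything cancels;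
  otherwise moving this line to \<open>i\<close> adds a term with the ratio of its signs.\<close>

lemma total_left_open:
  assumes V: "valid_hd n l E" and cup: "E i = Arc (Suc i) Undec" and le: "left_end i E 0"
    and re: "right_end n i E y" and y: "E y = Prop" "y \<le> n"
    and ST: "int i = 2 * S + 1" "0 \<le> S" "int y = int i + 2 * T + 2" "0 \<le> T"
  shows "total i E = (if has_deco LBlob E (Suc i) y then 0
    else H E * ((\<sigma> y / \<sigma> i - qw q Q1 (- S - T - 1) / qw q Q1 (- S)) / qn q (T + 1)))"
proof -
  note N = valid_nc[OF V]
  have i: "1 \<le> i" "Suc i \<le> n" using ncD[OF N cup] by auto
  note tx = left_end_tiled[OF le] 
  have ty: "tiled E (Suc i) y" "Suc i < y" using re by (auto simp: right_end_def)
  have noR: "\<not> has_deco RBlob E 0 i" "\<not> has_deco RBlob E (Suc i) y"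
    using no_RBlob[OF N y tx] no_RBlob[OF N y ty(1)] ty by auto
  have n1: "\<not> tiled E (Suc i) (Suc n)"
    using not_both_open[OF V nl cup tx] by blast
  have "e \<noteq> RBlob \<longleftrightarrow> e = Undec \<or> e = LBlob" for e by (cases e) auto
  then have "{e. (e = LBlob \<longrightarrow> tiled E 0 i) \<and> (e = RBlob \<longrightarrow> tiled E (Suc i) (Suc n))} = {Undec, LBlob}"
    using n1 tx by auto
  moreover have "hook' i (Suc i) LBlob = qn q (S + 1) * qw q Q1 (- S)"
    by (rule hook_LBlob) (use ST in simp_all)
  ultimately have C: "clsum' i E (Cup i) = H E * (- qn q 2 + qw q Q1 1 / (qn q (S + 1) * qw q Q1 (- S)))"
    using clsum_Cup[OF V cup] by (simp add: loopval_def)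
  have L: "clsum' i E (SibL i) = H E * (qn q S / qn q (S + 1))"
    using clsum_SibL[OF V cup le] noR tel_eq[of i 0 S] ST by (simp add: region_def)
  have R: "clsum' i E (SibR i) = H E * (if has_deco LBlob E (Suc i) y then qw q Q1 (- S - 1) / qw q Q1 (- S)
     else qn q T / qn q (T + 1))"
    using clsum_SibR[OF V cup re ST(3), of S] ST by simp
  have PL: "clsum' i E (PropL i) = 0" using clsum_PropL[OF V cup le] by simp
  have PR: "clsum' i E (PropR i) = (if has_deco LBlob E (Suc i) y then 0 else H E * (\<sigma> y / (qn q (T + 1) * \<sigma> i)))"
    using clsum_PropR[OF V cup re ST(3)] y noR by (simp add: undec_iff)
  have EN: "clsum' i E (Encl i) = 0" by (rule clsum_Encl_0[OF V le]) simp
  note sp = clsum_split[OF i, of q Q1 Q2 l \<sigma> E]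
  have o: "- qn q 2 + qw q Q1 1 / (qn q (S + 1) * qw q Q1 (- S)) + qn q S / qn q (S + 1) = - qw q Q1 (- S - 1) / qw q Q1 (- S)"
    using left_open_sum[OF ST(2)] by (simp add: algebra_simps)
  show ?thesis
  proof (cases "has_deco LBlob E (Suc i) y")
    case True
    then have "total i E = H E * ((- qn q 2 + qw q Q1 1 / (qn q (S + 1) * qw q Q1 (- S)) + qn q S / qn q (S + 1)) + qw q Q1 (- S - 1) / qw q Q1 (- S))"
      unfolding sp C L R PL PR EN by (simp add: algebra_simps)
    then show ?thesis unfolding o using True by simp
  next
    case False
    have nz: "qn q (T + 1) \<noteq> 0" "qw q Q1 (- S) \<noteq> 0" "\<sigma> i \<noteq> 0" using ST by (auto intro!: qn_nz qw_nz \<sigma>_nz)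
    have "total i E = H E * ((- qn q 2 + qw q Q1 1 / (qn q (S + 1) * qw q Q1 (- S)) + qn q S / qn q (S + 1)) 
       + qn q T / qn q (T + 1) + \<sigma> y / (qn q (T + 1) * \<sigma> i))"
      unfolding sp C L R PL PR EN using False by (simp add: algebra_simps)
    also have "\<dots> = H E * ((qn q T / qn q (T + 1) - qw q Q1 (- S - 1) / qw q Q1 (- S)) + \<sigma> y / (qn q (T + 1) * \<sigma> i))"
      unfolding o by (simp add: algebra_simps)
    also have "\<dots> = H E * ((\<sigma> y / \<sigma> i - qw q Q1 (- S - T - 1) / qw q Q1 (- S)) / qn q (T + 1))"
      unfolding left_open_defect[OF ST(4)] using nz by (simp add: field_simps)
    finally show ?thesis using False by simp
  qed
qed

text \<open>The sign ratios arise from moving the line at \<open>x\<close> to \<open>Suc i\<close>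
  and the line at \<open>y\<close> to \<open>i\<close>; the remaining term is the one from
  \<open>gap_sum\<close>.\<close>

lemma total_both_Prop:
  assumes V: "valid_hd n l E" and cup: "E i = Arc (Suc i) Undec" and le: "left_end i E x" and x: "E x = Prop" "1 \<le> x"
    and re: "right_end n i E y" and y: "E y = Prop" "y \<le> n"
    and ST: "int i = int x + 2 * S + 1" "0 \<le> S" "int y = int i + 2 * T + 2" "0 \<le> T"
  shows "total i E = H E * ((\<sigma> x / \<sigma> (Suc i) * qn q (T + 1) + \<sigma> y / \<sigma> i * qn q (S + 1) - qn q (S + T + 2))
     / (qn q (S + 1) * qn q (T + 1)))"
proof -
  note N = valid_nc[OF V]
  have i: "1 \<le> i" "Suc i \<le> n" using ncD[OF N cup] by auto
  note tx = left_end_tiled[OF le] and xi = left_end_less[OF le]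
  have ty: "tiled E (Suc i) y" "Suc i < y" using re by (auto simp: right_end_def)
  have u: "undec E x i" "undec E (Suc i) y"
    using no_RBlob[OF N y tx] no_RBlob[OF N y ty(1)] no_LBlob[OF N x tx] no_LBlob[OF N x ty(1)] ty xi
    by (auto simp: undec_iff)
  have n0: "\<not> tiled E 0 i" using x xi tiledE[of E 0 i x] by auto
  have n1: "\<not> tiled E (Suc i) (Suc n)" using y ty tiledE[of E "Suc i" "Suc n" y] by auto
  have "{e. (e = LBlob \<longrightarrow> tiled E 0 i) \<and> (e = RBlob \<longrightarrow> tiled E (Suc i) (Suc n))} = {Undec}"
    using n0 n1 deco.exhaust by auto
  then have C: "clsum' i E (Cup i) = H E * (- qn q 2)"
    using clsum_Cup[OF V cup] by (simp add: loopval_def)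
  have L: "clsum' i E (SibL i) = H E * (qn q S / qn q (S + 1))"
    using clsum_SibL[OF V cup le] u tel_eq[OF ST(1)] by (simp add: region_def undec_iff)
  have R: "clsum' i E (SibR i) = H E * (qn q T / qn q (T + 1))"
    using clsum_SibR[OF V cup re ST(3), of 0] u by (simp add: undec_iff)
  have "hook' x i Undec = qn q (S + 1)" by (rule hook_Undec) (use ST in simp)
  then have PL: "clsum' i E (PropL i) = H E * (\<sigma> x / (qn q (S + 1) * \<sigma> (Suc i)))"
    using clsum_PropL[OF V cup le] u x by simp
  have PR: "clsum' i E (PropR i) = H E * (\<sigma> y / (qn q (T + 1) * \<sigma> i))"
    using clsum_PropR[OF V cup re ST(3)] y u by simp
  have EN: "clsum' i E (Encl i) = 0" by (rule clsum_Encl_0[OF V le]) (use x in simp)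
  note sp = clsum_split[OF i, of q Q1 Q2 l \<sigma> E]
  have nz: "qn q (S + 1) \<noteq> 0" "qn q (T + 1) \<noteq> 0" "\<sigma> i \<noteq> 0" "\<sigma> (Suc i) \<noteq> 0" using ST by (auto intro!: qn_nz \<sigma>_nz)
  have "total i E = H E * ((- qn q 2 + qn q S / qn q (S + 1) + qn q T / qn q (T + 1))
     + \<sigma> x / (qn q (S + 1) * \<sigma> (Suc i)) + \<sigma> y / (qn q (T + 1) * \<sigma> i))"
    unfolding sp C L R PL PR EN by (simp add: algebra_simps)
  also have "\<dots> = H E * ((\<sigma> x / \<sigma> (Suc i) * qn q (T + 1) + \<sigma> y / \<sigma> i * qn q (S + 1) - qn q (S + T + 2))
     / (qn q (S + 1) * qn q (T + 1)))"
    unfolding gap_sum[OF ST(2,4)] using nz by (simp add: field_simps)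
  finally show ?thesis .
qed

lemma total_mir:
  assumes N: "nc n E" and cup: "E i = Arc (Suc i) Undec"
  shows "hook_weights.total q Q2 Q1 n l (\<lambda>a. \<sigma> (Suc n - a)) (n - i) (mir n E) = total i E"
proof -
  have i: "1 \<le> i" "Suc i \<le> n" using ncD[OF N cup] by auto
  show ?thesis using clsum_mir[OF i N, of q Q2 Q1 l \<sigma> "\<lambda>_. True"] by simp
qed

end

section \<open>Specialising at a root of unity\<close>

text \<open>An arc whose hook has size \<open>s\<close> forces a block of \<open>2 s\<close> consecutive vertices carrying arcs.\<close>
definition block_lo :: "nat \<Rightarrow> deco \<Rightarrow> nat" where
  "block_lo a d = (if d = LBlob then 0 else a - 1)"

definition block_hi :: "nat \<Rightarrow> nat \<Rightarrow> deco \<Rightarrow> nat" where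
  "block_hi n b d = (if d = RBlob then Suc n else Suc b)"

lemma arc_block:
  assumes N: "nc n E" and ab: "E a = Arc b d" "a < b"
  shows "tiled E (block_lo a d) (block_hi n b d)"
    and "int (block_hi n b d) = int (block_lo a d) + 2 * hsize n a b d + 1"
proof -
  note r = ncD(1-4)[OF N ab(1)]
  note tab = nc_tiled[OF N ab]
  have lo: "tiled E (block_lo a d) a" "block_lo a d < a"
    using nc_L[OF N] ab r by (auto simp: block_lo_def)
  have hi: "tiled E b (block_hi n b d)" "b < block_hi n b d"
    using nc_R[OF N] ab r by (auto simp: block_hi_def)
  show t: "tiled E (block_lo a d) (block_hi n b d)"
    by (rule tiled_bridge[OF ab(1) ncD(6)[OF N ab(1)] ab(2) lo(1) tab hi(1) lo(2) hi(2)])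
  have "block_lo a d < block_hi n b d" using lo hi ab by simp
  then obtain k where k: "int (block_hi n b d) = int (block_lo a d) + 2 * k + 1" "0 \<le> k"
    using odd_diff_int[OF tiled_odd[OF N t]] by blast
  have "hsize n a b d = k"
  proof (cases d)
    case Undec
    then have "int b - int a + 1 = 2 * k" using k r by (simp add: block_lo_def block_hi_def of_nat_diff)
    then show ?thesis using Undec by (simp add: hsize_def)
  next
    case LBlob
    then have "int b = 2 * k" using k by (simp add: block_lo_def block_hi_def)
    then show ?thesis using LBlob by (simp add: hsize_def)
  next
    case RBlob
    then have "int n - int a + 1 = 2 * k" using k r by (simp add: block_lo_def block_hi_def of_nat_diff)
    then show ?thesis using RBlob by (simp add: hsize_def)
  qed
  then show "int (block_hi n b d) = int (block_lo a d) + 2 * hsize n a b d + 1" using k by simp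
qed

text \<open>The block of an arc is tiled, so \<open>tiled_length\<close> bounds it; in the extreme
  case the block contains every vertex with an arc.\<close>

lemma hsize_bounds:
  assumes V: "valid_hd n l E" and ab: "E a = Arc b d" "a < b"
  shows "1 \<le> hsize n a b d" "hsize n a b d \<le> int l"
    and "hsize n a b d = int l \<Longrightarrow> arcv n E = {block_lo a d<..<block_hi n b d}"
proof -
  note N = valid_nc[OF V]
  note r = ncD(1-4)[OF N ab(1)]
  note B = arc_block[OF N ab]
  have hi: "block_hi n b d \<le> Suc n" using r by (simp add: block_hi_def)
  show "hsize n a b d \<le> int l" using tiled_length[OF V B(1) hi] B(2) by linarith
  show "1 \<le> hsize n a b d" using ab r by (cases d) (auto simp: hsize_def)
  assume "hsize n a b d = int l"
  then have "block_hi n b d - block_lo a d = Suc (2 * l)" using B(2) by linarith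
  then show "arcv n E = {block_lo a d<..<block_hi n b d}" by (rule tiled_full[OF V B(1) hi])
qed

text \<open>All hook sizes then lie strictly between \<open>0\<close> and \<open>l\<close>, so no
  factor of the hook product vanishes at the root of unity.\<close>

definition regular :: "nat \<Rightarrow> nat \<Rightarrow> hdiag \<Rightarrow> bool" where
  "regular n l E \<longleftrightarrow> (\<forall>a b d. E a = Arc b d \<and> a < b \<longrightarrow> hsize n a b d < int l)"

text \<open>Two hooks of size \<open>l\<close> have the same block, and a common end of the block
  determines the arc. The only other combination, a left-blobbed and a right-blobbed arc, would make
  the block all of \<open>1..n\<close>, which has more than \<open>2 * l\<close> vertices.\<close>

lemma full_hook_unique:
  assumes V: "valid_hd n l E" and nl: "2 * l < n" and l: "0 < l"
    and ab: "E a = Arc b d" "a < b" "hsize n a b d = int l"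
    and ab': "E a' = Arc b' d'" "a' < b'" "hsize n a' b' d' = int l"
  shows "a = a'"
proof -
  note N = valid_nc[OF V]
  note r = ncD[OF N ab(1)] and r' = ncD[OF N ab'(1)]
  have eq: "{block_lo a d<..<block_hi n b d} = {block_lo a' d'<..<block_hi n b' d'}"
    using hsize_bounds(3)[OF V ab] hsize_bounds(3)[OF V ab'] by simp
  have h: "block_hi n b d = block_lo a d + 2 * l + 1" "block_hi n b' d' = block_lo a' d' + 2 * l + 1"
    using arc_block(2)[OF N ab(1,2)] arc_block(2)[OF N ab'(1,2)] ab(3) ab'(3) by linarith+
  have "Suc (block_lo a d) \<in> {block_lo a' d'<..<block_hi n b' d'}"
    unfolding eq[symmetric] using h l by simp_all
  moreover have "Suc (block_lo a' d') \<in> {block_lo a d<..<block_hi n b d}"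
    unfolding eq using h l by simp
  ultimately have lo: "block_lo a d = block_lo a' d'" by simp
  then have hi: "block_hi n b d = block_hi n b' d'" using h by simp
  show ?thesis
  proof (cases "d \<noteq> RBlob \<and> d' \<noteq> RBlob")
    case True
    then have "b = b'" using hi by (simp add: block_hi_def)
    then show ?thesis using r(6) r'(6) by simp
  next
    case False
    show ?thesis
    proof (cases "d = LBlob \<or> d' = LBlob")
      case True
      then have "block_lo a d = 0" "block_hi n b d = Suc n" using False lo hi by (auto simp: block_lo_def block_hi_def)
      then show ?thesis using h nl by simp
    next
      case False
      then show ?thesis using lo r(1) r'(1) by (simp add: block_lo_def)
    qed
  qed
qed

text \<open>The block of a hook of size \<open>l\<close> contains the cup and stops before the line
  at \<open>y\<close>. Its arc is not the cup, so it encloses the cup or is left-blobbed with its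
  right end beyond the cup; both contradict what bounds the gaps.\<close>

lemma regular_between_Props:
  assumes V: "valid_hd n l E" and l2: "2 \<le> l" and cup: "E i = Arc (Suc i) Undec" and le: "left_end i E x"
    and re: "right_end n i E y" and y: "E y = Prop" "y \<le> n"
    and x: "x = 0 \<and> \<not> has_deco LBlob E (Suc i) y \<or> 1 \<le> x \<and> E x = Prop"
  shows "regular n l E"
  unfolding regular_def
proof (intro allI impI; elim conjE)
  fix a b d assume ab: "E a = Arc b d" "a < b"
  note N = valid_nc[OF V]
  note r = ncD[OF N ab(1)] and i = ncD[OF N cup]
  note B = hsize_bounds[OF V ab]
  show "hsize n a b d < int l"
  proof (rule ccontr)
    assume "\<not> hsize n a b d < int l"
    then have h: "hsize n a b d = int l" using B by linarith
    note AV = B(3)[OF h]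
    have "i \<in> arcv n E" "Suc i \<in> arcv n E" using cup i by (auto simp: arcv_def)
    then have ib: "block_lo a d < i" "Suc i < block_hi n b d" using AV by auto
    have "y \<notin> arcv n E" using y by (simp add: arcv_def)
    then have yb: "block_hi n b d \<le> y" using AV ib re by (auto simp: right_end_def)
    have ne: "b \<noteq> i" using r ab i cup by auto
    show False
    proof (cases d)
      case RBlob
      then show False using yb y by (simp add: block_hi_def)
    next
      case LBlob
      then have "b \<noteq> Suc i" using r(6) i(6) by auto
      then have b: "Suc i < b" "b < y" using ib yb LBlob ne by (auto simp: block_hi_def)
      then have "has_deco LBlob E (Suc i) y" using r(6) LBlob unfolding has_deco_def by blast
      then have "1 \<le> x" "E x = Prop" using x by auto
      moreover have "x \<in> arcv n E"
        using AV LBlob left_end_less[OF le] ib \<open>1 \<le> x\<close> by (auto simp: block_lo_def)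
      ultimately show False by (simp add: arcv_def)
    next
      case Undec
      \<comment> \<open>The cup has hook size \<open>1\<close>, which differs from \<open>l\<close>
        because \<open>2 \<le> l\<close>.\<close>
      have "a \<noteq> i"
      proof
        assume "a = i"
        then have "b = Suc i" using ab cup by simp
        then have "hsize n a b d = 1" using \<open>a = i\<close> Undec by (simp add: hsize_def)
        then show False using h l2 by simp
      qed
      moreover have "b \<noteq> Suc i" using r(6) i(6) \<open>a \<noteq> i\<close> by auto
      ultimately have enc: "a < i" "Suc i < b" using ib Undec ne by (auto simp: block_lo_def block_hi_def)
      have "a \<noteq> x" using ab x r by auto
      moreover have "\<not> x < a" using tiledD[OF left_end_tiled[OF le] ab(1)] enc by auto
      moreover have "\<not> a < x"
      proof
        assume "a < x"
        then have "E x = Prop" "x < b" using x left_end_less[OF le] enc by auto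
        then show False using tiledE[OF nc_tiled[OF N ab] \<open>a < x\<close>] by auto
      qed
      ultimately show False by simp
    qed
  qed
qed

context place
begin

definition fin :: "'K \<Rightarrow> bool" where "fin z \<longleftrightarrow> (\<exists>u. sp z u)"

lemma finI: "sp z u \<Longrightarrow> fin z" by (auto simp: fin_def)

lemma fin_mult: "fin z \<Longrightarrow> fin w \<Longrightarrow> fin (z * w)"
  unfolding fin_def using sp_mult by blast

lemma fin_prod: "(\<And>a. a \<in> A \<Longrightarrow> fin (f a)) \<Longrightarrow> fin (prod f A)"
  by (induction A rule: infinite_finite_induct) (auto intro: fin_mult finI sp_1)

lemma sp_0_mult: "sp z 0 \<Longrightarrow> fin w \<Longrightarrow> sp (z * w) 0"
  unfolding fin_def using sp_mult by fastforce

end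

text \<open>The values at the place are \<open>p\<close>, \<open>P1\<close>, \<open>P2\<close>. Of
  the signs only the reversal under a shift by \<open>2 * l\<close> is kept, since this survives the
  reflection of positions while the exact pattern of \<open>h3\<close> need not.\<close>

locale hook_place = place sp + hook_weights q Q1 Q2 n l \<sigma>
  for sp :: "'K::field \<Rightarrow> 'k::field \<Rightarrow> bool" and q Q1 Q2 :: 'K and n l :: nat and \<sigma> :: "nat \<Rightarrow> 'K" +
  fixes p P1 P2 :: 'k
  assumes sp_q: "sp q p" and sp_Q1: "sp Q1 P1" and sp_Q2: "sp Q2 P2"
    and p0: "p \<noteq> 0" "P1 \<noteq> 0" "P2 \<noteq> 0" and pd: "p - inverse p \<noteq> 0"
    and pl: "p powi int l = - 1"
    and qn_p: "\<And>m. 0 < m \<Longrightarrow> m < int l \<Longrightarrow> qn p m \<noteq> 0"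
    and qw_p: "\<And>m. qw p P1 m \<noteq> 0" "\<And>m. qw p P2 m \<noteq> 0"
    and l2: "2 \<le> l"
    and \<sigma>_sign: "\<And>a. \<sigma> a = 1 \<or> \<sigma> a = - 1"
    and \<sigma>_shift: "\<And>a. 1 \<le> a \<Longrightarrow> a + 2 * l \<le> n \<Longrightarrow> \<sigma> (a + 2 * l) = - \<sigma> a"
begin

lemma mirror_place: "hook_place sp q Q2 Q1 n l (\<lambda>a. \<sigma> (Suc n - a)) p P2 P1"
proof -
  interpret M: hook_weights q Q2 Q1 n l "\<lambda>a. \<sigma> (Suc n - a)" by (rule mirror)
  have "\<sigma> (Suc n - (a + 2 * l)) = - \<sigma> (Suc n - a)" if "1 \<le> a" "a + 2 * l \<le> n" for a
  proof -
    have "Suc n - (a + 2 * l) + 2 * l = Suc n - a" using that by simp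
    then show ?thesis using \<sigma>_shift[of "Suc n - (a + 2 * l)"] that by simp
  qed
  then show ?thesis
    by unfold_locales (use sp_q sp_Q1 sp_Q2 p0 pd pl qn_p qw_p l2 \<sigma>_sign in auto)
qed

lemma sp_qn': "sp (qn q m) (qn p m)"
  by (rule sp_qn[OF sp_q p0(1) pd])

lemma sp_qw': "sp (qw q Q1 m) (qw p P1 m)" "sp (qw q Q2 m) (qw p P2 m)"
  by (rule sp_qw[OF sp_q sp_Q1 p0(1,2) pd], rule sp_qw[OF sp_q sp_Q2 p0(1,3) pd])

lemma powi_minus_l: "p powi (- int l) = - 1"
  using pl by (simp add: power_int_minus)

lemma qn_p_l: "qn p (int l) = 0"
  using pl powi_minus_l by (simp add: qn_def)

lemma qn_p_shift: "qn p (m + int l) = - qn p m"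
proof -
  have "p powi (m + int l) = - (p powi m)" using pl p0 by (simp add: power_int_add)
  moreover have "p powi (- m - int l) = - (p powi (- m))"
    using powi_minus_l power_int_add[of p "- m" "- int l"] p0 by simp
  ultimately show ?thesis by (simp add: qn_def minus_divide_left)
qed

lemma qw_p_minus_l: "qw p P1 (- int l) = - qw p P1 0"
  using pl powi_minus_l by (simp add: qw_def minus_divide_left)

lemma sp_0_qn_l: "sp (qn q (int l)) 0"
  using sp_qn'[of "int l"] qn_p_l by simp

lemma fin_\<sigma>: "fin (\<sigma> a)" "fin (inverse (\<sigma> a))" "fin (\<sigma> a / \<sigma> b)"
proof -
  show "fin (\<sigma> a)" "fin (inverse (\<sigma> a))" using \<sigma>_sign[of a] sp_1 sp_minus_1 by (auto intro: finI)
  have "\<sigma> a / \<sigma> b = 1 \<or> \<sigma> a / \<sigma> b = - 1" using \<sigma>_sign[of a] \<sigma>_sign[of b] by auto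
  then show "fin (\<sigma> a / \<sigma> b)" using sp_1 sp_minus_1 by (auto intro: finI)
qed

lemma fin_inverse_qn: "0 < m \<Longrightarrow> m < int l \<Longrightarrow> fin (inverse (qn q m))"
  using sp_inverse[OF sp_qn' qn_p] by (rule finI)

lemma fin_inverse_hunit: "fin (inverse (hunit q Q1 Q2 n a b d))"
  using sp_1 sp_inverse[OF sp_qw'(1) qw_p(1)] sp_inverse[OF sp_qw'(2) qw_p(2)]
  by (cases d) (auto simp: hunit_def intro: finI)

lemma fin_inverse_fac:
  assumes V: "valid_hd n l E"
    and s: "\<And>b d. E a = Arc b d \<Longrightarrow> a < b \<Longrightarrow> hsize n a b d < int l"
  shows "fin (inverse (fac' E a))"
proof (cases "E a")
  case Prop
  then show ?thesis by (simp add: fac_def fin_\<sigma>)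
next
  case (Arc b d)
  show ?thesis
  proof (cases "a < b")
    case True
    have "fin (inverse (qn q (hsize n a b d)))"
      using hsize_bounds(1)[OF V Arc True] s[OF Arc True] by (intro fin_inverse_qn) auto
    then show ?thesis using Arc True fin_mult[OF _ fin_inverse_hunit] by (simp add: fac_def hook_def)
  next
    case False
    then show ?thesis using Arc by (simp add: fac_def finI[OF sp_1])
  qed
qed

lemma fin_H_regular:
  assumes V: "valid_hd n l E" and r: "regular n l E"
  shows "fin (H E)"
  unfolding hk_def prod_inversef[symmetric]
  by (rule fin_prod, unfold comp_def, rule fin_inverse_fac[OF V]) (use r in \<open>auto simp: regular_def\<close>)

text \<open>At most one hook has size \<open>l\<close>, so the hook product has at most one
  vanishing factor, and a single \<open>[l]\<close> removes the pole.\<close>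

lemma fin_qn_l_H:
  assumes V: "valid_hd n l E"
  shows "fin (qn q (int l) * H E)"
proof (cases "regular n l E")
  case True
  then show ?thesis using fin_mult[OF finI[OF sp_qn'] fin_H_regular[OF V]] by blast
next
  case False
  note N = valid_nc[OF V]
  have l0: "0 < l" using l2 by simp
  obtain a b d where ab: "E a = Arc b d" "a < b" "\<not> hsize n a b d < int l"
    using False unfolding regular_def by blast
  then have h: "hsize n a b d = int l" using hsize_bounds(2)[OF V ab(1,2)] by simp
  have a: "a \<in> {1..n}" using ncD(1,2)[OF N ab(1)] by simp
  have "fin (\<Prod>v\<in>{1..n} - {a}. inverse (fac' E v))"
  proof (intro fin_prod fin_inverse_fac[OF V])
    fix v b' d' assume v: "v \<in> {1..n} - {a}" and vb: "E v = Arc b' d'" "v < b'"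
    have "hsize n v b' d' \<noteq> int l" using full_hook_unique[OF V nl l0 ab(1,2) h vb] v by blast
    then show "hsize n v b' d' < int l" using hsize_bounds(2)[OF V vb] by simp
  qed
  moreover have "fin (qn q (int l) * inverse (fac' E a))"
  proof -
    have "qn q (int l) \<noteq> 0" by (rule qn_nz) (use l0 in simp)
    then have "qn q (int l) * inverse (fac' E a) = inverse (hunit q Q1 Q2 n a b d)"
      using ab h by (simp add: fac_def hook_def)
    then show ?thesis using fin_inverse_hunit by simp
  qed
  moreover have "qn q (int l) * H E = (qn q (int l) * inverse (fac' E a)) * (\<Prod>v\<in>{1..n} - {a}. inverse (fac' E v))"
    unfolding hk_def using prod.remove[OF _ a, of "fac' E"] prod_inversef[of "fac' E" "{1..n} - {a}"]
    by (simp add: comp_def mult.assoc)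
  ultimately show ?thesis using fin_mult by metis
qed

text \<open>Without a left blob on the right, \<open>E\<close> is regular. If
  \<open>T + 1 < l\<close>, the factor \<open>[l]\<close> survives and gives \<open>0\<close>. If
  \<open>T + 1 = l\<close>, the cup and the right gap use up all arcs, so \<open>S = 0\<close>,
  \<open>i = 1\<close> and \<open>y = 2 * l + 1\<close>; then both the sign ratio and the ratio of
  \<open>Q1\<close> factors take the value \<open>- 1\<close> and cancel.\<close>

lemma total_left_open_sp:
  assumes V: "valid_hd n l E" and cup: "E i = Arc (Suc i) Undec" and le: "left_end i E 0"
    and re: "right_end n i E y" and y: "E y = Prop" "y \<le> n"
  shows "sp (qn q (int l) * total i E) 0"
proof (cases "has_deco LBlob E (Suc i) y")
  case False
  note N = valid_nc[OF V]
  obtain S T where ST: "int i = int 0 + 2 * S + 1" "0 \<le> S" "int y = int i + 2 * T + 2" "0 \<le> T"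
    using even_gaps[OF N le re] .
  have ST1: "int i = 2 * S + 1" using ST by simp
  have ty: "tiled E (Suc i) y" "Suc i < y" using re by (auto simp: right_end_def)
  have "tiled E 0 y"
    by (rule tiled_bridge[OF cup ncD(6)[OF N cup] _ left_end_tiled[OF le] _ ty(1)]) (use left_end_less[OF le] ty in auto)
  then have "y - 0 \<le> Suc (2 * l)" by (rule tiled_length[OF V]) (use y in simp)
  then have STl: "S + T + 1 \<le> int l" using ST by linarith
  have fH: "fin (H E)"
    by (rule fin_H_regular[OF V regular_between_Props[OF V l2 cup le re y]]) (use False in simp)
  define w where "w = \<sigma> y / \<sigma> i - qw q Q1 (- S - T - 1) / qw q Q1 (- S)"
  have t: "total i E = H E * (w / qn q (T + 1))"
    using total_left_open[OF V cup le re y ST1 ST(2-4)] False by (simp add: w_def)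
  have fw: "fin w"
  proof -
    obtain u where "sp (\<sigma> y / \<sigma> i) u" using fin_\<sigma>(3) fin_def by blast
    from sp_diff[OF this sp_divide[OF sp_qw'(1) sp_qw'(1) qw_p(1)]] show ?thesis unfolding w_def by (rule finI)
  qed
  show ?thesis
  proof (cases "T + 1 = int l")
    case True
    then have S: "S = 0" using STl ST by simp
    have "int y = int (1 + 2 * l)" "int i = 1" using True ST S by auto
    then have yi: "y = 1 + 2 * l" "i = 1" by linarith+
    have "\<sigma> y = - \<sigma> i" using \<sigma>_shift[of 1] y yi by simp
    then have s: "\<sigma> y / \<sigma> i = - 1" using \<sigma>_nz by simp
    have "- S - T - 1 = - int l" using True S by simp
    then have w: "w = - 1 - qw q Q1 (- int l) / qw q Q1 0" unfolding w_def s using S by simp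
    have "sp w (- 1 - qw p P1 (- int l) / qw p P1 0)"
      unfolding w by (intro sp_diff sp_divide sp_minus_1 sp_qw' qw_p)
    then have "sp w 0" using qw_p(1)[of 0] by (simp add: qw_p_minus_l)
    moreover have "qn q (int l) \<noteq> 0" by (rule qn_nz) (use l2 in simp)
    then have "qn q (int l) * total i E = w * H E" unfolding t True by simp
    ultimately show ?thesis using sp_0_mult fH by simp
  next
    case False
    then have "fin (inverse (qn q (T + 1)))" using STl ST by (intro fin_inverse_qn) auto
    then have "fin (H E * (w * inverse (qn q (T + 1))))" using fH fw by (intro fin_mult)
    then show ?thesis using sp_0_mult[OF sp_0_qn_l] t by (simp add: divide_inverse)
  qed
next
  case True
  note N = valid_nc[OF V]
  obtain S T where ST: "int i = int 0 + 2 * S + 1" "0 \<le> S" "int y = int i + 2 * T + 2" "0 \<le> T"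
    using even_gaps[OF N le re] .
  have ST1: "int i = 2 * S + 1" using ST by simp
  have "total i E = 0" using total_left_open[OF V cup le re y ST1 ST(2-4)] True by simp
  then show ?thesis by (simp add: sp_0)
qed

text \<open>From \<open>S + T + 1 \<le> l\<close>, a gap with denominator \<open>[l]\<close> forces
  the other gap to be empty. The line then moves by \<open>2 * l\<close> places with sign ratio
  \<open>- 1\<close>, and the numerator takes the value \<open>- [1] - [l + 1] = 0\<close> because
  \<open>[l] = 0\<close> and \<open>[l + 1] = - 1\<close>. Otherwise the factor \<open>[l]\<close>
  survives.\<close>

lemma total_both_Prop_sp:
  assumes V: "valid_hd n l E" and cup: "E i = Arc (Suc i) Undec" and le: "left_end i E x" and x: "E x = Prop" "1 \<le> x"
    and re: "right_end n i E y" and y: "E y = Prop" "y \<le> n"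
  shows "sp (qn q (int l) * total i E) 0"
proof -
  note N = valid_nc[OF V]
  have i: "1 \<le> i" "Suc i \<le> n" using ncD[OF N cup] by auto
  obtain S T where ST: "int i = int x + 2 * S + 1" "0 \<le> S" "int y = int i + 2 * T + 2" "0 \<le> T"
    using even_gaps[OF N le re] .
  have ty: "tiled E (Suc i) y" "Suc i < y" using re by (auto simp: right_end_def)
  have "tiled E x y"
    by (rule tiled_bridge[OF cup ncD(6)[OF N cup] _ left_end_tiled[OF le] _ ty(1)]) (use left_end_less[OF le] ty in auto)
  then have "y - x \<le> Suc (2 * l)" by (rule tiled_length[OF V]) (use y in simp)
  then have STl: "S + T + 1 \<le> int l" using ST by linarith
  have fH: "fin (H E)"
    by (rule fin_H_regular[OF V regular_between_Props[OF V l2 cup le re y]]) (use x in simp)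
  define w where "w = \<sigma> x / \<sigma> (Suc i) * qn q (T + 1) + \<sigma> y / \<sigma> i * qn q (S + 1) - qn q (S + T + 2)"
  have t: "total i E = H E * (w / (qn q (S + 1) * qn q (T + 1)))"
    using total_both_Prop[OF V cup le x re y ST] by (simp add: w_def)
  obtain u v where uv: "sp (\<sigma> x / \<sigma> (Suc i)) u" "sp (\<sigma> y / \<sigma> i) v" using fin_\<sigma>(3) fin_def by meson
  have sw: "sp w (u * qn p (T + 1) + v * qn p (S + 1) - qn p (S + T + 2))"
    unfolding w_def by (intro sp_diff sp_add sp_mult uv sp_qn')
  have nz: "qn q (int l) \<noteq> 0" by (rule qn_nz) (use l2 in simp)
  have q1: "qn p (1 + int l) = - 1" using qn_p_shift[of 1] pd by simp
  consider "S + 1 = int l" "T = 0" | "T + 1 = int l" "S = 0" | "S + 1 < int l" "T + 1 < int l"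
    using STl ST by linarith
  then show ?thesis
  proof cases
    case 1
    have "int (Suc i) = int (x + 2 * l)" using ST 1 by simp
    then have "Suc i = x + 2 * l" by linarith
    then have "\<sigma> (Suc i) = - \<sigma> x" using \<sigma>_shift[OF x(2)] i by simp
    then have "\<sigma> x / \<sigma> (Suc i) = - 1" using \<sigma>_nz by simp
    then have "u = - 1" using uv(1) sp_minus_1 sp_unique by metis
    moreover have "S + T + 2 = 1 + int l" using 1 by simp
    then have "qn p (S + T + 2) = - 1" using q1 by (simp only:)
    ultimately have "u * qn p (T + 1) + v * qn p (S + 1) - qn p (S + T + 2) = 0"
      using 1 qn_p_l pd by simp
    then have "sp w 0" using sw by simp
    moreover have "qn q (int l) * total i E = w * H E" unfolding t using 1 nz qd by simp
    ultimately show ?thesis using sp_0_mult fH by simp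
  next
    case 2
    have "int y = int (i + 2 * l)" using ST 2 by simp
    then have "y = i + 2 * l" by linarith
    then have "\<sigma> y = - \<sigma> i" using \<sigma>_shift[OF i(1)] y by simp
    then have "\<sigma> y / \<sigma> i = - 1" using \<sigma>_nz by simp
    then have "v = - 1" using uv(2) sp_minus_1 sp_unique by metis
    moreover have "S + T + 2 = 1 + int l" using 2 by simp
    then have "qn p (S + T + 2) = - 1" using q1 by (simp only:)
    ultimately have "u * qn p (T + 1) + v * qn p (S + 1) - qn p (S + T + 2) = 0"
      using 2 qn_p_l pd by simp
    then have "sp w 0" using sw by simp
    moreover have "qn q (int l) * total i E = w * H E" unfolding t using 2 nz qd by simp
    ultimately show ?thesis using sp_0_mult fH by simp
  next
    case 3
    have "fin (inverse (qn q (S + 1)))" "fin (inverse (qn q (T + 1)))"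
      using 3 ST by (auto intro!: fin_inverse_qn)
    then have "fin (H E * (w * (inverse (qn q (S + 1)) * inverse (qn q (T + 1)))))"
      using fH sw by (intro fin_mult) (auto intro: finI)
    then show ?thesis using sp_0_mult[OF sp_0_qn_l] t by (simp add: divide_inverse)
  qed
qed

text \<open>The ends of the two gaps decide the case. A right-blobbed enclosing arc and a cup open
  to the right edge are reduced by reflection to their left counterparts.\<close>

lemma total_sp:
  assumes V: "valid_hd n l E" and cup: "E i = Arc (Suc i) Undec"
  shows "sp (qn q (int l) * total i E) 0"
proof -
  interpret M: hook_place sp q Q2 Q1 n l "\<lambda>a. \<sigma> (Suc n - a)" p P2 P1 by (rule mirror_place)
  note N = valid_nc[OF V]
  have i: "1 \<le> i" "Suc i \<le> n" using ncD[OF N cup] by auto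
  note V' = valid_mir[OF V] and cup' = mir_cup_at[OF N cup]
  note tm = total_mir[OF N cup]
  obtain x where le: "left_end i E x"
    using left_boundary[OF N cup] unfolding left_end_def by metis
  obtain y where re: "right_end n i E y" using right_end_exists[OF N cup] .
  have ty: "tiled E (Suc i) y" "Suc i < y" "y \<le> Suc n" using re by (auto simp: right_end_def)
  show ?thesis
  proof (cases "\<exists>y d. E x = Arc y d \<and> Suc i < y")
    case True
    then obtain z d where z: "E x = Arc z d" "Suc i < z" by blast
    show ?thesis
    proof (cases "d = RBlob")
      case False
      then show ?thesis using total_encl[OF V cup le z] by (simp add: sp_0)
    next
      case True
      note Ez = ncD[OF N z(1)]
      note xi = left_end_less[OF le]
      have "right_end n i E z"
        unfolding right_end_def using z xi Ez tiled_right[OF N cup z(1) xi left_end_tiled[OF le] z(2)] by auto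
      note le' = left_end_mir[OF N i this]
      have "mir n E (Suc n - z) = Arc (Suc n - x) LBlob" using mir_Arc[OF N Ez(6)] True by simp
      moreover have "Suc (n - i) < Suc n - x" using xi i by simp
      ultimately have "M.total (n - i) (mir n E) = 0" by (rule M.total_encl[OF V' cup' le']) simp
      then show ?thesis using tm by (simp add: sp_0)
    qed
  next
    case False
    then have x: "x = 0 \<or> 1 \<le> x \<and> E x = Prop" using le by (auto simp: left_end_def)
    \<comment> \<open>An arc over the cup ending at \<open>y\<close> would also have to bound the
      left gap, or else cover the propagating line at \<open>x\<close>.\<close>
    have yArc: "\<not> (\<exists>z d. E y = Arc z d \<and> z < i)"
    proof
      assume "\<exists>z d. E y = Arc z d \<and> z < i"
      then obtain z d where z: "E y = Arc z d" "z < i" by blast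
      note Ez = ncD[OF N z(1)]
      have "z \<noteq> x" using x Ez by auto
      moreover have "\<not> x < z" using tiledD[OF left_end_tiled[OF le] Ez(6)] z ty by auto
      moreover have "\<not> z < x"
      proof
        assume zx: "z < x"
        have "x < y" using left_end_less[OF le] ty by simp
        moreover have "z < y" using zx \<open>x < y\<close> by simp
        ultimately obtain w e where "E x = Arc w e" using tiledE[OF nc_tiled[OF N Ez(6)] zx] by blast
        then show False using x zx by auto
      qed
      ultimately show False by simp
    qed
    then have y: "y = Suc n \<or> y \<le> n \<and> E y = Prop" using re by (auto simp: right_end_def)
    consider "x = 0" "y = Suc n" | "x = 0" "y \<le> n" "E y = Prop" | "1 \<le> x" "E x = Prop" "y = Suc n"
      | "1 \<le> x" "E x = Prop" "y \<le> n" "E y = Prop" using x y by blast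
    then show ?thesis
    proof cases
      case 1
      then show ?thesis using not_both_open[OF V nl cup] left_end_tiled[OF le] ty by blast
    next
      case 2
      then show ?thesis using total_left_open_sp[OF V cup _ re] le by simp
    next
      case 3
      have "left_end (n - i) (mir n E) 0" using left_end_mir[OF N i re] 3 by simp
      moreover note right_end_mir[OF N i le]
      moreover have "mir n E (Suc n - x) = Prop" using 3 mir_at[of x n E] left_end_less[OF le] i by simp
      moreover have "Suc n - x \<le> n" using 3 by linarith
      ultimately have "sp (qn q (int l) * M.total (n - i) (mir n E)) 0"
        by (rule M.total_left_open_sp[OF V' cup'])
      then show ?thesis using tm by simp
    next
      case 4
      then show ?thesis using total_both_Prop_sp[OF V cup le _ _ re] by blast
    qed
  qed
qed

end

section \<open>The end generators and the main theorem\<close>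

definition act_sum :: "'k::field \<Rightarrow> 'k \<Rightarrow> 'k \<Rightarrow> nat \<Rightarrow> nat \<Rightarrow> (nat \<Rightarrow> 'k) \<Rightarrow> gen \<Rightarrow> hdiag \<Rightarrow> 'k" where
  "act_sum q Q1 Q2 n l \<sigma> g E = (\<Sum>D\<in>{D. valid_hd n l D}. case act q Q1 Q2 n g D of None \<Rightarrow> 0
     | Some (c, E') \<Rightarrow> if E' = E then c * hk q Q1 Q2 n \<sigma> D else 0)"

lemma act_sum_GenEi: "act_sum q Q1 Q2 n l \<sigma> (GenEi i) E = clsum q Q1 Q2 n l \<sigma> i E (\<lambda>_. True)"
  by (simp add: act_sum_def clsum_def coef_def)

lemma set_deco_commute: "a \<noteq> b \<Longrightarrow> set_deco a b e D = set_deco b a e D"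
  by (auto simp: set_deco_def)

lemma act_GenE: "act q Q1 Q2 n GenE D = (case D 1 of Prop \<Rightarrow> None
   | Arc b d \<Rightarrow> if d = Undec then Some (1, set_deco 1 b LBlob D) else if d = LBlob then Some (- qw q Q1 0, D) else None)"
  by (auto simp: act.simps set_deco_def split: hv.split deco.split)

lemma act_GenF: "act q Q1 Q2 n GenF D = (case D n of Prop \<Rightarrow> None
   | Arc b d \<Rightarrow> if d = Undec then Some (1, set_deco n b RBlob D) else if d = RBlob then Some (- qw q Q2 0, D) else None)"
  by (auto simp: act.simps set_deco_def split: hv.split deco.split)

lemma valid_set_deco_first:
  assumes V: "valid_hd n l D" and D: "D 1 = Arc b d" and e: "e \<noteq> RBlob"
  shows "valid_hd n l (set_deco 1 b e D)"
proof -
  note N = valid_nc[OF V]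
  have "1 < b" using ncD[OF N D] by simp
  then show ?thesis using valid_set_deco[OF V D, of e] e by simp
qed

lemma valid_set_deco_last:
  assumes V: "valid_hd n l D" and D: "D n = Arc b d" and e: "e \<noteq> LBlob"
  shows "valid_hd n l (set_deco n b e D)"
proof -
  note N = valid_nc[OF V]
  have "b < n" using ncD[OF N D] by simp
  then show ?thesis using valid_set_deco[OF V ncD(6)[OF N D], of e] e set_deco_commute[of n b e D] by simp
qed

context hook_weights
begin

text \<open>A blob generator reaches \<open>E\<close> only from \<open>E\<close> itself, with scalar
  \<open>- w\<close>, and from \<open>E\<close> with the blob at \<open>v\<close> erased, with
  scalar \<open>1\<close>. Erasing the blob multiplies the inverse hook product by \<open>w\<close>,
  so the two contributions cancel, even before specialisation.\<close>

lemma act_sum_end: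
  assumes act: "\<And>D. act q Q1 Q2 n g D = (case D v of Prop \<Rightarrow> None
     | Arc b d \<Rightarrow> if d = Undec then Some (1, set_deco v b e D) else if d = e then Some (- w, D) else None)"
    and e: "e \<noteq> Undec"
    and valid: "\<And>D b d e'. valid_hd n l D \<Longrightarrow> D v = Arc b d \<Longrightarrow> e' \<in> {Undec, e} \<Longrightarrow> valid_hd n l (set_deco v b e' D)"
    and H: "\<And>D b. valid_hd n l D \<Longrightarrow> D v = Arc b e \<Longrightarrow> H (set_deco v b Undec D) = w * H D"
  shows "act_sum q Q1 Q2 n l \<sigma> g E = 0"
proof -
  define f where "f D = (case act q Q1 Q2 n g D of None \<Rightarrow> 0
     | Some (c, E') \<Rightarrow> if E' = E then c * H D else 0)" for D
  have set: "D = E \<and> D v = Arc b e \<or> E v = Arc b e \<and> valid_hd n l E \<and> D = set_deco v b Undec E"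
    if V: "valid_hd n l D" and nz: "f D \<noteq> 0" and b: "D v = Arc b d" for D b d
  proof (cases "d = Undec")
    case True
    note N = valid_nc[OF V]
    have E: "E = set_deco v b e D" using nz b True by (auto simp: f_def act split: if_splits)
    have vb: "v \<noteq> b" using ncD(5)[OF N b] by simp
    have "D = set_deco v b Undec E"
      unfolding E using ncD(6)[OF N b] b True vb by (auto simp: set_deco_def fun_eq_iff)
    moreover have "E v = Arc b e" unfolding E using vb by (simp add: set_deco_def)
    moreover have "valid_hd n l E" unfolding E by (rule valid[OF V b]) simp
    ultimately show ?thesis by blast
  next
    case False
    then show ?thesis using nz b by (auto simp: f_def act split: if_splits)
  qed
  have "(\<Sum>D\<in>{D. valid_hd n l D}. f D) = 0"
  proof (cases "valid_hd n l E \<and> (\<exists>b. E v = Arc b e)")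
    case True
    then obtain b where b: "E v = Arc b e" and V: "valid_hd n l E" by blast
    note N = valid_nc[OF V]
    have vb: "v \<noteq> b" using ncD(5)[OF N b] by simp
    define E0 where "E0 = set_deco v b Undec E"
    have E0: "E0 v = Arc b Undec" using vb by (simp add: E0_def set_deco_def)
    have restore: "set_deco v b e E0 = E"
      unfolding E0_def using ncD(6)[OF N b] b by (auto simp: set_deco_def fun_eq_iff)
    have ne: "E0 \<noteq> E" using E0 b e by auto
    have sub: "{E, E0} \<subseteq> {D. valid_hd n l D}"
      using V valid[OF V b, of Undec] by (simp add: E0_def)
    have "f D = 0" if D: "D \<in> {D. valid_hd n l D} - {E, E0}" for D
    proof (rule ccontr)
      assume nz: "f D \<noteq> 0"
      then obtain b' d where D': "D v = Arc b' d" by (cases "D v") (auto simp: f_def act)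
      from set[OF _ nz D'] D have "E v = Arc b' e" "D = set_deco v b' Undec E" by auto
      then show False using D b by (simp add: E0_def)
    qed
    then have "(\<Sum>D\<in>{D. valid_hd n l D}. f D) = (\<Sum>D\<in>{E, E0}. f D)"
      by (intro sum.mono_neutral_right finite_valid_hd sub) blast
    also have "\<dots> = f E + f E0" using ne by simp
    also have "f E = - w * H E" using b e by (simp add: f_def act)
    also have "f E0 = H E0" using E0 restore by (simp add: f_def act)
    also have "H E0 = w * H E" unfolding E0_def by (rule H[OF V b])
    finally show ?thesis by simp
  next
    case False
    show ?thesis
    proof (rule sum.neutral, rule ballI, rule ccontr)
      fix D assume D: "D \<in> {D. valid_hd n l D}" and nz: "f D \<noteq> 0"
      then obtain b' d where D': "D v = Arc b' d" by (cases "D v") (auto simp: f_def act)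
      from set[OF _ nz D'] D False show False by auto
    qed
  qed
  then show ?thesis by (simp add: act_sum_def f_def)
qed

text \<open>For an arc starting at vertex \<open>1\<close> the sizes with and without left blob
  agree, so the two hooks differ by the factor \<open>[w_1]\<close>, the negative of the blob
  parameter.\<close>

lemma act_sum_GenE: "act_sum q Q1 Q2 n l \<sigma> GenE E = 0"
proof (rule act_sum_end[where v = 1 and e = LBlob and w = "qw q Q1 0"])
  fix D b assume V: "valid_hd n l D" and D: "D 1 = Arc b LBlob"
  note N = valid_nc[OF V]
  have b: "1 < b" "b \<le> n" using ncD[OF N D] by auto
  have "nc n (set_deco 1 b Undec D)" using valid_set_deco_first[OF V D, of Undec] by (simp add: valid_hd_iff)
  moreover have "hook' 1 b LBlob = qw q Q1 0 * hook' 1 b Undec"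
    by (simp add: hook_def hsize_def hunit_def)
  ultimately show "H (set_deco 1 b Undec D) = qw q Q1 0 * H D"
    using H_set_deco[OF N _ D b(1), of Undec] hook_nz[of 1 b Undec] b by simp
next
  fix D b d e' assume "valid_hd n l D" "D 1 = Arc b d" "e' \<in> {Undec, LBlob}"
  then show "valid_hd n l (set_deco 1 b e' D)" using valid_set_deco_first by blast
qed (simp_all add: act_GenE)

lemma act_sum_GenF: "act_sum q Q1 Q2 n l \<sigma> GenF E = 0"
proof (rule act_sum_end[where v = n and e = RBlob and w = "qw q Q2 0"])
  fix D b assume V: "valid_hd n l D" and D: "D n = Arc b RBlob"
  note N = valid_nc[OF V]
  have b: "b < n" "1 \<le> b" using ncD[OF N D] by auto
  note Db = ncD(6)[OF N D]
  have c: "set_deco n b Undec D = set_deco b n Undec D" using b by (intro set_deco_commute) simp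
  have "nc n (set_deco b n Undec D)" using valid_set_deco_last[OF V D, of Undec] c by (simp add: valid_hd_iff)
  moreover have "hook' b n RBlob = qw q Q2 0 * hook' b n Undec"
    by (simp add: hook_def hsize_def hunit_def)
  ultimately show "H (set_deco n b Undec D) = qw q Q2 0 * H D"
    unfolding c using H_set_deco[OF N _ Db b(1), of Undec] hook_nz[of b n Undec] b by simp
next
  fix D b d e' assume "valid_hd n l D" "D n = Arc b d" "e' \<in> {Undec, RBlob}"
  then show "valid_hd n l (set_deco n b e' D)" using valid_set_deco_last by blast
qed (simp_all add: act_GenF)

end

text \<open>The witness for a non-zero image: the hook of its outermost arc is \<open>[l]\<close>
  and cancels the vanishing factor of the numerator.\<close>

definition nested :: "nat \<Rightarrow> hdiag" where
  "nested l v = (if 1 \<le> v \<and> v \<le> 2 * l then Arc (2 * l + 1 - v) Undec else Prop)"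

lemma valid_nested:
  assumes "2 * l \<le> n"
  shows "valid_hd n l (nested l)"
proof -
  have "nc n (nested l)"
  proof (rule ncI)
    fix v w d assume "nested l v = Arc w d"
    then have v: "1 \<le> v" "v \<le> 2 * l" "w = 2 * l + 1 - v" "d = Undec" by (auto simp: nested_def split: if_splits)
    then have "w \<noteq> v" by presburger
    moreover have "1 \<le> w" "w \<le> 2 * l" "2 * l + 1 - w = v" using v by linarith+
    ultimately show "1 \<le> w \<and> w \<le> n \<and> w \<noteq> v \<and> nested l w = Arc v d" using v(4) assms by (simp add: nested_def)
  next
    fix a b d assume ab: "nested l a = Arc b d" "a < b"
    then have v: "1 \<le> a" "b + a = 2 * l + 1" "d = Undec" by (auto simp: nested_def split: if_splits)
    have "tiled (nested l) a b"
      unfolding tiled_def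
    proof (intro allI impI)
      fix v assume "a < v \<and> v < b"
      then show "\<exists>w d. nested l v = Arc w d \<and> a < w \<and> w < b"
        using v by (intro exI[of _ "2 * l + 1 - v"] exI[of _ Undec]) (auto simp: nested_def)
    qed
    then show "tiled (nested l) a b \<and> (d = LBlob \<longrightarrow> tiled (nested l) 0 a) \<and> (d = RBlob \<longrightarrow> tiled (nested l) b (Suc n))"
      using v by simp
  qed
  moreover have "arcv n (nested l) = {1..2 * l}" using assms by (auto simp: arcv_def nested_def)
  ultimately show ?thesis by (simp add: valid_hd_iff)
qed

context hook_place
begin

lemma sp_loopval: "sp (loopval q Q1 Q2 d) (loopval p P1 P2 d)"
  by (cases d) (auto simp: loopval_def intro: sp_uminus sp_qn' sp_qw')

lemma sp_combine: "rel_option (rel_prod sp (=)) (combine q Q1 Q2 d1 d2) (combine p P1 P2 d1 d2)"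
  by (cases d1; cases d2) (auto intro: sp_1 sp_uminus sp_qw')

text \<open>Generic and specialised generators send a diagram to the same diagram; only the scalars
  are specialised.\<close>

lemma sp_act: "rel_option (rel_prod sp (=)) (act q Q1 Q2 n g D) (act p P1 P2 n g D)"
proof (cases g)
  case GenE
  then show ?thesis by (auto simp: act_GenE split: hv.split intro: sp_1 sp_uminus sp_qw')
next
  case GenF
  then show ?thesis by (auto simp: act_GenF split: hv.split intro: sp_1 sp_uminus sp_qw')
next
  case (GenEi i)
  show ?thesis
  proof (cases "\<exists>a d1 b d2. D i = Arc a d1 \<and> D (Suc i) = Arc b d2 \<and> a \<noteq> Suc i")
    case True
    then obtain a d1 b d2 where D: "D i = Arc a d1" "D (Suc i) = Arc b d2" "a \<noteq> Suc i" by blast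
    from sp_combine[of d1 d2] show ?thesis
      unfolding GenEi by (cases rule: option.rel_cases) (auto simp: act.simps D)
  next
    case False
    then show ?thesis unfolding GenEi
      by (auto simp: act.simps split: hv.split intro: sp_1 sp_loopval)
  qed
qed

lemma act_sum_sp: "valid_gen n g \<Longrightarrow> sp (qn q (int l) * act_sum q Q1 Q2 n l \<sigma> g E) 0"
proof (cases g)
  case (GenEi i)
  assume "valid_gen n g"
  then have i: "1 \<le> i" "Suc i \<le> n" using GenEi by (auto simp: valid_gen_def)
  show ?thesis
  proof (cases "valid_hd n l E \<and> E i = Arc (Suc i) Undec")
    case True
    then show ?thesis using total_sp GenEi by (simp add: act_sum_GenEi)
  next
    case False
    have "coef' i E D = 0" if "valid_hd n l D" for D
      using coef_nz[of q Q1 Q2 n \<sigma> i E D] act_target[OF that i] False by metis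
    then have "total i E = 0" by (simp add: clsum_def)
    then show ?thesis using GenEi by (simp add: act_sum_GenEi sp_0)
  qed
qed (simp_all add: act_sum_GenE act_sum_GenF sp_0)

lemma fin_fac: "fin (fac' D a)"
proof -
  have "fin (hunit q Q1 Q2 n a b d)" for b d
    using finI[OF sp_1] finI[OF sp_qw'(1)] finI[OF sp_qw'(2)] by (cases d) (auto simp: hunit_def)
  then have "fin (hook' a b d)" for b d
    unfolding hook_def using fin_mult finI[OF sp_qn'] by blast
  then show ?thesis using finI[OF sp_1] fin_\<sigma> by (auto simp: fac_def split: hv.split)
qed

text \<open>After cancelling the outer hook, \<open>[l] * H (nested l)\<close> is inverse to a
  product of finite factors, so its value has an inverse too.\<close>

lemma nested_nonzero:
  assumes "sp (qn q (int l) * H (nested l)) u"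
  shows "u \<noteq> 0"
proof -
  let ?D = "nested l"
  have l: "qn q (int l) \<noteq> 0" by (rule qn_nz) (use l2 in simp)
  have V: "valid_hd n l ?D" using valid_nested nl by simp
  then have N: "nc n ?D" by (simp add: valid_hd_iff)
  have "?D 1 = Arc (2 * l) Undec" using l2 by (simp add: nested_def)
  moreover have "hook' 1 (2 * l) Undec = qn q (int l)" by (rule hook_Undec) simp
  ultimately have f1: "fac' ?D 1 = qn q (int l)" using l2 by (simp add: fac_def)
  have "1 \<in> {1..n}" using nl by simp
  then have "(\<Prod>a\<in>{1..n}. fac' ?D a) = qn q (int l) * (\<Prod>a\<in>{1..n} - {1}. fac' ?D a)"
    using prod.remove[of "{1..n}" 1 "fac' ?D"] f1 by simp
  moreover have "(\<Prod>a\<in>{1..n}. fac' ?D a) \<noteq> 0" using fac_nz[OF N] by simp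
  ultimately have "qn q (int l) * H ?D * (\<Prod>a\<in>{1..n} - {1}. fac' ?D a) = 1"
    using l by (simp add: hk_def mult.assoc)
  moreover have "fin (\<Prod>a\<in>{1..n} - {1}. fac' ?D a)" by (intro fin_prod fin_fac)
  then obtain w where "sp (\<Prod>a\<in>{1..n} - {1}. fac' ?D a) w" by (auto simp: fin_def)
  ultimately have "sp 1 (u * w)" using sp_mult[OF assms] by metis
  then have "u * w = 1" using sp_unique sp_1 by blast
  then show ?thesis by auto
qed

end

section \<open>Verification of the hypotheses at the root of unity, and the conclusion\<close>

lemma qn_nonzero:
  fixes q :: "'a::field"
  assumes "q \<noteq> 0" "q - inverse q \<noteq> 0" "q powi (2 * m) \<noteq> 1"
  shows "qn q m \<noteq> 0"
proof
  assume "qn q m = 0"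
  then have "q powi m = inverse (q powi m)" using assms(2) by (simp add: qn_def power_int_minus)
  then have "q powi m * q powi m = 1"
    using assms(1) by (metis power_int_eq_0_iff right_inverse)
  then show False using assms(1,3) power_int_add[of q m m] by simp
qed

text \<open>A zero would give \<open>(Q * q powi m) ^ 2 = 1\<close>, that is
  \<open>Q = q powi (- m)\<close> up to sign, which is excluded by \<open>w\<close> not being an
  integer.\<close>

lemma qw_nonzero:
  fixes q :: "'a::field"
  assumes "q \<noteq> 0" "Q \<noteq> 0" "q - inverse q \<noteq> 0" "\<forall>z::int. Q \<noteq> q powi z \<and> Q \<noteq> - (q powi z)"
  shows "qw q Q m \<noteq> 0"
proof
  assume "qw q Q m = 0"
  then have "Q * q powi m = inverse (Q * q powi m)" using assms(3) by (simp add: qw_def power_int_minus)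
  then have "(Q * q powi m) * (Q * q powi m) = 1"
    using assms(1,2) by (metis mult_eq_0_iff power_int_eq_0_iff right_inverse)
  then have "Q * q powi m = 1 \<or> Q * q powi m = - 1" by (simp add: square_eq_1_iff)
  then have "Q = q powi (- m) \<or> Q = - (q powi (- m))"
    using assms(1) by (auto simp: power_int_minus field_simps)
  then show False using assms(4) by blast
qed

definition prop_sign :: "nat \<Rightarrow> nat \<Rightarrow> 'k::field" where
  "prop_sign l a = (if (a - 1) mod (4 * l) < 2 * l then 1 else - 1)"

text \<open>A shift by \<open>2 * l\<close> is half of the period \<open>4 * l\<close>.\<close>

lemma prop_sign_shift:
  assumes "1 \<le> a" "0 < l"
  shows "prop_sign l (a + 2 * l) = - prop_sign l a"
proof -
  define r where "r = (a - 1) mod (4 * l)"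
  have r: "r < 4 * l" using assms by (simp add: r_def)
  have "(a + 2 * l - 1) mod (4 * l) = (r + 2 * l) mod (4 * l)"
    using assms by (simp add: r_def mod_add_left_eq)
  also have "\<dots> = (if r < 2 * l then r + 2 * l else r - 2 * l)"
    using r by (auto simp: mod_if not_less)
  finally have "(a + 2 * l - 1) mod (4 * l) < 2 * l \<longleftrightarrow> \<not> (a - 1) mod (4 * l) < 2 * l"
    unfolding r_def[symmetric] using r by auto
  then show ?thesis by (simp add: prop_sign_def)
qed

lemma hook_place_spec_at:
  fixes q Q1 Q2 :: "'k::field"
  assumes root: "prim_root q (2 * l)" and qwd: "q - inverse q \<noteq> 0" and nl: "2 * l < n"
    and Q1: "Q1 \<noteq> 0" "\<forall>z::int. Q1 \<noteq> q powi z \<and> Q1 \<noteq> - (q powi z)"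
    and Q2: "Q2 \<noteq> 0" "\<forall>z::int. Q2 \<noteq> q powi z \<and> Q2 \<noteq> - (q powi z)"
  shows "hook_place (\<lambda>F v. spec_at F q Q1 Q2 v) Vq VQ1 VQ2 n l (prop_sign l) q Q1 Q2"
proof -
  interpret place "\<lambda>F v. spec_at F q Q1 Q2 v" by (rule place_spec_at)
  have l: "0 < l" and q1: "q ^ (2 * l) = 1" and qj: "\<And>j. 0 < j \<Longrightarrow> j < 2 * l \<Longrightarrow> q ^ j \<noteq> 1"
    using root by (auto simp: prim_root_def)
  have q0: "q \<noteq> 0" using q1 l by (metis mult_pos_pos power_0_left zero_neq_one less_not_refl2 zero_less_numeral)
  \<comment> \<open>For \<open>l = 1\<close> the quantum numbers are undefined, since
    \<open>q * q = 1\<close> makes their denominator \<open>q - inverse q\<close> vanish.\<close>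
  have l1: "l \<noteq> 1"
  proof
    assume "l = 1"
    then have "q * q = 1" using q1 by (simp add: power2_eq_square)
    then show False using qwd by (simp add: inverse_unique)
  qed
  have spV: "spec_at Vq q Q1 Q2 q" "spec_at VQ1 q Q1 Q2 Q1" "spec_at VQ2 q Q1 Q2 Q2"
    unfolding Vq_def VQ1_def VQ2_def
    using spec_at_Fract_1[of "[:[:[:0, 1:]:]:]" q Q1 Q2] spec_at_Fract_1[of "[:[:0, 1:]:]" q Q1 Q2]
      spec_at_Fract_1[of "[:0, 1:]" q Q1 Q2] by (simp_all only: eval3_Vars)
  have Vnz: "(Vq :: 'k rfun) \<noteq> 0" "(VQ1 :: 'k rfun) \<noteq> 0" "(VQ2 :: 'k rfun) \<noteq> 0"
    using sp_nonzero[OF spV(1) q0] sp_nonzero[OF spV(2) Q1(1)] sp_nonzero[OF spV(3) Q2(1)] by auto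
  have Vd: "(Vq :: 'k rfun) - inverse Vq \<noteq> 0"
    using sp_nonzero[OF sp_diff[OF spV(1) sp_inverse[OF spV(1) q0]] qwd] .
  have qn_nz: "qn (Vq :: 'k rfun) m \<noteq> 0" if "m \<noteq> 0" for m
  proof (rule qn_nonzero[OF Vnz(1) Vd])
    show "(Vq :: 'k rfun) powi (2 * m) \<noteq> 1"
    proof (cases "0 \<le> m")
      case True
      then show ?thesis using Vq_power_ne_1[of "nat (2 * m)"] that by (simp add: power_int_def)
    next
      case False
      then show ?thesis using Vq_power_ne_1[of "nat (- 2 * m)"] by (simp add: power_int_def power_inverse)
    qed
  qed
  have w1: "qw q Q1 m \<noteq> 0" and w2: "qw q Q2 m \<noteq> 0" for m
    using qw_nonzero[OF q0 Q1(1) qwd Q1(2)] qw_nonzero[OF q0 Q2(1) qwd Q2(2)] by auto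
  have W: "qw (Vq :: 'k rfun) VQ1 m \<noteq> 0" "qw (Vq :: 'k rfun) VQ2 m \<noteq> 0" for m
    using sp_nonzero[OF sp_qw[OF spV(1,2) q0 Q1(1) qwd] w1] sp_nonzero[OF sp_qw[OF spV(1,3) q0 Q2(1) qwd] w2] by auto
  have "(q ^ l) * (q ^ l) = 1" using q1 by (simp add: power_add[symmetric] mult_2)
  then have pl: "q ^ l = - 1" using qj[of l] l by (simp add: square_eq_1_iff)
  have qn_p: "qn q m \<noteq> 0" if "0 < m" "m < int l" for m
  proof (rule qn_nonzero[OF q0 qwd])
    show "q powi (2 * m) \<noteq> 1" using qj[of "nat (2 * m)"] that by (simp add: power_int_def)
  qed
  have sign: "prop_sign l a = (1 :: 'k rfun) \<or> prop_sign l a = (- 1 :: 'k rfun)" for a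
    by (simp add: prop_sign_def)
  have sign0: "prop_sign l a \<noteq> (0 :: 'k rfun)" for a
    by (simp add: prop_sign_def)
  have shift: "prop_sign l (a + 2 * l) = - (prop_sign l a :: 'k rfun)" if "1 \<le> a" for a
    by (rule prop_sign_shift[OF that l])
  show ?thesis
    by unfold_locales
      (use spV Vnz Vd qn_nz W nl q0 Q1(1) Q2(1) qwd pl qn_p w1 w2 l l1 sign sign0 shift in auto)
qed

lemma h3_eq:
  "(h3 n l D :: 'k::field rfun) = ((\<Prod>j\<in>{1..l}. qn Vq (int j)) * (\<Prod>j<l. qw Vq VQ1 (- int j)) * (\<Prod>j<l. qw Vq VQ2 (- int j)))
     * hk Vq VQ1 VQ2 n (prop_sign l) D"
proof -
  have q: "fqn = (qn Vq :: int \<Rightarrow> 'k rfun)" "fqw Q = (qw Vq Q :: int \<Rightarrow> 'k rfun)" for Q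
    by (auto simp: fqn_def qn_def fqw_def qw_def fun_eq_iff)
  have "h3_fac n l D a = (fac Vq VQ1 VQ2 n (prop_sign l) D a :: 'k rfun)" for a
    by (auto simp: h3_fac_def fac_def prop_sign_def hook_def hsize_def hunit_def q split: hv.split deco.split)
  then show ?thesis by (simp add: h3_def hk_def q divide_inverse)
qed

theorem theorem4p3p2:
  fixes q Q1 Q2 :: "'k::field" and n l :: nat
  assumes root: "prim_root q (2 * l)"
    and qwd: "q - inverse q \<noteq> 0"
    and nl: "2 * l < n"
    and Q1: "Q1 \<noteq> 0" "\<forall>z::int. Q1 \<noteq> q powi z \<and> Q1 \<noteq> - (q powi z)"
    and Q2: "Q2 \<noteq> 0" "\<forall>z::int. Q2 \<noteq> q powi z \<and> Q2 \<noteq> - (q powi z)"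
  defines "xiE \<equiv> (\<lambda>D. if valid_hd n l D then specialize (h3 n l D :: 'k rfun) q Q1 Q2 else 0)"
  shows "(\<forall>D. valid_hd n l D \<longrightarrow> specializable (h3 n l D :: 'k rfun) q Q1 Q2)
         \<and> (\<exists>D. valid_hd n l D \<and> xiE D \<noteq> 0)
         \<and> (\<forall>g. valid_gen n g \<longrightarrow> act_vec q Q1 Q2 n l g xiE = (\<lambda>_. 0))"
proof -
  let ?sp = "\<lambda>F v. spec_at F q Q1 Q2 v"
  interpret hook_place ?sp Vq VQ1 VQ2 n l "prop_sign l" q Q1 Q2
    by (rule hook_place_spec_at[OF root qwd nl Q1 Q2])
  \<comment> \<open>The numerator of \<open>h3\<close> without its factor \<open>[l]\<close>; its
    value \<open>\<nu>\<close> is non-zero, and \<open>[l]\<close> is kept together with the inverse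
    hook product.\<close>
  define N where "N = (\<Prod>j\<in>{1..<l}. qn (Vq :: 'k rfun) (int j)) * (\<Prod>j<l. qw Vq VQ1 (- int j)) * (\<Prod>j<l. qw Vq VQ2 (- int j))"
  define \<nu> where "\<nu> = (\<Prod>j\<in>{1..<l}. qn q (int j)) * (\<Prod>j<l. qw q Q1 (- int j)) * (\<Prod>j<l. qw q Q2 (- int j))"
  have N: "?sp N \<nu>" unfolding N_def \<nu>_def by (intro sp_mult sp_prod sp_qn' sp_qw')
  have \<nu>: "\<nu> \<noteq> 0" unfolding \<nu>_def using qn_p qw_p by simp
  have "{1..l} = insert l {1..<l}" using l2 by auto
  then have h3: "h3 n l D = N * (qn Vq (int l) * H D)" for D
    unfolding h3_eq N_def by (simp add: mult_ac)
  have fin3: "\<exists>v. ?sp (h3 n l D) v" if "valid_hd n l D" for D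
    unfolding h3 using fin_mult[OF finI[OF N] fin_qn_l_H[OF that]] by (simp add: fin_def)
  have xi: "?sp (h3 n l D) (xiE D)" if V: "valid_hd n l D" for D
  proof -
    obtain v where v: "?sp (h3 n l D) v" using fin3[OF V] by blast
    then show ?thesis using specialize_eq[OF v] V by (simp add: xiE_def)
  qed
  have V0: "valid_hd n l (nested l)" using valid_nested nl by simp
  have "xiE (nested l) \<noteq> 0"
  proof -
    obtain u where u: "?sp (qn Vq (int l) * H (nested l)) u" using fin_qn_l_H[OF V0] by (auto simp: fin_def)
    have "?sp (h3 n l (nested l)) (\<nu> * u)" unfolding h3 by (rule sp_mult[OF N u])
    then have "xiE (nested l) = \<nu> * u" using sp_unique xi[OF V0] by blast
    then show ?thesis using nested_nonzero[OF u] \<nu> by simp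
  qed
  moreover have "act_vec q Q1 Q2 n l g xiE = (\<lambda>_. 0)" if g: "valid_gen n g" for g
  proof
    fix E
    \<comment> \<open>The place respects finite sums and the action, so the coefficient wanted is
      the value of the generic coefficient. The latter is \<open>N\<close> times an expression with
      value \<open>0\<close>, and values are unique.\<close>
    have "?sp (\<Sum>D\<in>{D. valid_hd n l D}. case act Vq VQ1 VQ2 n g D of None \<Rightarrow> 0
       | Some (c, E') \<Rightarrow> if E' = E then c * h3 n l D else 0) (act_vec q Q1 Q2 n l g xiE E)"
      unfolding act_vec_def
    proof (rule sp_sum)
      fix D assume "D \<in> {D. valid_hd n l D}"
      then have "?sp (h3 n l D) (xiE D)" using xi by simp
      with sp_act[of g D] show "?sp (case act Vq VQ1 VQ2 n g D of None \<Rightarrow> 0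
          | Some (c, E') \<Rightarrow> if E' = E then c * h3 n l D else 0)
         (case act q Q1 Q2 n g D of None \<Rightarrow> 0 | Some (c, E') \<Rightarrow> if E' = E then c * xiE D else 0)"
        by (cases rule: option.rel_cases) (auto intro: sp_0 sp_mult)
    qed
    moreover have "(\<Sum>D\<in>{D. valid_hd n l D}. case act Vq VQ1 VQ2 n g D of None \<Rightarrow> 0
       | Some (c, E') \<Rightarrow> if E' = E then c * h3 n l D else 0)
       = N * (qn Vq (int l) * act_sum Vq VQ1 VQ2 n l (prop_sign l) g E)"
      unfolding act_sum_def sum_distrib_left
      by (rule sum.cong) (auto simp: h3 mult_ac split: option.split)
    moreover have "?sp (N * (qn Vq (int l) * act_sum Vq VQ1 VQ2 n l (prop_sign l) g E)) (\<nu> * 0)"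
      by (rule sp_mult[OF N act_sum_sp[OF g]])
    ultimately show "act_vec q Q1 Q2 n l g xiE E = 0" using sp_unique by fastforce
  qed
  ultimately show ?thesis using fin3 V0 unfolding specializable_def by blast
qed

end
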